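(* Suppose $P$ is a quasi-compact natural collision operator, and that the Truncated Variance Assumption (stated in the context) holds. Then, for any $t>0$, the sum $\sum_{j=0}^{N_{a,t}-1}a^{-1}Z_j$ converges in distribution to $\mathcal{N}(0,t\mathcal{D})$ as $a\to\infty$, where $$\mathcal{D}=\lim_{a\to\infty}\frac{1}{a^2t}\,\mathbb{E}_\nu\left[\left(\sum_{j=0}^{N_{a,t}-1}Z_{a,j}\right)^2\right].$$
   Context: Setting. Let $n\ge2$, $k=n-1$, $r>0$; the channel is $\mathbb{R}^{n-1}\times[-r,r]$. $\mathbb{H}=\{v\in\mathbb{R}^n:\langle v,e_n\rangle>0\}$ is the space of post-collision velocities ($e_n$ corresponding to the inward unit normal; pre-collision velocities are identified with elements of $\mathbb{H}$ by mirror reflection). A collision operator is a Markov operator $(P\phi)(v)=\int_{\mathbb{H}}\phi\,d\eta_v$, with $v\mapsto\eta_v$ a measurable map into the probability measures on $\mathbb{H}$. With $M,\beta>0$, $d\mu_\beta(v)=2\pi(\beta M/2\pi)^{(n+1)/2}\langle v,e_n\rangle e^{-\beta M|v|^2/2}dV(v)$; for $s>0$, $\mu$ is the probability measure on the hemisphere $\{v\in\mathbb{H}:|v|=s\}$ with density proportional to $\langle v,e_n\rangle$ with respect to surface measure. $P$ is natural if either (a) $\mu_\beta$ is its unique stationary distribution for some $\beta$ (then $\nu:=\mu_\beta$) or (b) $P$ does not change the speed and $\mu$ is stationary for all $s$ (then $\nu:=\mu$ for a fixed $s$), and in both cases detailed balance $\nu(dv)\eta_v(du)=\nu(du)\eta_u(dv)$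 holds. $P$ is then self-adjoint on $L^2(\mathbb{H},\nu)$; it is quasi-compact if its spectral radius on the orthogonal complement of the constants is strictly less than $1$. Process. $V_0,V_1,\dots$ is the stationary Markov chain with transition operator $P$ and initial law $\nu$; $\mathbb{E}_\nu$ is the corresponding expectation. The free-flight time after velocity $v$ is $\tau_b(v)=2r/\langle v,e_n\rangle$; $\tau_j=\tau_b(V_j)$; $N_t$ is the number of collisions in $[0,t]$, i.e. $\tau_0+\dots+\tau_{N_t-1}\le t\le\tau_0+\dots+\tau_{N_t}$. With $h(a)=a/\log a$, $N_{a,t}:=N_{ah(a)t}$ (the number of collisions in $[0,t]$ for the $a$-scaled system, with channel radius $r/a$ and velocities multiplied by $h(a)$). Observable. $Z:\mathbb{H}\to\mathbb{R}$ is any real measurable function that is $\nu$-integrable with mean $0$ and slowly varying at infinity in the sense that $\mathbb{E}_\nu[Z^2\mathbf{1}_{\{|Z|\le a\}}]\sim C\log a$ as $a\to\infty$ for a constant $C>0$ (e.g. a component $\langle u,Z(v)\rangle$ of the horizontal between-collisions displacement). $Z_j=Z(V_j)$, $Z_a=Z\mathbf{1}_{\{|Z|\le a\}}$, $Z_{a,j}=Z_a(V_j)$. Truncated Variance Assumption. Let $\gamma>1$ and let $Z_{a,\gamma,j}=Z_j\mathbf{1}_{\{|Z_j|\le ar/\log^\gamma a\}}$. For any $t>0$, $\lim_{a\to\infty}\mathbb{E}_\nu\left[\left(\frac1a\sum_{j=0}^{N_{a,t}}Z_{a,\gamma,j}\right)^2\right]$ exists. *)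

theory Defs
  imports "HOL-Probability.Probability" "HOL-Library.Landau_Symbols"
begin

section \<open>Velocities and collision operators\<close>

text \<open>
  Velocities live in \<^typ>\<open>real ^ 'n\<close>; the coordinate \<open>i\<close> is the one normal to the channel
  walls, so that \<open>v $ i\<close> is the inner product of \<open>v\<close> with the inward unit normal.
\<close>

definition halfspace :: "'n \<Rightarrow> (real ^ 'n::finite) set" where
  "halfspace i = {v. v $ i > 0}"

definition vel_space :: "'n \<Rightarrow> (real ^ 'n::finite) measure" where
  "vel_space i = restrict_space borel (halfspace i)"

text \<open>A collision operator is given by its kernel \<open>\<eta>\<close>, a measurable map into the probability
  measures on the half-space.\<close>

definition collision_kernel ::
    "'n \<Rightarrow> (real ^ 'n \<Rightarrow> (real ^ 'n::finite) measure) \<Rightarrow> bool" where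
  "collision_kernel i \<eta> \<longleftrightarrow> \<eta> \<in> vel_space i \<rightarrow>\<^sub>M prob_algebra (vel_space i)"

definition kernel_op :: "('a \<Rightarrow> 'a measure) \<Rightarrow> ('a \<Rightarrow> complex) \<Rightarrow> 'a \<Rightarrow> complex" where
  "kernel_op \<eta> \<phi> v = (\<integral>u. \<phi> u \<partial>\<eta> v)"

definition stationary :: "('a \<Rightarrow> 'a measure) \<Rightarrow> 'a measure \<Rightarrow> bool" where
  "stationary \<eta> \<nu> \<longleftrightarrow> \<nu> \<bind> \<eta> = \<nu>"

text \<open>Equality of the measures \<open>\<nu>(dv) \<eta>\<^sub>v(du)\<close> and \<open>\<nu>(du) \<eta>\<^sub>u(dv)\<close> on pairs \<open>(v, u)\<close>.\<close>

definition detailed_balance :: "('a \<Rightarrow> 'a measure) \<Rightarrow> 'a measure \<Rightarrow> bool" where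
  "detailed_balance \<eta> \<nu> \<longleftrightarrow>
     (\<forall>C \<in> sets (\<nu> \<Otimes>\<^sub>M \<nu>).
        (\<integral>\<^sup>+v. emeasure (\<eta> v) {u \<in> space \<nu>. (v, u) \<in> C} \<partial>\<nu>) =
        (\<integral>\<^sup>+u. emeasure (\<eta> u) {v \<in> space \<nu>. (v, u) \<in> C} \<partial>\<nu>))"


section \<open>The equilibrium distributions\<close>

definition maxwellian :: "'n \<Rightarrow> real \<Rightarrow> real \<Rightarrow> (real ^ 'n::finite) measure" where
  "maxwellian i M \<beta> =
     density (restrict_space lborel (halfspace i))
       (\<lambda>v. ennreal (2 * pi * (\<beta> * M / (2 * pi)) powr ((real CARD('n) + 1) / 2) *
                     (v $ i) * exp (- \<beta> * M * (norm v)\<^sup>2 / 2)))"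

text \<open>
  Surface measure on the sphere of radius \<open>s > 0\<close> about the origin, through the cone formula:
  the area of \<open>A\<close> is \<open>n / s\<close> times the volume of the solid cone over \<open>A\<close> with apex \<open>0\<close>.
\<close>

definition sphere_measure :: "real \<Rightarrow> (real ^ 'n::finite) measure" where
  "sphere_measure s =
     scale_measure (ennreal (real CARD('n) / s))
       (distr (restrict_space lborel (cball 0 s)) borel (\<lambda>x. (s / norm x) *\<^sub>R x))"

definition cosine_law :: "'n \<Rightarrow> real \<Rightarrow> (real ^ 'n::finite) measure" where
  "cosine_law i s =
     density (restrict_space (sphere_measure s) (halfspace i))
       (\<lambda>v. ennreal (v $ i) /
            (\<integral>\<^sup>+u. ennreal (u $ i) \<partial>restrict_space (sphere_measure s) (halfspace i)))"


section \<open>Natural and quasi-compact operators\<close>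

text \<open>The measure \<open>\<nu>\<close> is an argument because it depends on the alternative and, in the
  second one, on the chosen speed \<open>s\<close>.\<close>

definition natural_collision ::
    "'n \<Rightarrow> real \<Rightarrow> (real ^ 'n \<Rightarrow> (real ^ 'n::finite) measure) \<Rightarrow> (real ^ 'n) measure \<Rightarrow> bool" where
  "natural_collision i M \<eta> \<nu> \<longleftrightarrow>
     ((\<exists>\<beta>>0. stationary \<eta> (maxwellian i M \<beta>) \<and>
              (\<forall>\<pi> \<in> space (prob_algebra (vel_space i)).
                 stationary \<eta> \<pi> \<longrightarrow> \<pi> = maxwellian i M \<beta>) \<and>
              \<nu> = maxwellian i M \<beta>) \<or>
      ((\<forall>v \<in> halfspace i. AE u in \<eta> v. norm u = norm v) \<and>
       (\<forall>s>0. stationary \<eta> (cosine_law i s)) \<and>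
       (\<exists>s>0. \<nu> = cosine_law i s))) \<and>
     detailed_balance \<eta> \<nu>"

text \<open>Square-integrable functions are not quotiented by null sets; equality in the Hilbert space
  is equality almost everywhere.\<close>

definition square_integrable :: "'a measure \<Rightarrow> ('a \<Rightarrow> complex) set" where
  "square_integrable \<nu> = {\<phi> \<in> borel_measurable \<nu>. integrable \<nu> (\<lambda>v. (cmod (\<phi> v))\<^sup>2)}"

definition norm_L2 :: "'a measure \<Rightarrow> ('a \<Rightarrow> complex) \<Rightarrow> real" where
  "norm_L2 \<nu> \<phi> = sqrt (\<integral>v. (cmod (\<phi> v))\<^sup>2 \<partial>\<nu>)"

definition orth_constants :: "'a measure \<Rightarrow> ('a \<Rightarrow> complex) set" where
  "orth_constants \<nu> = {\<phi> \<in> square_integrable \<nu>. \<forall>c. (\<integral>v. \<phi> v * cnj c \<partial>\<nu>) = 0}"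

text \<open>The complex spectrum of the operator on the orthogonal complement of the constants:
  \<open>z\<close> is in the resolvent set iff \<open>z - P\<close> is a bijection of this space with bounded inverse.\<close>

definition resolvent_set_orth :: "('a \<Rightarrow> 'a measure) \<Rightarrow> 'a measure \<Rightarrow> complex set" where
  "resolvent_set_orth \<eta> \<nu> =
     {z. \<exists>B. \<forall>\<psi> \<in> orth_constants \<nu>.
           \<exists>\<phi> \<in> orth_constants \<nu>.
             (AE v in \<nu>. z * \<phi> v - kernel_op \<eta> \<phi> v = \<psi> v) \<and>
             norm_L2 \<nu> \<phi> \<le> B * norm_L2 \<nu> \<psi> \<and>
             (\<forall>\<phi>' \<in> orth_constants \<nu>.
                (AE v in \<nu>. z * \<phi>' v - kernel_op \<eta> \<phi>' v = \<psi> v) \<longrightarrow> (AE v in \<nu>. \<phi>' v = \<phi> v))}"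

definition spectral_radius_orth :: "('a \<Rightarrow> 'a measure) \<Rightarrow> 'a measure \<Rightarrow> ennreal" where
  "spectral_radius_orth \<eta> \<nu> = (SUP z \<in> - resolvent_set_orth \<eta> \<nu>. ennreal (cmod z))"

definition quasi_compact :: "('a \<Rightarrow> 'a measure) \<Rightarrow> 'a measure \<Rightarrow> bool" where
  "quasi_compact \<eta> \<nu> \<longleftrightarrow> spectral_radius_orth \<eta> \<nu> < 1"


section \<open>The collision process\<close>

definition history ::
    "'w measure \<Rightarrow> 'a measure \<Rightarrow> (nat \<Rightarrow> 'w \<Rightarrow> 'a) \<Rightarrow> nat \<Rightarrow> 'w measure" where
  "history \<Omega> S V k =
     vimage_algebra (space \<Omega>) (\<lambda>\<omega>. \<lambda>j\<in>{..k}. V j \<omega>) (PiM {..k} (\<lambda>_. S))"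

definition markov_chain ::
    "'w measure \<Rightarrow> 'a measure \<Rightarrow> 'a measure \<Rightarrow> ('a \<Rightarrow> 'a measure) \<Rightarrow> (nat \<Rightarrow> 'w \<Rightarrow> 'a) \<Rightarrow> bool" where
  "markov_chain \<Omega> S \<nu> \<eta> V \<longleftrightarrow>
     prob_space \<Omega> \<and>
     (\<forall>k. V k \<in> \<Omega> \<rightarrow>\<^sub>M S) \<and>
     distr \<Omega> S (V 0) = \<nu> \<and>
     (\<forall>k. \<forall>A \<in> sets S. AE \<omega> in \<Omega>.
        real_cond_exp \<Omega> (history \<Omega> S V k) (indicator (V (Suc k) -` A \<inter> space \<Omega>)) \<omega> =
        measure (\<eta> (V k \<omega>)) A)"

definition flight_time :: "'n \<Rightarrow> real \<Rightarrow> real ^ 'n::finite \<Rightarrow> real" where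
  "flight_time i r v = 2 * r / (v $ i)"

text \<open>
  The \<open>k\<close>-th collision (\<open>k \<ge> 1\<close>) happens at the sum of the first \<open>k\<close> flight times. On the event
  that infinitely many collisions happen in finite time, \<^const>\<open>card\<close> gives \<open>0\<close>.
\<close>

definition collisions ::
    "'n \<Rightarrow> real \<Rightarrow> (nat \<Rightarrow> 'w \<Rightarrow> real ^ 'n::finite) \<Rightarrow> real \<Rightarrow> 'w \<Rightarrow> nat" where
  "collisions i r V t \<omega> = card {k. k \<ge> 1 \<and> (\<Sum>j<k. flight_time i r (V j \<omega>)) \<le> t}"

lemma collisions_bounds:
  assumes pos: "\<And>j. V j \<omega> \<in> halfspace i" and "r > 0" "t \<ge> 0"
    and fin: "finite {k. k \<ge> 1 \<and> (\<Sum>j<k. flight_time i r (V j \<omega>)) \<le> t}"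
  shows "(\<Sum>j<collisions i r V t \<omega>. flight_time i r (V j \<omega>)) \<le> t"
    and "t < (\<Sum>j<Suc (collisions i r V t \<omega>). flight_time i r (V j \<omega>))"
proof -
  let ?S = "\<lambda>k. \<Sum>j<k. flight_time i r (V j \<omega>)"
  let ?N = "collisions i r V t \<omega>"
  let ?K = "{k. k \<ge> 1 \<and> ?S k \<le> t}"
  have nonneg: "flight_time i r (V j \<omega>) \<ge> 0" for j
    using pos[of j] \<open>r > 0\<close> by (simp add: flight_time_def halfspace_def)
  have mono: "?S k \<le> ?S l" if "k \<le> l" for k l
    using that nonneg by (intro sum_mono2) auto
  define m where "m = Max (insert 0 ?K)"
  have m_in: "m \<in> insert 0 ?K"
    unfolding m_def using fin by (intro Max_in) auto
  have m_ge: "k \<le> m" if "k \<in> ?K" for k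
    unfolding m_def using fin that by (intro Max_ge) auto
  have Sm: "?S m \<le> t"
    using m_in \<open>t \<ge> 0\<close> by auto
  have "?K = {1..m}"
  proof (intro equalityI subsetI)
    fix k assume "k \<in> {1..m}"
    then show "k \<in> ?K" using mono[of k m] Sm by auto
  qed (use m_ge in auto)
  then have N: "?N = m"
    unfolding collisions_def by simp
  show "?S ?N \<le> t"
    using Sm N by simp
  have "Suc m \<notin> ?K"
    using m_ge[of "Suc m"] by auto
  then show "t < ?S (Suc ?N)"
    using N by auto
qed

definition scaled_collisions ::
    "'n \<Rightarrow> real \<Rightarrow> (nat \<Rightarrow> 'w \<Rightarrow> real ^ 'n::finite) \<Rightarrow> real \<Rightarrow> real \<Rightarrow> 'w \<Rightarrow> nat" where
  "scaled_collisions i r V a t \<omega> = collisions i r V (a * (a / ln a) * t) \<omega>"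


section \<open>Observables and the limit law\<close>

definition truncate :: "real \<Rightarrow> real \<Rightarrow> real" where
  "truncate c z = z * indicator {x. \<bar>x\<bar> \<le> c} z"

definition slowly_varying_observable :: "'a measure \<Rightarrow> ('a \<Rightarrow> real) \<Rightarrow> bool" where
  "slowly_varying_observable \<nu> Z \<longleftrightarrow>
     integrable \<nu> Z \<and> (\<integral>v. Z v \<partial>\<nu>) = 0 \<and>
     (\<exists>C>0. (\<lambda>a. \<integral>v. (Z v)\<^sup>2 * indicator {x. \<bar>x\<bar> \<le> a} (Z v) \<partial>\<nu>) \<sim>[at_top] (\<lambda>a. C * ln a))"

definition truncated_variance_assumption ::
    "'w measure \<Rightarrow> 'n \<Rightarrow> real \<Rightarrow> (nat \<Rightarrow> 'w \<Rightarrow> real ^ 'n::finite) \<Rightarrow> (real ^ 'n \<Rightarrow> real) \<Rightarrow> real \<Rightarrow> bool"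
  where
  "truncated_variance_assumption \<Omega> i r V Z \<gamma> \<longleftrightarrow>
     (\<forall>t>0. \<exists>L. ((\<lambda>a. \<integral>\<omega>. (1 / a * (\<Sum>j\<le>scaled_collisions i r V a t \<omega>.
                     truncate (a * r / ln a powr \<gamma>) (Z (V j \<omega>))))\<^sup>2 \<partial>\<Omega>) \<longlongrightarrow> L) at_top)"

text \<open>The centred normal law with variance \<open>\<sigma>2\<close>; a vanishing variance gives the point mass at \<open>0\<close>.\<close>

definition normal_law :: "real \<Rightarrow> real measure" where
  "normal_law \<sigma>2 =
     (if \<sigma>2 = 0 then return borel 0
      else density lborel (\<lambda>x. ennreal (normal_density 0 (sqrt \<sigma>2) x)))"

text \<open>Convergence in distribution for a real parameter tending to infinity, reduced to the
  sequential notion along all sequences that tend to infinity.\<close>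

definition conv_in_distribution ::
    "'w measure \<Rightarrow> (real \<Rightarrow> 'w \<Rightarrow> real) \<Rightarrow> real measure \<Rightarrow> bool" where
  "conv_in_distribution \<Omega> X \<mu> \<longleftrightarrow>
     (\<forall>\<alpha>. filterlim \<alpha> at_top sequentially \<longrightarrow>
        weak_conv_m (\<lambda>k. distr \<Omega> borel (X (\<alpha> k))) \<mu>)"

end

theory Submission
  imports Defs "HOL-Real_Asymp.Real_Asymp"
begin

text \<open>
  Why the theorem holds. Detailed balance makes the averaging operator \<open>P\<close> self-adjoint, and
  quasi-compactness puts \<open>1\<close> and \<open>-1\<close> into the resolvent set on mean-zero functions; together they
  give \<open>\<parallel>P f\<parallel> \<le> \<rho> \<parallel>f\<parallel>\<close> for mean-zero \<open>f\<close> and some \<open>\<rho> < 1\<close> (\<open>spectral_gap\<close>). Only bounded \<open>f\<close> are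
  considered; everything unbounded is truncated before \<open>P\<close> is applied.

  Up to time \<open>t\<close> there are about \<open>a\<^sup>2 t / (\<theta> ln a)\<close> collisions, \<open>\<theta>\<close> being the mean flight time,
  which is finite because the density of \<open>\<nu>\<close> contains the factor \<open>v $ i\<close> (\<open>integrable_flight_time\<close>).
  The law of large numbers for the flight times, obtained from the gap after truncation, and an
  exponential bound on the event that the flight times of many collisions add up to little
  (\<open>multiplicative_functional_decay\<close>) show that the count is concentrated in mean square
  (\<open>truncated_count_L2\<close>, \<open>count_square_tail\<close>).

  The observable is cut at level \<open>a r / (ln a) ^ \<gamma>\<close>. As the truncated second moment grows like
  \<open>ln a\<close>, the part between this level and \<open>a\<close> has second moment \<open>o(ln a)\<close> and is negligible after
  summing \<open>O(a\<^sup>2 / ln a)\<close> terms, and with high probability no value beyond \<open>a\<close> occurs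
  (\<open>full_sum_approximation\<close>, \<open>exceptional_negligible\<close>). The centred truncated observable \<open>f\<close> is
  written as \<open>f = g - P g + P\<^sup>K f\<close> with \<open>g = f + P f + \<dots> + P\<^sup>K\<^sup>-\<^sup>1 f\<close> and \<open>K\<close> about \<open>ln a\<close>: the remainder is
  small in mean square, \<open>g\<close> is \<open>o(a)\<close> uniformly because \<open>\<gamma> > 1\<close>, and \<open>g - P g\<close> sums to a martingale
  and two boundary terms. Second moments of stopped martingales are computed by orthogonality,
  which allows the random number of collisions to be replaced by a deterministic one
  (\<open>stopped_sum_approximation\<close>).

  The variance assumption concerns sums that are not centred. Their second moment is, up to
  \<open>o(1)\<close>, the variance of the martingale, linear in \<open>t\<close>, plus the square of a drift, quadratic in
  \<open>t\<close>; comparing \<open>t = 1\<close> and \<open>t = 2\<close> shows that the variance per unit time converges to some \<open>D\<close>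
  (\<open>asymp_var_converges\<close>). At truncation level \<open>a\<close> the drift is negligible, so \<open>D\<close> is the limit in
  the theorem (\<open>full_second_moment\<close>).

  Finally, the characteristic function of the martingale satisfies an approximate one-step
  recursion with factor \<open>1 - u\<^sup>2 \<sigma>\<^sup>2 / (2 a\<^sup>2)\<close>, the conditional variance being decorrelated from the
  past by the gap (\<open>mart_exp_step\<close>). Hence it converges to that of the normal law, and Levy's
  continuity theorem concludes.
\<close>


section \<open>Bounded functions and mean squares\<close>

definition bounded_measurable :: "'a measure \<Rightarrow> ('a \<Rightarrow> real) set" where
  "bounded_measurable M = {f \<in> borel_measurable M. \<exists>B. \<forall>x\<in>space M. \<bar>f x\<bar> \<le> B}"

lemma bounded_measurableI:
  "f \<in> borel_measurable M \<Longrightarrow> (\<And>x. x \<in> space M \<Longrightarrow> \<bar>f x\<bar> \<le> B) \<Longrightarrow> f \<in> bounded_measurable M"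
  by (auto simp: bounded_measurable_def)

lemma bounded_measurable_measurable: "f \<in> bounded_measurable M \<Longrightarrow> f \<in> borel_measurable M"
  by (auto simp: bounded_measurable_def)

lemma bounded_measurableE:
  assumes "f \<in> bounded_measurable M"
  obtains B where "B \<ge> 0" "\<And>x. x \<in> space M \<Longrightarrow> \<bar>f x\<bar> \<le> B"
proof -
  obtain B where "\<And>x. x \<in> space M \<Longrightarrow> \<bar>f x\<bar> \<le> B"
    using assms by (auto simp: bounded_measurable_def)
  then show ?thesis by (intro that[of "max B 0"]) (auto simp: le_max_iff_disj)
qed

lemma bounded_measurable_const: "(\<lambda>_. c) \<in> bounded_measurable M"
  by (auto simp: bounded_measurable_def)

lemma bounded_measurable_add:
  assumes "f \<in> bounded_measurable M" "g \<in> bounded_measurable M"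
  shows "(\<lambda>x. f x + g x) \<in> bounded_measurable M"
proof -
  obtain B C where "\<And>x. x \<in> space M \<Longrightarrow> \<bar>f x\<bar> \<le> B" "\<And>x. x \<in> space M \<Longrightarrow> \<bar>g x\<bar> \<le> C"
    using assms[THEN bounded_measurableE] by metis
  then show ?thesis
    using assms[THEN bounded_measurable_measurable]
    by (intro bounded_measurableI[where B="B + C"]) (auto intro!: order_trans[OF abs_triangle_ineq] add_mono)
qed

lemma bounded_measurable_mult:
  assumes "f \<in> bounded_measurable M" "g \<in> bounded_measurable M"
  shows "(\<lambda>x. f x * g x) \<in> bounded_measurable M"
proof -
  obtain B C where "B \<ge> 0" "\<And>x. x \<in> space M \<Longrightarrow> \<bar>f x\<bar> \<le> B" "\<And>x. x \<in> space M \<Longrightarrow> \<bar>g x\<bar> \<le> C"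
    using assms[THEN bounded_measurableE] by metis
  then show ?thesis
    using assms[THEN bounded_measurable_measurable]
    by (intro bounded_measurableI[where B="B * C"]) (auto simp: abs_mult intro!: mult_mono)
qed

lemma bounded_measurable_uminus:
  "f \<in> bounded_measurable M \<Longrightarrow> (\<lambda>x. - f x) \<in> bounded_measurable M"
  by (auto simp: bounded_measurable_def)

lemma bounded_measurable_diff:
  "f \<in> bounded_measurable M \<Longrightarrow> g \<in> bounded_measurable M \<Longrightarrow> (\<lambda>x. f x - g x) \<in> bounded_measurable M"
  using bounded_measurable_add[OF _ bounded_measurable_uminus, of f M g] by simp

lemma bounded_measurable_power:
  "f \<in> bounded_measurable M \<Longrightarrow> (\<lambda>x. f x ^ n) \<in> bounded_measurable M"
  by (induction n) (auto intro: bounded_measurable_const bounded_measurable_mult)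

lemma bounded_measurable_sum:
  "(\<And>i. i \<in> I \<Longrightarrow> f i \<in> bounded_measurable M) \<Longrightarrow> (\<lambda>x. \<Sum>i\<in>I. f i x) \<in> bounded_measurable M"
  by (induction I rule: infinite_finite_induct)
     (auto intro: bounded_measurable_const bounded_measurable_add)

lemma bounded_measurable_prod:
  "(\<And>i. i \<in> I \<Longrightarrow> f i \<in> bounded_measurable M) \<Longrightarrow> (\<lambda>x. \<Prod>i\<in>I. f i x) \<in> bounded_measurable M"
  by (induction I rule: infinite_finite_induct)
     (auto intro: bounded_measurable_const bounded_measurable_mult)

lemma bounded_measurable_abs:
  "f \<in> bounded_measurable M \<Longrightarrow> (\<lambda>x. \<bar>f x\<bar>) \<in> bounded_measurable M"
  by (auto simp: bounded_measurable_def)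

lemma bounded_measurable_divide:
  "f \<in> bounded_measurable M \<Longrightarrow> (\<lambda>x. f x / c) \<in> bounded_measurable M"
  using bounded_measurable_mult[OF _ bounded_measurable_const[of "1 / c" M], of f] by simp

lemma bounded_measurable_compose:
  assumes "f \<in> bounded_measurable M" "g \<in> N \<rightarrow>\<^sub>M M"
  shows "(\<lambda>x. f (g x)) \<in> bounded_measurable N"
  using assms measurable_space[OF assms(2)] by (auto simp: bounded_measurable_def)

lemma bounded_measurable_cong:
  assumes "\<And>x. x \<in> space M \<Longrightarrow> f x = g x" "f \<in> bounded_measurable M"
  shows "g \<in> bounded_measurable M"
  using assms measurable_cong[of M f g borel] by (simp add: bounded_measurable_def)

lemma bounded_measurable_indicator:
  "A \<in> sets M \<Longrightarrow> indicator A \<in> bounded_measurable M"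
  by (intro bounded_measurableI[where B=1]) (auto simp: indicator_def)

lemmas bounded_measurable_intros =
  bounded_measurable_const bounded_measurable_add bounded_measurable_mult bounded_measurable_uminus
  bounded_measurable_diff bounded_measurable_power bounded_measurable_sum bounded_measurable_prod
  bounded_measurable_abs bounded_measurable_divide bounded_measurable_indicator

context prob_space
begin

lemma bounded_measurable_integrable: "f \<in> bounded_measurable M \<Longrightarrow> integrable M f"
  by (metis AE_I2 bounded_measurableE bounded_measurable_measurable integrable_const_bound real_norm_def)

lemma integrable_mult_of_squares:
  fixes f g :: "'a \<Rightarrow> real"
  assumes [measurable]: "f \<in> borel_measurable M" "g \<in> borel_measurable M"
    and "integrable M (\<lambda>x. (f x)\<^sup>2)" "integrable M (\<lambda>x. (g x)\<^sup>2)"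
  shows "integrable M (\<lambda>x. f x * g x)"
proof (rule Bochner_Integration.integrable_bound)
  show "integrable M (\<lambda>x. (f x)\<^sup>2 + (g x)\<^sup>2)" using assms by simp
  have "\<bar>a * b\<bar> \<le> a\<^sup>2 + b\<^sup>2" for a b :: real
  proof -
    have "2 * (\<bar>a\<bar> * \<bar>b\<bar>) \<le> a\<^sup>2 + b\<^sup>2"
      using sum_squares_bound[of "\<bar>a\<bar>" "\<bar>b\<bar>"] by (simp add: mult.assoc)
    moreover have "0 \<le> \<bar>a\<bar> * \<bar>b\<bar>" by simp
    ultimately show ?thesis unfolding abs_mult by linarith
  qed
  then show "AE x in M. norm (f x * g x) \<le> norm ((f x)\<^sup>2 + (g x)\<^sup>2)" by simp
qed measurable

lemma integrable_square_add:
  fixes f g :: "'a \<Rightarrow> real"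
  assumes [measurable]: "f \<in> borel_measurable M" "g \<in> borel_measurable M"
    and "integrable M (\<lambda>x. (f x)\<^sup>2)" "integrable M (\<lambda>x. (g x)\<^sup>2)"
  shows "integrable M (\<lambda>x. (f x + g x)\<^sup>2)"
  using integrable_mult_of_squares[OF assms] assms by (simp add: power2_sum mult.assoc)

lemma expectation_cauchy_schwarz:
  fixes f g :: "'a \<Rightarrow> real"
  assumes [measurable]: "f \<in> borel_measurable M" "g \<in> borel_measurable M"
    and f: "integrable M (\<lambda>x. (f x)\<^sup>2)" and g: "integrable M (\<lambda>x. (g x)\<^sup>2)"
  shows "(\<integral>x. f x * g x \<partial>M)\<^sup>2 \<le> (\<integral>x. (f x)\<^sup>2 \<partial>M) * (\<integral>x. (g x)\<^sup>2 \<partial>M)"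
proof -
  define a b c where "a = (\<integral>x. (f x)\<^sup>2 \<partial>M)" "b = (\<integral>x. f x * g x \<partial>M)" "c = (\<integral>x. (g x)\<^sup>2 \<partial>M)"
  have fg: "integrable M (\<lambda>x. f x * g x)"
    using assms by (intro integrable_mult_of_squares)
  have quad: "0 \<le> a - 2 * t * b + t\<^sup>2 * c" for t
  proof -
    have "0 \<le> (\<integral>x. (f x - t * g x)\<^sup>2 \<partial>M)" by simp
    also have "(\<lambda>x. (f x - t * g x)\<^sup>2) = (\<lambda>x. (f x)\<^sup>2 - (2 * t) * (f x * g x) + t\<^sup>2 * (g x)\<^sup>2)"
      by (auto simp: power2_eq_square algebra_simps)
    also have "(\<integral>x. (f x)\<^sup>2 - (2 * t) * (f x * g x) + t\<^sup>2 * (g x)\<^sup>2 \<partial>M) = a - 2 * t * b + t\<^sup>2 * c"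
      using f g fg by (simp add: a_b_c_def)
    finally show ?thesis .
  qed
  have "c \<ge> 0" by (simp add: a_b_c_def)
  have "b\<^sup>2 \<le> a * c"
  proof (cases "c = 0")
    case True
    have "b = 0"
    proof (rule ccontr)
      assume "b \<noteq> 0"
      then have "a - 2 * ((a + 1) / (2 * b)) * b = -1" by (simp add: field_simps)
      then show False using quad[of "(a + 1) / (2 * b)"] True by simp
    qed
    then show ?thesis using True by simp
  next
    case False
    with \<open>c \<ge> 0\<close> have "c > 0" by simp
    have "0 \<le> c * (a - 2 * (b / c) * b + (b / c)\<^sup>2 * c)"
      using quad[of "b / c"] \<open>c > 0\<close> by (intro mult_nonneg_nonneg) auto
    also have "\<dots> = a * c - b\<^sup>2" using \<open>c > 0\<close> by (simp add: field_simps power2_eq_square)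
    finally show ?thesis by simp
  qed
  then show ?thesis by (simp add: a_b_c_def)
qed

lemma expectation_square_le:
  fixes f :: "'a \<Rightarrow> real"
  assumes "f \<in> borel_measurable M" "integrable M (\<lambda>x. (f x)\<^sup>2)"
  shows "(\<integral>x. f x \<partial>M)\<^sup>2 \<le> (\<integral>x. (f x)\<^sup>2 \<partial>M)"
  using expectation_cauchy_schwarz[of f "\<lambda>_. 1"] assms by (simp add: prob_space)

lemma expectation_abs_le_sqrt:
  fixes f :: "'a \<Rightarrow> real"
  assumes "f \<in> borel_measurable M" "integrable M (\<lambda>x. (f x)\<^sup>2)"
  shows "(\<integral>x. \<bar>f x\<bar> \<partial>M) \<le> sqrt (\<integral>x. (f x)\<^sup>2 \<partial>M)"
  using expectation_square_le[of "\<lambda>x. \<bar>f x\<bar>"] assms by (intro real_le_rsqrt) simp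

end


section \<open>The Markov property and reversibility\<close>

definition kernel_avg :: "('a \<Rightarrow> 'a measure) \<Rightarrow> ('a \<Rightarrow> real) \<Rightarrow> 'a \<Rightarrow> real" where
  "kernel_avg \<eta> f v = (\<integral>u. f u \<partial>\<eta> v)"

locale stationary_chain = prob_space \<Omega> for \<Omega> :: "'w measure" +
  fixes S :: "'a measure" and \<nu> :: "'a measure"
    and \<eta> :: "'a \<Rightarrow> 'a measure" and V :: "nat \<Rightarrow> 'w \<Rightarrow> 'a"
  assumes kernel: "\<eta> \<in> S \<rightarrow>\<^sub>M prob_algebra S"
    and chain: "markov_chain \<Omega> S \<nu> \<eta> V"
    and stationary: "stationary \<eta> \<nu>"
begin

abbreviation "P \<equiv> kernel_avg \<eta>"
abbreviation "H \<equiv> history \<Omega> S V"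

lemma V_measurable[measurable]: "V k \<in> \<Omega> \<rightarrow>\<^sub>M S"
  using chain by (simp add: markov_chain_def)

lemma distr_V0: "distr \<Omega> S (V 0) = \<nu>"
  using chain by (simp add: markov_chain_def)

lemma sets_nu[simp, measurable_cong]: "sets \<nu> = sets S"
  using distr_V0 by (metis sets_distr)

lemma space_nu[simp]: "space \<nu> = space S"
  by (rule sets_eq_imp_space_eq) simp

sublocale nu: prob_space \<nu>
  using prob_space_distr[OF V_measurable[of 0]] by (simp add: distr_V0)

lemma nu_total[simp]: "measure \<nu> (space S) = 1" "emeasure \<nu> (space S) = 1"
  using nu.prob_space nu.emeasure_space_1 by simp_all

lemma kernel_subprob[measurable]: "\<eta> \<in> S \<rightarrow>\<^sub>M subprob_algebra S"
  using kernel by (rule measurable_prob_algebraD)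

lemma prob_space_kernel: "v \<in> space S \<Longrightarrow> prob_space (\<eta> v)"
  using measurable_space[OF kernel] by (simp add: space_prob_algebra)

lemma sets_kernel: "v \<in> space S \<Longrightarrow> sets (\<eta> v) = sets S"
  using measurable_space[OF kernel] by (simp add: space_prob_algebra)

lemma space_kernel: "v \<in> space S \<Longrightarrow> space (\<eta> v) = space S"
  using sets_kernel sets_eq_imp_space_eq by blast

lemma bounded_measurable_nu: "bounded_measurable \<nu> = bounded_measurable S"
  by (auto simp: bounded_measurable_def)

lemma bounded_measurable_kernel:
  "v \<in> space S \<Longrightarrow> f \<in> bounded_measurable S \<Longrightarrow> f \<in> bounded_measurable (\<eta> v)"
  using sets_kernel space_kernel
  by (auto simp: bounded_measurable_def cong: measurable_cong_sets)

lemma integrable_kernel: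
  "v \<in> space S \<Longrightarrow> f \<in> bounded_measurable S \<Longrightarrow> integrable (\<eta> v) f"
  by (intro prob_space.bounded_measurable_integrable prob_space_kernel bounded_measurable_kernel)

lemma integrable_nu: "f \<in> bounded_measurable S \<Longrightarrow> integrable \<nu> f"
  using nu.bounded_measurable_integrable by (simp add: bounded_measurable_nu)

lemma P_bound:
  assumes "f \<in> bounded_measurable S" "\<And>u. u \<in> space S \<Longrightarrow> \<bar>f u\<bar> \<le> B" "v \<in> space S"
  shows "\<bar>P f v\<bar> \<le> B"
proof -
  interpret k: prob_space "\<eta> v" using assms by (intro prob_space_kernel)
  have "\<bar>P f v\<bar> \<le> (\<integral>u. \<bar>f u\<bar> \<partial>\<eta> v)" unfolding kernel_avg_def by (rule integral_abs_bound)
  also have "\<dots> \<le> (\<integral>u. B \<partial>\<eta> v)"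
    using assms by (intro integral_mono integrable_kernel bounded_measurable_intros) (auto simp: space_kernel)
  finally show ?thesis by (simp add: k.prob_space)
qed

lemma P_measurable[measurable]: "f \<in> borel_measurable S \<Longrightarrow> P f \<in> borel_measurable S"
  unfolding kernel_avg_def
  by (rule measurable_compose[OF kernel_subprob integral_measurable_subprob_algebra])

lemma P_bounded_measurable: "f \<in> bounded_measurable S \<Longrightarrow> P f \<in> bounded_measurable S"
  by (metis P_bound P_measurable bounded_measurableE bounded_measurableI bounded_measurable_measurable)

lemma P_add: "f \<in> bounded_measurable S \<Longrightarrow> g \<in> bounded_measurable S \<Longrightarrow> v \<in> space S \<Longrightarrow>
    P (\<lambda>u. f u + g u) v = P f v + P g v"
  unfolding kernel_avg_def by (intro Bochner_Integration.integral_add integrable_kernel)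

lemma P_diff: "f \<in> bounded_measurable S \<Longrightarrow> g \<in> bounded_measurable S \<Longrightarrow> v \<in> space S \<Longrightarrow>
    P (\<lambda>u. f u - g u) v = P f v - P g v"
  unfolding kernel_avg_def by (intro Bochner_Integration.integral_diff integrable_kernel)

lemma P_const: "v \<in> space S \<Longrightarrow> P (\<lambda>_. c) v = c"
  using prob_space_kernel[of v] by (simp add: kernel_avg_def prob_space.prob_space)

lemma P_square_le:
  assumes "f \<in> bounded_measurable S" "v \<in> space S"
  shows "(P f v)\<^sup>2 \<le> P (\<lambda>u. (f u)\<^sup>2) v"
proof -
  interpret k: prob_space "\<eta> v" using assms by (intro prob_space_kernel)
  show ?thesis
    unfolding kernel_avg_def using assms
    by (intro k.expectation_square_le integrable_kernel bounded_measurable_intros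
        bounded_measurable_measurable bounded_measurable_kernel)
qed

lemma space_history[simp]: "space (H k) = space \<Omega>"
  by (simp add: history_def)

lemma subalgebra_history: "subalgebra \<Omega> (H k)"
proof -
  have "(\<lambda>\<omega>. \<lambda>j\<in>{..k}. V j \<omega>) \<in> \<Omega> \<rightarrow>\<^sub>M PiM {..k} (\<lambda>_. S)"
    by (intro measurable_restrict) simp
  from sets_image_in_sets[OF refl this] show ?thesis
    by (simp add: subalgebra_def history_def)
qed

lemma V_history:
  assumes "j \<le> k"
  shows "V j \<in> H k \<rightarrow>\<^sub>M S"
proof -
  have "(\<lambda>\<omega>. (\<lambda>j\<in>{..k}. V j \<omega>)) \<in> H k \<rightarrow>\<^sub>M PiM {..k} (\<lambda>_. S)"
    unfolding history_def using measurable_space[OF V_measurable]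
    by (intro measurable_vimage_algebra1) (auto simp: space_PiM)
  from measurable_compose[OF this measurable_component_singleton[of j]] assms
  show ?thesis by simp
qed

lemma history_measurable: "F \<in> H k \<rightarrow>\<^sub>M N \<Longrightarrow> F \<in> \<Omega> \<rightarrow>\<^sub>M N"
  by (rule measurable_from_subalg[OF subalgebra_history])

lemma bounded_history: "F \<in> bounded_measurable (H k) \<Longrightarrow> F \<in> bounded_measurable \<Omega>"
  by (auto simp: bounded_measurable_def intro: history_measurable)

lemma bounded_V_history:
  "f \<in> bounded_measurable S \<Longrightarrow> j \<le> k \<Longrightarrow> (\<lambda>\<omega>. f (V j \<omega>)) \<in> bounded_measurable (H k)"
  by (rule bounded_measurable_compose[OF _ V_history])

lemma bounded_V: "f \<in> bounded_measurable S \<Longrightarrow> (\<lambda>\<omega>. f (V j \<omega>)) \<in> bounded_measurable \<Omega>"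
  by (rule bounded_measurable_compose[OF _ V_measurable])

lemma integral_centered_square:
  assumes f: "f \<in> bounded_measurable S"
  shows "(\<integral>v. (f v - (\<integral>v. f v \<partial>\<nu>))\<^sup>2 \<partial>\<nu>) = (\<integral>v. (f v)\<^sup>2 \<partial>\<nu>) - (\<integral>v. f v \<partial>\<nu>)\<^sup>2"
proof -
  define m where "m = (\<integral>v. f v \<partial>\<nu>)"
  have "(\<integral>v. (f v - m)\<^sup>2 \<partial>\<nu>) = (\<integral>v. (f v)\<^sup>2 - 2 * m * f v + m\<^sup>2 \<partial>\<nu>)"
    by (intro Bochner_Integration.integral_cong) (auto simp: power2_eq_square algebra_simps)
  also have "\<dots> = (\<integral>v. (f v)\<^sup>2 \<partial>\<nu>) - 2 * m * m + m\<^sup>2"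
    using f by (simp add: integrable_nu bounded_measurable_power m_def)
  finally show ?thesis by (simp add: m_def power2_eq_square)
qed

lemma integral_centered_square_le:
  "f \<in> bounded_measurable S \<Longrightarrow>
    (\<integral>v. (f v - (\<integral>v. f v \<partial>\<nu>))\<^sup>2 \<partial>\<nu>) \<le> (\<integral>v. (f v)\<^sup>2 \<partial>\<nu>)"
  by (simp add: integral_centered_square)

text \<open>This is the defining property of the conditional expectation of \<open>V (Suc k) \<in> A\<close> given the
  history, integrated against \<open>F\<close>.\<close>

lemma markov_indicator:
  assumes F: "F \<in> bounded_measurable (H k)" and A: "A \<in> sets S"
  shows "(\<integral>\<omega>. F \<omega> * indicator A (V (Suc k) \<omega>) \<partial>\<Omega>) = (\<integral>\<omega>. F \<omega> * measure (\<eta> (V k \<omega>)) A \<partial>\<Omega>)"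
proof -
  interpret s: finite_measure_subalgebra \<Omega> "H k"
    by unfold_locales (rule subalgebra_history)
  let ?g = "indicator (V (Suc k) -` A \<inter> space \<Omega>) :: _ \<Rightarrow> real"
  have g: "?g \<in> bounded_measurable \<Omega>" using A by (intro bounded_measurable_intros) simp
  have [measurable]: "F \<in> borel_measurable \<Omega>"
    using F by (intro bounded_measurable_measurable bounded_history)
  have "(\<integral>\<omega>. F \<omega> * indicator A (V (Suc k) \<omega>) \<partial>\<Omega>) = (\<integral>\<omega>. F \<omega> * ?g \<omega> \<partial>\<Omega>)"
    by (intro Bochner_Integration.integral_cong) (auto simp: indicator_def)
  also have "\<dots> = (\<integral>\<omega>. F \<omega> * real_cond_exp \<Omega> (H k) ?g \<omega> \<partial>\<Omega>)"
    using F g by (intro s.real_cond_exp_intg(2)[symmetric] bounded_measurable_integrable bounded_measurable_intros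
        bounded_history bounded_measurable_measurable measurable_sets[OF V_measurable A])
  also have "\<dots> = (\<integral>\<omega>. F \<omega> * measure (\<eta> (V k \<omega>)) A \<partial>\<Omega>)"
  proof (rule integral_cong_AE)
    have [measurable]: "(\<lambda>v. measure (\<eta> v) A) \<in> borel_measurable S"
      using A by (intro measurable_compose[OF kernel_subprob measurable_measure_subprob_algebra])
    show "(\<lambda>\<omega>. F \<omega> * measure (\<eta> (V k \<omega>)) A) \<in> borel_measurable \<Omega>" by measurable
    show "AE \<omega> in \<Omega>. F \<omega> * real_cond_exp \<Omega> (H k) ?g \<omega> = F \<omega> * measure (\<eta> (V k \<omega>)) A"
    proof -
      have "AE \<omega> in \<Omega>. real_cond_exp \<Omega> (H k) ?g \<omega> = measure (\<eta> (V k \<omega>)) A"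
        using chain A unfolding markov_chain_def by blast
      then show ?thesis by (rule AE_mp) simp
    qed
  qed measurable
  finally show ?thesis .
qed

text \<open>For nonnegative \<open>F\<close> the measures with density \<open>F\<close>, pushed forward by \<open>V (Suc k)\<close> and by
  \<open>V k\<close> followed by the kernel, agree on all sets, and therefore integrate \<open>f\<close> alike.\<close>

lemma markov_nonneg:
  assumes F: "F \<in> bounded_measurable (H k)" "\<And>\<omega>. \<omega> \<in> space \<Omega> \<Longrightarrow> F \<omega> \<ge> 0" and f: "f \<in> bounded_measurable S"
  shows "(\<integral>\<omega>. F \<omega> * f (V (Suc k) \<omega>) \<partial>\<Omega>) = (\<integral>\<omega>. F \<omega> * P f (V k \<omega>) \<partial>\<Omega>)"
proof -
  have F': "F \<in> bounded_measurable \<Omega>" using F by (intro bounded_history)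
  have Fm[measurable]: "F \<in> borel_measurable \<Omega>"
    using F' by (rule bounded_measurable_measurable)
  have [measurable]: "f \<in> borel_measurable S" using f by (rule bounded_measurable_measurable)
  define D where "D = density \<Omega> (\<lambda>\<omega>. ennreal (F \<omega>))"
  have Dm[measurable_cong]: "sets D = sets \<Omega>" and spD: "space D = space \<Omega>" by (simp_all add: D_def)
  have eD: "emeasure D A = (\<integral>\<omega>. F \<omega> * indicator A \<omega> \<partial>\<Omega>)" if "A \<in> sets \<Omega>" for A
  proof -
    have "emeasure D A = (\<integral>\<^sup>+\<omega>. ennreal (F \<omega>) * indicator A \<omega> \<partial>\<Omega>)"
      using that unfolding D_def by (intro emeasure_density) measurable
    also have "\<dots> = (\<integral>\<^sup>+\<omega>. ennreal (F \<omega> * indicator A \<omega>) \<partial>\<Omega>)"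
      using F(2) by (intro nn_integral_cong) (auto simp: ennreal_mult' indicator_def)
    also have "\<dots> = (\<integral>\<omega>. F \<omega> * indicator A \<omega> \<partial>\<Omega>)"
      using F' F(2) that by (intro nn_integral_eq_integral bounded_measurable_integrable bounded_measurable_intros) auto
    finally show ?thesis .
  qed
  have finD: "finite_measure D"
    by (rule finite_measureI) (use eD[of "space \<Omega>"] in \<open>auto simp: D_def\<close>)
  have fin: "finite_measure (distr D S (V k))"
    using finD by (rule finite_measure.finite_measure_distr) (simp add: D_def)
  have ne: "space S \<noteq> {}" using nu.not_empty by simp
  have eq: "distr D S (V (Suc k)) = distr D S (V k) \<bind> \<eta>"
  proof (rule measure_eqI)
    show "sets (distr D S (V (Suc k))) = sets (distr D S (V k) \<bind> \<eta>)"
      using ne sets_kernel by (subst sets_bind[where N=S]) auto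
    fix A assume "A \<in> sets (distr D S (V (Suc k)))"
    then have A[measurable]: "A \<in> sets S" by simp
    have "emeasure (distr D S (V (Suc k))) A = (\<integral>\<omega>. F \<omega> * indicator (V (Suc k) -` A \<inter> space \<Omega>) \<omega> \<partial>\<Omega>)"
      by (subst emeasure_distr) (auto simp: eD spD)
    also have "(\<integral>\<omega>. F \<omega> * indicator (V (Suc k) -` A \<inter> space \<Omega>) \<omega> \<partial>\<Omega>) = (\<integral>\<omega>. F \<omega> * indicator A (V (Suc k) \<omega>) \<partial>\<Omega>)"
      by (intro Bochner_Integration.integral_cong) (auto simp: indicator_def)
    also have "\<dots> = (\<integral>\<omega>. F \<omega> * measure (\<eta> (V k \<omega>)) A \<partial>\<Omega>)"
      using F A by (intro markov_indicator)
    also have "ennreal \<dots> = (\<integral>\<^sup>+\<omega>. ennreal (F \<omega> * measure (\<eta> (V k \<omega>)) A) \<partial>\<Omega>)"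
    proof (intro nn_integral_eq_integral[symmetric] bounded_measurable_integrable bounded_measurable_mult F')
      show "(\<lambda>\<omega>. measure (\<eta> (V k \<omega>)) A) \<in> bounded_measurable \<Omega>"
        using prob_space.prob_le_1[OF prob_space_kernel] measurable_space[OF V_measurable]
        by (intro bounded_measurableI[where B=1]
            measurable_compose[OF V_measurable measurable_compose[OF kernel_subprob measurable_measure_subprob_algebra]]) auto
    qed (use F(2) in auto)
    also have "\<dots> = (\<integral>\<^sup>+\<omega>. ennreal (F \<omega>) * emeasure (\<eta> (V k \<omega>)) A \<partial>\<Omega>)"
      using F(2) measurable_space[OF V_measurable]
      by (intro nn_integral_cong)
         (auto simp: ennreal_mult finite_measure.emeasure_eq_measure prob_space_kernel prob_space.finite_measure)
    also have "\<dots> = (\<integral>\<^sup>+\<omega>. emeasure (\<eta> (V k \<omega>)) A \<partial>D)"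
      unfolding D_def using measurable_compose[OF V_measurable measurable_compose[OF kernel_subprob measurable_emeasure_subprob_algebra[OF A]]]
      by (subst nn_integral_density) auto
    also have "\<dots> = (\<integral>\<^sup>+v. emeasure (\<eta> v) A \<partial>distr D S (V k))"
      using measurable_compose[OF kernel_subprob measurable_emeasure_subprob_algebra[OF A]]
      by (subst nn_integral_distr) auto
    also have "\<dots> = emeasure (distr D S (V k) \<bind> \<eta>) A"
      using ne by (subst emeasure_bind[where N=S]) auto
    finally show "emeasure (distr D S (V (Suc k))) A = emeasure (distr D S (V k) \<bind> \<eta>) A" .
  qed
  have "(\<integral>\<omega>. F \<omega> * f (V (Suc k) \<omega>) \<partial>\<Omega>) = (\<integral>\<omega>. f (V (Suc k) \<omega>) \<partial>D)"
    unfolding D_def using F(2) by (subst integral_density) auto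
  also have "\<dots> = (\<integral>v. f v \<partial>distr D S (V (Suc k)))"
    by (subst integral_distr) auto
  also have "\<dots> = (\<integral>v. f v \<partial>(distr D S (V k) \<bind> \<eta>))" by (simp add: eq)
  also have "\<dots> = (\<integral>v. P f v \<partial>distr D S (V k))"
  proof -
    obtain B where B: "\<And>x. x \<in> space S \<Longrightarrow> \<bar>f x\<bar> \<le> B" by (metis bounded_measurableE[OF f])
    have "AE v in distr D S (V k). emeasure (\<eta> v) (space (\<eta> v)) \<le> ennreal 1"
      by (rule AE_I2) (use prob_space.emeasure_space_1[OF prob_space_kernel] in auto)
    from integral_bind[OF bounded_measurable_measurable[OF f] B _ fin this] show ?thesis
      unfolding kernel_avg_def by simp
  qed
  also have "\<dots> = (\<integral>\<omega>. P f (V k \<omega>) \<partial>D)"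
    by (subst integral_distr) auto
  also have "\<dots> = (\<integral>\<omega>. F \<omega> * P f (V k \<omega>) \<partial>\<Omega>)"
    unfolding D_def using F(2) by (subst integral_density) auto
  finally show ?thesis .
qed

lemma markov:
  assumes F: "F \<in> bounded_measurable (H k)" and f: "f \<in> bounded_measurable S"
  shows "(\<integral>\<omega>. F \<omega> * f (V (Suc k) \<omega>) \<partial>\<Omega>) = (\<integral>\<omega>. F \<omega> * P f (V k \<omega>) \<partial>\<Omega>)"
proof -
  obtain B where B: "B \<ge> 0" "\<And>\<omega>. \<omega> \<in> space (H k) \<Longrightarrow> \<bar>F \<omega>\<bar> \<le> B" using F by (rule bounded_measurableE) auto
  have 1: "(\<integral>\<omega>. (F \<omega> + B) * f (V (Suc k) \<omega>) \<partial>\<Omega>) = (\<integral>\<omega>. (F \<omega> + B) * P f (V k \<omega>) \<partial>\<Omega>)"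
  proof (rule markov_nonneg[OF _ _ f])
    show "(\<lambda>\<omega>. F \<omega> + B) \<in> bounded_measurable (H k)" using F by (intro bounded_measurable_intros)
    show "\<omega> \<in> space \<Omega> \<Longrightarrow> 0 \<le> F \<omega> + B" for \<omega> using B(2)[of \<omega>] by auto
  qed
  have 2: "(\<integral>\<omega>. B * f (V (Suc k) \<omega>) \<partial>\<Omega>) = (\<integral>\<omega>. B * P f (V k \<omega>) \<partial>\<Omega>)"
    using B(1) by (intro markov_nonneg bounded_measurable_const f) auto
  have int: "integrable \<Omega> (\<lambda>\<omega>. F \<omega> * h (V j \<omega>))" "integrable \<Omega> (\<lambda>\<omega>. h (V j \<omega>))"
    if "h \<in> bounded_measurable S" for h j
    using bounded_measurable_mult[OF bounded_history[OF F] bounded_V[OF that]]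
      bounded_V[OF that]
    by (blast intro: bounded_measurable_integrable)+
  have "(\<integral>\<omega>. F \<omega> * f (V (Suc k) \<omega>) \<partial>\<Omega>) + (\<integral>\<omega>. B * f (V (Suc k) \<omega>) \<partial>\<Omega>)
      = (\<integral>\<omega>. (F \<omega> + B) * f (V (Suc k) \<omega>) \<partial>\<Omega>)"
    by (subst Bochner_Integration.integral_add[symmetric]) (auto simp: algebra_simps intro!: int f)
  moreover have "(\<integral>\<omega>. F \<omega> * P f (V k \<omega>) \<partial>\<Omega>) + (\<integral>\<omega>. B * P f (V k \<omega>) \<partial>\<Omega>)
      = (\<integral>\<omega>. (F \<omega> + B) * P f (V k \<omega>) \<partial>\<Omega>)"
    by (subst Bochner_Integration.integral_add[symmetric]) (auto simp: algebra_simps intro!: int f P_bounded_measurable)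
  ultimately show ?thesis using 1 2 by linarith
qed

lemma integral_P_nu:
  assumes f: "f \<in> bounded_measurable S"
  shows "(\<integral>v. P f v \<partial>\<nu>) = (\<integral>v. f v \<partial>\<nu>)"
proof -
  obtain B where B: "\<And>x. x \<in> space S \<Longrightarrow> \<bar>f x\<bar> \<le> B" by (metis bounded_measurableE[OF f])
  have "AE v in \<nu>. emeasure (\<eta> v) (space (\<eta> v)) \<le> ennreal 1"
    by (rule AE_I2) (use prob_space.emeasure_space_1[OF prob_space_kernel] in auto)
  from integral_bind[OF bounded_measurable_measurable[OF f] B _ nu.finite_measure_axioms this]
  have "(\<integral>v. f v \<partial>(\<nu> \<bind> \<eta>)) = (\<integral>v. P f v \<partial>\<nu>)"
    unfolding kernel_avg_def by (simp cong: measurable_cong_sets)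
  then show ?thesis using stationary by (simp add: stationary_def)
qed

lemma expectation_V_bounded:
  assumes f: "f \<in> bounded_measurable S"
  shows "(\<integral>\<omega>. f (V k \<omega>) \<partial>\<Omega>) = (\<integral>v. f v \<partial>\<nu>)"
  using f
proof (induction k arbitrary: f)
  case 0
  then show ?case
    by (subst distr_V0[symmetric], subst integral_distr) (auto dest: bounded_measurable_measurable)
next
  case (Suc k)
  have "(\<integral>\<omega>. f (V (Suc k) \<omega>) \<partial>\<Omega>) = (\<integral>\<omega>. P f (V k \<omega>) \<partial>\<Omega>)"
    using markov[OF bounded_measurable_const[of 1] Suc.prems, of k] by simp
  also have "\<dots> = (\<integral>v. f v \<partial>\<nu>)"
    using Suc.IH[OF P_bounded_measurable[OF Suc.prems]] integral_P_nu[OF Suc.prems] by simp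
  finally show ?case .
qed

lemma distr_V: "distr \<Omega> S (V k) = \<nu>"
proof (rule measure_eqI)
  fix A assume "A \<in> sets (distr \<Omega> S (V k))"
  then have A[measurable]: "A \<in> sets S" by simp
  have "measure (distr \<Omega> S (V k)) A = (\<integral>v. indicator A v \<partial>distr \<Omega> S (V k))" by simp
  also have "\<dots> = (\<integral>\<omega>. indicator A (V k \<omega>) \<partial>\<Omega>)" by (subst integral_distr) auto
  also have "\<dots> = (\<integral>v. indicator A v \<partial>\<nu>)"
    by (intro expectation_V_bounded bounded_measurable_intros A)
  also have "\<dots> = measure \<nu> A" by simp
  finally show "emeasure (distr \<Omega> S (V k)) A = emeasure \<nu> A"
    using prob_space.finite_measure[OF prob_space_distr[OF V_measurable[of k]]]
    by (simp add: finite_measure.emeasure_eq_measure nu.emeasure_eq_measure)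
qed simp

lemma expectation_V:
  fixes f :: "'a \<Rightarrow> real"
  assumes "f \<in> borel_measurable S"
  shows "(\<integral>\<omega>. f (V k \<omega>) \<partial>\<Omega>) = (\<integral>v. f v \<partial>\<nu>)"
  using assms by (subst distr_V[of k, symmetric], subst integral_distr) auto

lemma integrable_V:
  fixes f :: "'a \<Rightarrow> real"
  assumes "integrable \<nu> f"
  shows "integrable \<Omega> (\<lambda>\<omega>. f (V k \<omega>))"
  using assms by (subst (asm) distr_V[of k, symmetric]) (simp add: integrable_distr_eq integrable_distr[OF V_measurable])

lemma P_contraction:
  assumes "f \<in> bounded_measurable S"
  shows "(\<integral>v. (P f v)\<^sup>2 \<partial>\<nu>) \<le> (\<integral>v. (f v)\<^sup>2 \<partial>\<nu>)"
proof -
  have "(\<integral>v. (P f v)\<^sup>2 \<partial>\<nu>) \<le> (\<integral>v. P (\<lambda>u. (f u)\<^sup>2) v \<partial>\<nu>)"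
    using assms P_square_le by (intro integral_mono integrable_nu bounded_measurable_intros P_bounded_measurable) auto
  also have "\<dots> = (\<integral>v. (f v)\<^sup>2 \<partial>\<nu>)"
    using assms by (intro integral_P_nu bounded_measurable_intros)
  finally show ?thesis .
qed

lemma joint_rectangle:
  assumes [measurable]: "A \<in> sets S" "B \<in> sets S"
  shows "emeasure (distr \<Omega> (S \<Otimes>\<^sub>M S) (\<lambda>\<omega>. (V 0 \<omega>, V 1 \<omega>))) (A \<times> B) = (\<integral>\<^sup>+v. emeasure (\<eta> v) B * indicator A v \<partial>\<nu>)"
proof -
  have [measurable]: "(\<lambda>v. emeasure (\<eta> v) B) \<in> borel_measurable S"
    using measurable_compose[OF kernel_subprob measurable_emeasure_subprob_algebra[OF assms(2)]] .
  have [measurable]: "(\<lambda>v. measure (\<eta> v) B) \<in> borel_measurable S"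
    using measurable_compose[OF kernel_subprob measurable_measure_subprob_algebra[OF assms(2)]] .
  have bm: "(\<lambda>v. measure (\<eta> v) B) \<in> bounded_measurable S"
    using prob_space.prob_le_1[OF prob_space_kernel] by (intro bounded_measurableI[where B=1]) auto
  have "measure (distr \<Omega> (S \<Otimes>\<^sub>M S) (\<lambda>\<omega>. (V 0 \<omega>, V 1 \<omega>))) (A \<times> B)
      = (\<integral>x. indicator (A \<times> B) x \<partial>(distr \<Omega> (S \<Otimes>\<^sub>M S) (\<lambda>\<omega>. (V 0 \<omega>, V 1 \<omega>))))"
    by simp
  also have "\<dots> = (\<integral>\<omega>. indicator (A \<times> B) (V 0 \<omega>, V 1 \<omega>) \<partial>\<Omega>)"
    by (subst integral_distr) auto
  also have "\<dots> = (\<integral>\<omega>. indicator A (V 0 \<omega>) * indicator B (V (Suc 0) \<omega>) \<partial>\<Omega>)"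
    by (simp add: indicator_times)
  also have "\<dots> = (\<integral>\<omega>. indicator A (V 0 \<omega>) * measure (\<eta> (V 0 \<omega>)) B \<partial>\<Omega>)"
    by (intro markov_indicator bounded_V_history bounded_measurable_intros) auto
  also have "\<dots> = (\<integral>v. indicator A v * measure (\<eta> v) B \<partial>\<nu>)"
    by (intro expectation_V) measurable
  finally have eq: "measure (distr \<Omega> (S \<Otimes>\<^sub>M S) (\<lambda>\<omega>. (V 0 \<omega>, V 1 \<omega>))) (A \<times> B)
    = (\<integral>v. indicator A v * measure (\<eta> v) B \<partial>\<nu>)" .
  have "(\<integral>\<^sup>+v. emeasure (\<eta> v) B * indicator A v \<partial>\<nu>) = (\<integral>\<^sup>+v. ennreal (indicator A v * measure (\<eta> v) B) \<partial>\<nu>)"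
    by (intro nn_integral_cong)
       (auto simp: indicator_def finite_measure.emeasure_eq_measure prob_space_kernel prob_space.finite_measure)
  also have "\<dots> = ennreal (\<integral>v. indicator A v * measure (\<eta> v) B \<partial>\<nu>)"
    using bm by (intro nn_integral_eq_integral integrable_nu bounded_measurable_intros) auto
  finally show ?thesis
    using eq prob_space.finite_measure[OF prob_space_distr, of "\<lambda>\<omega>. (V 0 \<omega>, V 1 \<omega>)" "S \<Otimes>\<^sub>M S"]
    by (simp add: finite_measure.emeasure_eq_measure)
qed

text \<open>Detailed balance says that \<open>(V 0, V 1)\<close> and \<open>(V 1, V 0)\<close> have the same law on rectangles,
  which form a generator stable under intersection.\<close>

lemma P_selfadjoint:
  assumes db: "detailed_balance \<eta> \<nu>" and f: "f \<in> bounded_measurable S" and g: "g \<in> bounded_measurable S"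
  shows "(\<integral>v. f v * P g v \<partial>\<nu>) = (\<integral>v. P f v * g v \<partial>\<nu>)"
proof -
  have [measurable]: "f \<in> borel_measurable S" "g \<in> borel_measurable S"
    using f g by (auto dest: bounded_measurable_measurable)
  let ?J = "distr \<Omega> (S \<Otimes>\<^sub>M S) (\<lambda>\<omega>. (V 0 \<omega>, V 1 \<omega>))"
  let ?J' = "distr \<Omega> (S \<Otimes>\<^sub>M S) (\<lambda>\<omega>. (V 1 \<omega>, V 0 \<omega>))"
  have sym: "emeasure ?J (A \<times> B) = emeasure ?J (B \<times> A)" if [measurable]: "A \<in> sets S" "B \<in> sets S" for A B
  proof -
    have "A \<times> B \<in> sets (\<nu> \<Otimes>\<^sub>M \<nu>)" by measurable
    then have "(\<integral>\<^sup>+v. emeasure (\<eta> v) {u \<in> space \<nu>. (v, u) \<in> A \<times> B} \<partial>\<nu>) =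
        (\<integral>\<^sup>+u. emeasure (\<eta> u) {v \<in> space \<nu>. (v, u) \<in> A \<times> B} \<partial>\<nu>)"
      using db unfolding detailed_balance_def by blast
    also have "(\<integral>\<^sup>+v. emeasure (\<eta> v) {u \<in> space \<nu>. (v, u) \<in> A \<times> B} \<partial>\<nu>) = (\<integral>\<^sup>+v. emeasure (\<eta> v) B * indicator A v \<partial>\<nu>)"
      using sets.sets_into_space[OF that(2)]
      by (intro nn_integral_cong) (auto simp: indicator_def intro!: arg_cong[where f="emeasure (\<eta> _)"])
    also have "(\<integral>\<^sup>+u. emeasure (\<eta> u) {v \<in> space \<nu>. (v, u) \<in> A \<times> B} \<partial>\<nu>) = (\<integral>\<^sup>+v. emeasure (\<eta> v) A * indicator B v \<partial>\<nu>)"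
      using sets.sets_into_space[OF that(1)]
      by (intro nn_integral_cong) (auto simp: indicator_def intro!: arg_cong[where f="emeasure (\<eta> _)"])
    finally show ?thesis unfolding joint_rectangle[OF that] joint_rectangle[OF that(2,1)] .
  qed
  have "?J = ?J'"
  proof (rule measure_eqI_generator_eq[where E="{A \<times> B |A B. A \<in> sets S \<and> B \<in> sets S}"
        and \<Omega>="space S \<times> space S" and A="\<lambda>_. space S \<times> space S"])
    show "Int_stable {A \<times> B |A B. A \<in> sets S \<and> B \<in> sets S}"
      by (rule Int_stable_pair_measure_generator)
    show "{A \<times> B |A B. A \<in> sets S \<and> B \<in> sets S} \<subseteq> Pow (space S \<times> space S)"
      by (rule pair_measure_closed)
    show "emeasure ?J X = emeasure ?J' X" if "X \<in> {A \<times> B |A B. A \<in> sets S \<and> B \<in> sets S}" for X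
    proof -
      from that obtain A B where X: "X = A \<times> B" and [measurable]: "A \<in> sets S" "B \<in> sets S" by auto
      have "emeasure ?J' X = emeasure ?J (B \<times> A)"
        unfolding X by (subst (1 2) emeasure_distr) (auto intro!: arg_cong[where f="emeasure \<Omega>"])
      then show ?thesis using sym[of A B] by (simp add: X)
    qed
    show "emeasure ?J (space S \<times> space S) \<noteq> \<infinity>"
      using prob_space.finite_measure[OF prob_space_distr, of "\<lambda>\<omega>. (V 0 \<omega>, V 1 \<omega>)" "S \<Otimes>\<^sub>M S"]
      by (simp add: finite_measure.emeasure_eq_measure)
  qed (auto simp: sets_pair_measure)
  have "(\<integral>v. f v * P g v \<partial>\<nu>) = (\<integral>\<omega>. f (V 0 \<omega>) * P g (V 0 \<omega>) \<partial>\<Omega>)"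
    by (intro expectation_V[symmetric]) measurable
  also have "\<dots> = (\<integral>\<omega>. f (V 0 \<omega>) * g (V 1 \<omega>) \<partial>\<Omega>)"
    using markov[OF bounded_V_history[OF f] g, of 0 0] by simp
  also have "\<dots> = (\<integral>x. f (fst x) * g (snd x) \<partial>?J)" by (subst integral_distr) auto
  also have "\<dots> = (\<integral>x. f (fst x) * g (snd x) \<partial>?J')" by (simp only: \<open>?J = ?J'\<close>)
  also have "\<dots> = (\<integral>\<omega>. g (V 0 \<omega>) * f (V 1 \<omega>) \<partial>\<Omega>)" by (subst integral_distr) (auto simp: mult.commute)
  also have "\<dots> = (\<integral>\<omega>. g (V 0 \<omega>) * P f (V 0 \<omega>) \<partial>\<Omega>)"
    using markov[OF bounded_V_history[OF g] f, of 0 0] by simp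
  also have "\<dots> = (\<integral>v. g v * P f v \<partial>\<nu>)"
    by (intro expectation_V) measurable
  finally show ?thesis by (simp add: mult.commute)
qed

end


section \<open>The spectral gap\<close>

context stationary_chain
begin

text \<open>The resolvent equation with right-hand side \<open>z f - P f\<close> has \<open>f\<close> itself as a solution, so by
  uniqueness the bound on the resolvent applies to \<open>f\<close>.\<close>

lemma resolvent_bounded_below:
  assumes z: "complex_of_real z \<in> resolvent_set_orth \<eta> \<nu>"
  obtains B where "\<And>f. f \<in> bounded_measurable S \<Longrightarrow> (\<integral>v. f v \<partial>\<nu>) = 0 \<Longrightarrow>
    (\<integral>v. (f v)\<^sup>2 \<partial>\<nu>) \<le> B\<^sup>2 * (\<integral>v. (z * f v - P f v)\<^sup>2 \<partial>\<nu>)"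
proof -
  from z obtain B where B: "\<And>\<psi>. \<psi> \<in> orth_constants \<nu> \<Longrightarrow>
      \<exists>\<phi> \<in> orth_constants \<nu>. (AE v in \<nu>. complex_of_real z * \<phi> v - kernel_op \<eta> \<phi> v = \<psi> v) \<and>
             norm_L2 \<nu> \<phi> \<le> B * norm_L2 \<nu> \<psi> \<and>
             (\<forall>\<phi>' \<in> orth_constants \<nu>.
                (AE v in \<nu>. complex_of_real z * \<phi>' v - kernel_op \<eta> \<phi>' v = \<psi> v) \<longrightarrow> (AE v in \<nu>. \<phi>' v = \<phi> v))"
    unfolding resolvent_set_orth_def by blast
  have orth: "(\<lambda>v. complex_of_real (f v)) \<in> orth_constants \<nu>"
    if "f \<in> bounded_measurable S" "(\<integral>v. f v \<partial>\<nu>) = 0" for f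
  proof -
    have "f \<in> borel_measurable \<nu>"
      using that(1) bounded_measurable_measurable[of f S] by simp
    moreover have "integrable \<nu> (\<lambda>v. (f v)\<^sup>2)"
      using that(1) by (intro integrable_nu bounded_measurable_intros)
    ultimately show ?thesis
      using that(2) by (simp add: orth_constants_def square_integrable_def)
  qed
  have normL2: "norm_L2 \<nu> (\<lambda>v. complex_of_real (f v)) = sqrt (\<integral>v. (f v)\<^sup>2 \<partial>\<nu>)" for f
    by (simp add: norm_L2_def)
  have "(\<integral>v. (f v)\<^sup>2 \<partial>\<nu>) \<le> B\<^sup>2 * (\<integral>v. (z * f v - P f v)\<^sup>2 \<partial>\<nu>)"
    if f: "f \<in> bounded_measurable S" and f0: "(\<integral>v. f v \<partial>\<nu>) = 0" for f
  proof -
    let ?g = "\<lambda>v. z * f v - P f v"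
    have g: "?g \<in> bounded_measurable S" using f by (intro bounded_measurable_intros P_bounded_measurable)
    have g0: "(\<integral>v. ?g v \<partial>\<nu>) = 0"
      using f f0 integral_P_nu[OF f] by (simp add: integrable_nu P_bounded_measurable)
    from B[OF orth[OF g g0]] obtain \<phi> where \<phi>: "\<phi> \<in> orth_constants \<nu>"
      "norm_L2 \<nu> \<phi> \<le> B * norm_L2 \<nu> (\<lambda>v. complex_of_real (?g v))"
      "\<forall>\<phi>' \<in> orth_constants \<nu>. (AE v in \<nu>. complex_of_real z * \<phi>' v - kernel_op \<eta> \<phi>' v = complex_of_real (?g v)) \<longrightarrow> (AE v in \<nu>. \<phi>' v = \<phi> v)"
      by blast
    have "kernel_op \<eta> (\<lambda>v. complex_of_real (f v)) v = complex_of_real (P f v)" for v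
      by (simp add: kernel_op_def kernel_avg_def)
    then have "AE v in \<nu>. complex_of_real (f v) = \<phi> v"
      using \<phi>(3) orth[OF f f0] by auto
    then have "AE v in \<nu>. (cmod (complex_of_real (f v)))\<^sup>2 = (cmod (\<phi> v))\<^sup>2"
      by (rule AE_mp) simp
    then have "norm_L2 \<nu> (\<lambda>v. complex_of_real (f v)) = norm_L2 \<nu> \<phi>"
      using \<phi>(1) bounded_measurable_measurable[OF f] unfolding norm_L2_def
      by (intro arg_cong[where f=sqrt] integral_cong_AE) (auto simp: orth_constants_def square_integrable_def)
    then have "sqrt (\<integral>v. (f v)\<^sup>2 \<partial>\<nu>) \<le> B * sqrt (\<integral>v. (?g v)\<^sup>2 \<partial>\<nu>)"
      using \<phi>(2) by (simp only: normL2)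
    then have "(sqrt (\<integral>v. (f v)\<^sup>2 \<partial>\<nu>))\<^sup>2 \<le> (B * sqrt (\<integral>v. (?g v)\<^sup>2 \<partial>\<nu>))\<^sup>2"
      by (intro power_mono) auto
    then show ?thesis by (simp add: power_mult_distrib)
  qed
  then show thesis by (rule that)
qed

text \<open>Since \<open>1\<close> and \<open>-1\<close> lie in the resolvent set, \<open>1 - P\<^sup>2 = (1 - P) (1 + P)\<close> is bounded below on
  mean-zero functions. Self-adjointness and contractivity give
  \<open>\<parallel>(1 - P\<^sup>2) f\<parallel>\<^sup>2 \<le> \<parallel>f\<parallel>\<^sup>2 - \<parallel>P f\<parallel>\<^sup>2\<close>, so the loss of norm under \<open>P\<close> is at least a fixed fraction.\<close>

lemma spectral_gap:
  assumes qc: "quasi_compact \<eta> \<nu>" and db: "detailed_balance \<eta> \<nu>"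
  obtains \<rho> where "0 < \<rho>" "\<rho> < 1"
    "\<And>f. f \<in> bounded_measurable S \<Longrightarrow> (\<integral>v. f v \<partial>\<nu>) = 0 \<Longrightarrow>
      (\<integral>v. (P f v)\<^sup>2 \<partial>\<nu>) \<le> \<rho>\<^sup>2 * (\<integral>v. (f v)\<^sup>2 \<partial>\<nu>)"
proof -
  have res: "z \<in> resolvent_set_orth \<eta> \<nu>" if "cmod z = 1" for z
  proof (rule ccontr)
    assume "z \<notin> resolvent_set_orth \<eta> \<nu>"
    then have "ennreal (cmod z) \<le> spectral_radius_orth \<eta> \<nu>"
      unfolding spectral_radius_orth_def by (intro SUP_upper) auto
    then show False using qc that by (simp add: quasi_compact_def not_le)
  qed
  obtain B1 where B1: "\<And>f. f \<in> bounded_measurable S \<Longrightarrow> (\<integral>v. f v \<partial>\<nu>) = 0 \<Longrightarrow>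
    (\<integral>v. (f v)\<^sup>2 \<partial>\<nu>) \<le> B1\<^sup>2 * (\<integral>v. (1 * f v - P f v)\<^sup>2 \<partial>\<nu>)"
    using resolvent_bounded_below[of 1] res[of 1] by auto
  obtain B2 where B2: "\<And>f. f \<in> bounded_measurable S \<Longrightarrow> (\<integral>v. f v \<partial>\<nu>) = 0 \<Longrightarrow>
    (\<integral>v. (f v)\<^sup>2 \<partial>\<nu>) \<le> B2\<^sup>2 * (\<integral>v. (-1 * f v - P f v)\<^sup>2 \<partial>\<nu>)"
    using resolvent_bounded_below[of "-1"] res[of "-1"] by auto
  define c where "c = B2\<^sup>2 * B1\<^sup>2 + 2"
  have c: "c > 1" by (simp add: c_def add_pos_nonneg add.commute add_strict_increasing)
  have key: "(\<integral>v. (P f v)\<^sup>2 \<partial>\<nu>) \<le> (1 - 1 / c) * (\<integral>v. (f v)\<^sup>2 \<partial>\<nu>)"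
    if f: "f \<in> bounded_measurable S" and f0: "(\<integral>v. f v \<partial>\<nu>) = 0" for f
  proof -
    define N N' where "N = (\<integral>v. (f v)\<^sup>2 \<partial>\<nu>)" and "N' = (\<integral>v. (P f v)\<^sup>2 \<partial>\<nu>)"
    let ?h = "\<lambda>v. f v + P f v"
    note bm = bounded_measurable_intros P_bounded_measurable
    have Pf: "P f \<in> bounded_measurable S" using f by (intro bm)
    have PPf: "P (P f) \<in> bounded_measurable S" using f by (intro bm)
    have h: "?h \<in> bounded_measurable S" using f by (intro bm)
    have h0: "(\<integral>v. ?h v \<partial>\<nu>) = 0"
      using f f0 integral_P_nu[OF f] by (simp add: integrable_nu P_bounded_measurable)
    have "N \<le> B2\<^sup>2 * (\<integral>v. (-1 * f v - P f v)\<^sup>2 \<partial>\<nu>)"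
      unfolding N_def by (rule B2[OF f f0])
    also have "(\<integral>v. (-1 * f v - P f v)\<^sup>2 \<partial>\<nu>) = (\<integral>v. (?h v)\<^sup>2 \<partial>\<nu>)"
      by (intro Bochner_Integration.integral_cong) (auto simp: power2_eq_square algebra_simps)
    also have "\<dots> \<le> B1\<^sup>2 * (\<integral>v. (1 * ?h v - P ?h v)\<^sup>2 \<partial>\<nu>)"
      by (rule B1[OF h h0])
    also have "(\<integral>v. (1 * ?h v - P ?h v)\<^sup>2 \<partial>\<nu>) = (\<integral>v. (f v)\<^sup>2 - 2 * (f v * P (P f) v) + (P (P f) v)\<^sup>2 \<partial>\<nu>)"
      by (intro Bochner_Integration.integral_cong)
         (auto simp: P_add[OF f Pf] power2_eq_square algebra_simps)
    also have "\<dots> = N - 2 * (\<integral>v. f v * P (P f) v \<partial>\<nu>) + (\<integral>v. (P (P f) v)\<^sup>2 \<partial>\<nu>)"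
      unfolding N_def using f Pf PPf by (simp add: integrable_nu bounded_measurable_intros)
    also have "(\<integral>v. f v * P (P f) v \<partial>\<nu>) = N'"
      unfolding N'_def P_selfadjoint[OF db f Pf] by (simp add: power2_eq_square)
    also have "(\<integral>v. (P (P f) v)\<^sup>2 \<partial>\<nu>) \<le> N'"
      unfolding N'_def by (rule P_contraction[OF Pf])
    finally have "N \<le> (B2\<^sup>2 * B1\<^sup>2) * (N - N')"
      by (simp add: mult_left_mono mult.assoc)
    moreover have "N - N' \<ge> 0" unfolding N_def N'_def using P_contraction[OF f] by simp
    ultimately have "N \<le> c * (N - N')" unfolding c_def
      by (smt (verit) mult_right_mono)
    then have "N' \<le> (1 - 1 / c) * N" using c by (simp add: field_simps)
    then show ?thesis by (simp add: N_def N'_def)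
  qed
  show thesis
  proof (rule that[of "sqrt (1 - 1 / c)"])
    show "0 < sqrt (1 - 1 / c)" "sqrt (1 - 1 / c) < 1" using c by auto
    show "(\<integral>v. (P f v)\<^sup>2 \<partial>\<nu>) \<le> (sqrt (1 - 1 / c))\<^sup>2 * (\<integral>v. (f v)\<^sup>2 \<partial>\<nu>)"
      if "f \<in> bounded_measurable S" "(\<integral>v. f v \<partial>\<nu>) = 0" for f
      using key[OF that] c by simp
  qed
qed

end


section \<open>Martingale approximation of additive functionals\<close>

lemma sum_stopped:
  fixes x :: "nat \<Rightarrow> real"
  shows "n \<le> L \<Longrightarrow> (\<Sum>j<n. x j) = (\<Sum>j<L. of_bool (j < n) * x j)"
  by (rule sum.mono_neutral_cong_left) auto

lemma power2_sum3_le: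
  fixes x y z :: real
  shows "(x + y + z)\<^sup>2 \<le> 3 * x\<^sup>2 + 3 * y\<^sup>2 + 3 * z\<^sup>2"
proof -
  have "0 \<le> (x - y)\<^sup>2 + (y - z)\<^sup>2 + (x - z)\<^sup>2" by simp
  then show ?thesis by (simp add: power2_eq_square algebra_simps)
qed

lemma power2_sum2_le:
  fixes x y :: real
  shows "(x + y)\<^sup>2 \<le> 2 * x\<^sup>2 + 2 * y\<^sup>2"
proof -
  have "0 \<le> (x - y)\<^sup>2" by simp
  then show ?thesis by (simp add: power2_eq_square algebra_simps)
qed

locale gapped_chain = stationary_chain \<Omega> S \<nu> \<eta> V
  for \<Omega> :: "'w measure" and S \<nu> :: "'a measure" and \<eta> V +
  fixes \<rho> :: real
  assumes rho_pos: "0 < \<rho>" and rho_less: "\<rho> < 1"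
    and gap: "\<And>f. f \<in> bounded_measurable S \<Longrightarrow> (\<integral>v. f v \<partial>\<nu>) = 0 \<Longrightarrow>
      (\<integral>v. (P f v)\<^sup>2 \<partial>\<nu>) \<le> \<rho>\<^sup>2 * (\<integral>v. (f v)\<^sup>2 \<partial>\<nu>)"
begin

text \<open>Partial sums of the Neumann series, which solves the Poisson equation \<open>g - P g = f\<close>. Stopping
  after finitely many terms keeps the solution bounded.\<close>

definition poisson :: "('a \<Rightarrow> real) \<Rightarrow> nat \<Rightarrow> 'a \<Rightarrow> real" where
  "poisson f K v = (\<Sum>k<K. (P ^^ k) f v)"

lemma iter_bounded_measurable: "f \<in> bounded_measurable S \<Longrightarrow> (P ^^ k) f \<in> bounded_measurable S"
  by (induction k) (auto intro: P_bounded_measurable)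

lemma integral_iter:
  "f \<in> bounded_measurable S \<Longrightarrow> (\<integral>v. (P ^^ k) f v \<partial>\<nu>) = (\<integral>v. f v \<partial>\<nu>)"
  by (induction k) (auto simp: integral_P_nu iter_bounded_measurable)

lemma iter_bound:
  assumes "f \<in> bounded_measurable S" "\<And>u. u \<in> space S \<Longrightarrow> \<bar>f u\<bar> \<le> B" "v \<in> space S"
  shows "\<bar>(P ^^ k) f v\<bar> \<le> B"
  using assms(3)
proof (induction k arbitrary: v)
  case (Suc k)
  then show ?case using P_bound[OF iter_bounded_measurable[OF assms(1)], of k B v] by simp
qed (use assms in auto)

lemma iter_decay:
  assumes "f \<in> bounded_measurable S" "(\<integral>v. f v \<partial>\<nu>) = 0"
  shows "(\<integral>v. ((P ^^ k) f v)\<^sup>2 \<partial>\<nu>) \<le> (\<rho> ^ k)\<^sup>2 * (\<integral>v. (f v)\<^sup>2 \<partial>\<nu>)"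
proof (induction k)
  case (Suc k)
  have "(\<integral>v. ((P ^^ Suc k) f v)\<^sup>2 \<partial>\<nu>) \<le> \<rho>\<^sup>2 * (\<integral>v. ((P ^^ k) f v)\<^sup>2 \<partial>\<nu>)"
    using gap[OF iter_bounded_measurable[OF assms(1), of k]] assms by (simp add: integral_iter)
  also have "\<dots> \<le> \<rho>\<^sup>2 * ((\<rho> ^ k)\<^sup>2 * (\<integral>v. (f v)\<^sup>2 \<partial>\<nu>))"
    using Suc by (intro mult_left_mono) auto
  finally show ?case by (simp add: power_mult_distrib mult.assoc)
qed simp

lemma poisson_bounded_measurable: "f \<in> bounded_measurable S \<Longrightarrow> poisson f K \<in> bounded_measurable S"
  unfolding poisson_def[abs_def] by (intro bounded_measurable_intros iter_bounded_measurable)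

lemma poisson_bound:
  assumes "f \<in> bounded_measurable S" "\<And>u. u \<in> space S \<Longrightarrow> \<bar>f u\<bar> \<le> B" "v \<in> space S"
  shows "\<bar>poisson f K v\<bar> \<le> K * B"
  unfolding poisson_def
  using order_trans[OF sum_abs sum_mono[where g="\<lambda>_. B"], of "{..<K}" "\<lambda>k. (P ^^ k) f v"] iter_bound[OF assms]
  by simp

lemma integral_poisson:
  assumes "f \<in> bounded_measurable S" "(\<integral>v. f v \<partial>\<nu>) = 0"
  shows "(\<integral>v. poisson f K v \<partial>\<nu>) = 0"
  unfolding poisson_def using assms
  by (simp add: integrable_nu iter_bounded_measurable integral_iter)

lemma poisson_equation:
  assumes f: "f \<in> bounded_measurable S" and v: "v \<in> space S"
  shows "poisson f K v - P (poisson f K) v = f v - (P ^^ K) f v"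
proof (induction K)
  case 0
  then show ?case using v by (simp add: poisson_def[abs_def] P_const)
next
  case (Suc K)
  have "poisson f (Suc K) = (\<lambda>v. poisson f K v + (P ^^ K) f v)" by (simp add: poisson_def fun_eq_iff)
  then show ?case
    using Suc P_add[OF poisson_bounded_measurable[OF f] iter_bounded_measurable[OF f] v, of K K] by simp
qed

lemma poisson_norm:
  assumes f: "f \<in> bounded_measurable S" and f0: "(\<integral>v. f v \<partial>\<nu>) = 0"
  shows "(\<integral>v. (poisson f K v)\<^sup>2 \<partial>\<nu>) \<le> (\<integral>v. (f v)\<^sup>2 \<partial>\<nu>) / (1 - \<rho>)\<^sup>2"
proof (induction K)
  case 0
  then show ?case by (simp add: poisson_def)
next
  case (Suc K)
  let ?g = "poisson f K"
  have g: "?g \<in> bounded_measurable S" using f by (rule poisson_bounded_measurable)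
  \<comment> \<open>the weights \<open>1 - \<rho>\<close> and \<open>\<rho>\<close> make the induction hypothesis reproduce itself\<close>
  have convex: "(x + y)\<^sup>2 \<le> x\<^sup>2 / (1 - \<rho>) + y\<^sup>2 / \<rho>" for x y :: real
  proof -
    have "0 \<le> (\<rho> * x - (1 - \<rho>) * y)\<^sup>2" by simp
    also have "\<dots> = \<rho> * (1 - \<rho>) * (x\<^sup>2 / (1 - \<rho>) + y\<^sup>2 / \<rho> - (x + y)\<^sup>2)"
      using rho_pos rho_less by (simp add: field_simps power2_eq_square)
    finally have "0 \<le> \<rho> * (1 - \<rho>) * (x\<^sup>2 / (1 - \<rho>) + y\<^sup>2 / \<rho> - (x + y)\<^sup>2)" .
    moreover have "0 < \<rho> * (1 - \<rho>)" using rho_pos rho_less by simp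
    ultimately have "0 \<le> x\<^sup>2 / (1 - \<rho>) + y\<^sup>2 / \<rho> - (x + y)\<^sup>2"
      by (meson linorder_not_less mult_pos_neg)
    then show ?thesis by simp
  qed
  have "poisson f (Suc K) v = f v + P ?g v" if "v \<in> space S" for v
    using poisson_equation[OF f that, of K] by (simp add: poisson_def)
  then have "(\<integral>v. (poisson f (Suc K) v)\<^sup>2 \<partial>\<nu>) = (\<integral>v. (f v + P ?g v)\<^sup>2 \<partial>\<nu>)"
    by (intro Bochner_Integration.integral_cong) auto
  also have "\<dots> \<le> (\<integral>v. (f v)\<^sup>2 / (1 - \<rho>) + (P ?g v)\<^sup>2 / \<rho> \<partial>\<nu>)"
    using f g convex by (intro integral_mono integrable_nu bounded_measurable_intros P_bounded_measurable) auto
  also have "\<dots> = (\<integral>v. (f v)\<^sup>2 \<partial>\<nu>) / (1 - \<rho>) + (\<integral>v. (P ?g v)\<^sup>2 \<partial>\<nu>) / \<rho>"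
    using f g by (simp add: integrable_nu bounded_measurable_power P_bounded_measurable)
  also have "(\<integral>v. (P ?g v)\<^sup>2 \<partial>\<nu>) \<le> \<rho>\<^sup>2 * (\<integral>v. (?g v)\<^sup>2 \<partial>\<nu>)"
    using g integral_poisson[OF f f0] by (intro gap)
  also have "\<dots> \<le> \<rho>\<^sup>2 * ((\<integral>v. (f v)\<^sup>2 \<partial>\<nu>) / (1 - \<rho>)\<^sup>2)"
    using Suc by (intro mult_left_mono) auto
  finally have "(\<integral>v. (poisson f (Suc K) v)\<^sup>2 \<partial>\<nu>) \<le>
      (\<integral>v. (f v)\<^sup>2 \<partial>\<nu>) / (1 - \<rho>) + \<rho>\<^sup>2 * ((\<integral>v. (f v)\<^sup>2 \<partial>\<nu>) / (1 - \<rho>)\<^sup>2) / \<rho>"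
    using rho_pos by (simp add: divide_right_mono)
  also have "\<dots> = (\<integral>v. (f v)\<^sup>2 \<partial>\<nu>) / (1 - \<rho>)\<^sup>2"
  proof -
    define d N where "d = 1 - \<rho>" and "N = (\<integral>v. (f v)\<^sup>2 \<partial>\<nu>)"
    have "d \<noteq> 0" "\<rho> = 1 - d" using rho_less by (auto simp: d_def)
    have "N / d + \<rho>\<^sup>2 * (N / d\<^sup>2) / \<rho> = N * d / d\<^sup>2 + N * \<rho> / d\<^sup>2"
      using rho_pos \<open>d \<noteq> 0\<close> by (simp add: power2_eq_square)
    also have "\<dots> = N / d\<^sup>2"
      unfolding add_divide_distrib[symmetric] distrib_left[symmetric] by (simp add: d_def)
    finally show ?thesis by (simp add: d_def N_def)
  qed
  finally show ?case .
qed

definition increment :: "('a \<Rightarrow> real) \<Rightarrow> nat \<Rightarrow> 'w \<Rightarrow> real" where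
  "increment g j \<omega> = g (V (Suc j) \<omega>) - P g (V j \<omega>)"

definition cond_var :: "('a \<Rightarrow> real) \<Rightarrow> 'a \<Rightarrow> real" where
  "cond_var g v = P (\<lambda>u. (g u)\<^sup>2) v - (P g v)\<^sup>2"

lemma cond_var_bounded_measurable: "g \<in> bounded_measurable S \<Longrightarrow> cond_var g \<in> bounded_measurable S"
  unfolding cond_var_def[abs_def] by (intro bounded_measurable_intros P_bounded_measurable)

lemma cond_var_nonneg: "g \<in> bounded_measurable S \<Longrightarrow> v \<in> space S \<Longrightarrow> cond_var g v \<ge> 0"
  using P_square_le by (simp add: cond_var_def)

lemma cond_var_le:
  assumes g: "g \<in> bounded_measurable S" and B: "\<And>u. u \<in> space S \<Longrightarrow> \<bar>g u\<bar> \<le> B" and v: "v \<in> space S"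
  shows "cond_var g v \<le> B\<^sup>2"
proof -
  have "\<bar>P (\<lambda>u. (g u)\<^sup>2) v\<bar> \<le> B\<^sup>2"
  proof (rule P_bound)
    show "\<bar>(g u)\<^sup>2\<bar> \<le> B\<^sup>2" if "u \<in> space S" for u
      using power_mono[OF B[OF that], of 2] by simp
  qed (use g v in \<open>auto intro: bounded_measurable_intros\<close>)
  then have "P (\<lambda>u. (g u)\<^sup>2) v \<le> B\<^sup>2" by linarith
  moreover have "0 \<le> (P g v)\<^sup>2" by simp
  ultimately show ?thesis unfolding cond_var_def by linarith
qed

lemma integral_cond_var_le:
  assumes "g \<in> bounded_measurable S"
  shows "(\<integral>v. cond_var g v \<partial>\<nu>) \<le> (\<integral>v. (g v)\<^sup>2 \<partial>\<nu>)"
proof -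
  have "(\<integral>v. cond_var g v \<partial>\<nu>) \<le> (\<integral>v. P (\<lambda>u. (g u)\<^sup>2) v \<partial>\<nu>)"
    unfolding cond_var_def using assms
    by (intro integral_mono integrable_nu bounded_measurable_intros P_bounded_measurable) auto
  then show ?thesis using assms by (simp add: integral_P_nu bounded_measurable_power)
qed

lemma increment_bounded: "g \<in> bounded_measurable S \<Longrightarrow> increment g j \<in> bounded_measurable \<Omega>"
  unfolding increment_def[abs_def] by (intro bounded_measurable_intros bounded_V P_bounded_measurable)

lemma increment_history:
  "g \<in> bounded_measurable S \<Longrightarrow> j < k \<Longrightarrow> increment g j \<in> bounded_measurable (H k)"
  unfolding increment_def[abs_def]
  by (intro bounded_measurable_intros bounded_V_history P_bounded_measurable) auto

lemma increment_orthogonal: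
  assumes F: "F \<in> bounded_measurable (H j)" and g: "g \<in> bounded_measurable S"
  shows "(\<integral>\<omega>. F \<omega> * increment g j \<omega> \<partial>\<Omega>) = 0"
proof -
  have "(\<integral>\<omega>. F \<omega> * increment g j \<omega> \<partial>\<Omega>) = (\<integral>\<omega>. F \<omega> * g (V (Suc j) \<omega>) - F \<omega> * P g (V j \<omega>) \<partial>\<Omega>)"
    by (simp add: increment_def algebra_simps)
  also have "\<dots> = (\<integral>\<omega>. F \<omega> * g (V (Suc j) \<omega>) \<partial>\<Omega>) - (\<integral>\<omega>. F \<omega> * P g (V j \<omega>) \<partial>\<Omega>)"
    using bounded_history[OF F] g
    by (intro Bochner_Integration.integral_diff bounded_measurable_integrable)
       (rule bounded_measurable_mult, assumption, rule bounded_V, auto intro: P_bounded_measurable)+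
  finally show ?thesis using markov[OF F g] by simp
qed

lemma increment_square:
  assumes F: "F \<in> bounded_measurable (H j)" and g: "g \<in> bounded_measurable S"
  shows "(\<integral>\<omega>. F \<omega> * (increment g j \<omega>)\<^sup>2 \<partial>\<Omega>) = (\<integral>\<omega>. F \<omega> * cond_var g (V j \<omega>) \<partial>\<Omega>)"
proof -
  note F' = bounded_history[OF F]
  have Pg: "P g \<in> bounded_measurable S" using g by (rule P_bounded_measurable)
  have g2: "(\<lambda>u. (g u)\<^sup>2) \<in> bounded_measurable S" using g by (intro bounded_measurable_intros)
  have FP: "(\<lambda>\<omega>. F \<omega> * P g (V j \<omega>)) \<in> bounded_measurable (H j)"
    using bounded_measurable_mult[OF F bounded_V_history[OF Pg order_refl]] .
  have i1: "integrable \<Omega> (\<lambda>\<omega>. F \<omega> * (g (V (Suc j) \<omega>))\<^sup>2)"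
    using bounded_measurable_mult[OF F' bounded_V[OF g2, of "Suc j"]] by (intro bounded_measurable_integrable)
  have i2: "integrable \<Omega> (\<lambda>\<omega>. F \<omega> * P g (V j \<omega>) * g (V (Suc j) \<omega>))"
    using bounded_measurable_mult[OF bounded_history[OF FP] bounded_V[OF g, of "Suc j"]]
    by (intro bounded_measurable_integrable)
  have i3: "integrable \<Omega> (\<lambda>\<omega>. F \<omega> * P g (V j \<omega>) * P g (V j \<omega>))"
    using bounded_measurable_mult[OF bounded_history[OF FP] bounded_V[OF Pg, of j]]
    by (intro bounded_measurable_integrable)
  have i4: "integrable \<Omega> (\<lambda>\<omega>. F \<omega> * P (\<lambda>u. (g u)\<^sup>2) (V j \<omega>))"
    using bounded_measurable_mult[OF F' bounded_V[OF P_bounded_measurable[OF g2], of j]]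
    by (intro bounded_measurable_integrable)
  have "(\<integral>\<omega>. F \<omega> * (increment g j \<omega>)\<^sup>2 \<partial>\<Omega>) = (\<integral>\<omega>. F \<omega> * (g (V (Suc j) \<omega>))\<^sup>2
      - 2 * (F \<omega> * P g (V j \<omega>) * g (V (Suc j) \<omega>)) + F \<omega> * P g (V j \<omega>) * P g (V j \<omega>) \<partial>\<Omega>)"
    by (simp add: increment_def power2_eq_square algebra_simps)
  also have "\<dots> = (\<integral>\<omega>. F \<omega> * (g (V (Suc j) \<omega>))\<^sup>2 \<partial>\<Omega>)
      - 2 * (\<integral>\<omega>. F \<omega> * P g (V j \<omega>) * g (V (Suc j) \<omega>) \<partial>\<Omega>) + (\<integral>\<omega>. F \<omega> * P g (V j \<omega>) * P g (V j \<omega>) \<partial>\<Omega>)"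
    using i1 i2 i3 by simp
  also have "\<dots> = (\<integral>\<omega>. F \<omega> * P (\<lambda>u. (g u)\<^sup>2) (V j \<omega>) \<partial>\<Omega>) - (\<integral>\<omega>. F \<omega> * P g (V j \<omega>) * P g (V j \<omega>) \<partial>\<Omega>)"
    using markov[OF F g2] markov[OF FP g] by simp
  also have "\<dots> = (\<integral>\<omega>. F \<omega> * P (\<lambda>u. (g u)\<^sup>2) (V j \<omega>) - F \<omega> * P g (V j \<omega>) * P g (V j \<omega>) \<partial>\<Omega>)"
    using i3 i4 by simp
  finally show ?thesis by (simp add: cond_var_def power2_eq_square algebra_simps)
qed

lemma subalgebra_history_mono:
  assumes "j \<le> k"
  shows "subalgebra (H k) (H j)"
proof -
  have "(\<lambda>\<omega>. \<lambda>i\<in>{..j}. V i \<omega>) \<in> H k \<rightarrow>\<^sub>M PiM {..j} (\<lambda>_. S)"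
    using assms by (intro measurable_restrict V_history) auto
  from sets_image_in_sets[OF _ this, of "space \<Omega>"] show ?thesis
    by (simp add: subalgebra_def history_def[of _ _ _ j])
qed

lemma bounded_history_mono:
  assumes "F \<in> bounded_measurable (H j)" "j \<le> k"
  shows "F \<in> bounded_measurable (H k)"
proof -
  have "F \<in> borel_measurable (H k)"
    using measurable_from_subalg[OF subalgebra_history_mono[OF assms(2)]] bounded_measurable_measurable[OF assms(1)] .
  then show ?thesis using assms(1) by (simp add: bounded_measurable_def)
qed

text \<open>The coefficient \<open>c j\<close> knows \<open>V 0, \<dots>, V j\<close>, whereas the increment with index \<open>j\<close> has mean zero
  given these, so all mixed terms vanish.\<close>

lemma martingale_transform_square:
  assumes c: "\<And>j. c j \<in> bounded_measurable (H j)" and g: "g \<in> bounded_measurable S"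
  shows "(\<integral>\<omega>. (\<Sum>j<L. c j \<omega> * increment g j \<omega>)\<^sup>2 \<partial>\<Omega>) = (\<Sum>j<L. \<integral>\<omega>. (c j \<omega>)\<^sup>2 * cond_var g (V j \<omega>) \<partial>\<Omega>)"
proof (induction L)
  case (Suc L)
  let ?M = "\<lambda>\<omega>. \<Sum>j<L. c j \<omega> * increment g j \<omega>"
  have M: "?M \<in> bounded_measurable (H L)"
  proof (intro bounded_measurable_sum bounded_measurable_mult)
    fix j assume j: "j \<in> {..<L}"
    then show "increment g j \<in> bounded_measurable (H L)" using g by (intro increment_history) auto
    show "c j \<in> bounded_measurable (H L)" using c[of j] j by (intro bounded_history_mono[of _ j L]) auto
  qed
  have Mc: "(\<lambda>\<omega>. ?M \<omega> * c L \<omega>) \<in> bounded_measurable (H L)"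
    using M c by (rule bounded_measurable_mult)
  have c2: "(\<lambda>\<omega>. (c L \<omega>)\<^sup>2) \<in> bounded_measurable (H L)"
    using c by (rule bounded_measurable_power)
  note inc = increment_bounded[OF g]
  have i1: "integrable \<Omega> (\<lambda>\<omega>. (?M \<omega>)\<^sup>2)"
    using bounded_measurable_power[OF bounded_history[OF M]] by (rule bounded_measurable_integrable)
  have i2: "integrable \<Omega> (\<lambda>\<omega>. ?M \<omega> * c L \<omega> * increment g L \<omega>)"
    using bounded_measurable_mult[OF bounded_history[OF Mc] inc] by (rule bounded_measurable_integrable)
  have i3: "integrable \<Omega> (\<lambda>\<omega>. (c L \<omega>)\<^sup>2 * (increment g L \<omega>)\<^sup>2)"
    using bounded_measurable_mult[OF bounded_history[OF c2] bounded_measurable_power[OF inc]]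
    by (rule bounded_measurable_integrable)
  have "(\<integral>\<omega>. (\<Sum>j<Suc L. c j \<omega> * increment g j \<omega>)\<^sup>2 \<partial>\<Omega>)
      = (\<integral>\<omega>. (?M \<omega>)\<^sup>2 + 2 * (?M \<omega> * c L \<omega> * increment g L \<omega>) + (c L \<omega>)\<^sup>2 * (increment g L \<omega>)\<^sup>2 \<partial>\<Omega>)"
    by (simp add: power2_eq_square algebra_simps)
  also have "\<dots> = (\<integral>\<omega>. (?M \<omega>)\<^sup>2 \<partial>\<Omega>) + 2 * (\<integral>\<omega>. ?M \<omega> * c L \<omega> * increment g L \<omega> \<partial>\<Omega>)
      + (\<integral>\<omega>. (c L \<omega>)\<^sup>2 * (increment g L \<omega>)\<^sup>2 \<partial>\<Omega>)"
    using i1 i2 i3 by simp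
  also have "(\<integral>\<omega>. ?M \<omega> * c L \<omega> * increment g L \<omega> \<partial>\<Omega>) = 0"
    using increment_orthogonal[OF Mc g] by simp
  also have "(\<integral>\<omega>. (c L \<omega>)\<^sup>2 * (increment g L \<omega>)\<^sup>2 \<partial>\<Omega>) = (\<integral>\<omega>. (c L \<omega>)\<^sup>2 * cond_var g (V L \<omega>) \<partial>\<Omega>)"
    using increment_square[OF c2 g] by simp
  finally show ?case using Suc by simp
qed simp

text \<open>Whether the term with index \<open>j\<close> is summed may depend on \<open>V j\<close>, because the increment with
  index \<open>j\<close> leads from \<open>V j\<close> to \<open>V (Suc j)\<close>. The number of flights completed by a given time is
  of this kind: the flight with index \<open>j\<close> lasts \<open>\<tau> (V j)\<close>.\<close>

definition stopping_index :: "('w \<Rightarrow> nat) \<Rightarrow> nat \<Rightarrow> bool" where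
  "stopping_index n L \<longleftrightarrow> (\<forall>j. {\<omega> \<in> space \<Omega>. j < n \<omega>} \<in> sets (H j)) \<and> (\<forall>\<omega> \<in> space \<Omega>. n \<omega> \<le> L)"

lemma stopping_index_const: "stopping_index (\<lambda>_. m) m"
  unfolding stopping_index_def
  by (metis (mono_tags, lifting) Collect_empty_eq empty_iff mem_Collect_eq order_refl sets.empty_sets sets.top space_history subsetI subset_antisym)

lemma stopping_index_le: "stopping_index n L \<Longrightarrow> \<omega> \<in> space \<Omega> \<Longrightarrow> n \<omega> \<le> L"
  by (simp add: stopping_index_def)

lemma stopping_coefficient:
  assumes "stopping_index n L"
  shows "(\<lambda>\<omega>. of_bool (j < n \<omega>)) \<in> bounded_measurable (H j)"
proof -
  have "indicator {\<omega> \<in> space \<Omega>. j < n \<omega>} \<in> bounded_measurable (H j)"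
    using assms by (intro bounded_measurable_indicator) (simp add: stopping_index_def)
  moreover have "indicator {\<omega> \<in> space \<Omega>. j < n \<omega>} \<omega> = (of_bool (j < n \<omega>) :: real)" if "\<omega> \<in> space (H j)" for \<omega>
    using that by (simp add: indicator_def)
  ultimately show ?thesis by (rule bounded_measurable_cong[rotated])
qed

lemma stopped_sum_bounded_measurable:
  assumes n: "stopping_index n L" and x: "\<And>j. x j \<in> bounded_measurable \<Omega>"
  shows "(\<lambda>\<omega>. \<Sum>j<n \<omega>. x j \<omega>) \<in> bounded_measurable \<Omega>"
proof -
  have "(\<lambda>\<omega>. \<Sum>j<L. of_bool (j < n \<omega>) * x j \<omega>) \<in> bounded_measurable \<Omega>"
    by (intro bounded_measurable_sum bounded_measurable_mult x bounded_history[OF stopping_coefficient[OF n]])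
  moreover have "(\<Sum>j<L. of_bool (j < n \<omega>) * x j \<omega>) = (\<Sum>j<n \<omega>. x j \<omega>)" if "\<omega> \<in> space \<Omega>" for \<omega>
    using sum_stopped[OF stopping_index_le[OF n that]] by simp
  ultimately show ?thesis by (rule bounded_measurable_cong[rotated])
qed

lemma stopped_sum_V_bounded_measurable:
  "stopping_index n L \<Longrightarrow> f \<in> bounded_measurable S \<Longrightarrow> (\<lambda>\<omega>. \<Sum>j<n \<omega>. f (V j \<omega>)) \<in> bounded_measurable \<Omega>"
  by (rule stopped_sum_bounded_measurable, assumption, rule bounded_V)

lemma stopping_real_bounded_measurable:
  "stopping_index n L \<Longrightarrow> (\<lambda>\<omega>. real (n \<omega>)) \<in> bounded_measurable \<Omega>"
  using stopped_sum_bounded_measurable[OF _ bounded_measurable_const[of 1]] by simp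

lemma poisson_decomposition:
  assumes f: "f \<in> bounded_measurable S" and \<omega>: "\<omega> \<in> space \<Omega>"
  shows "(\<Sum>j<N. f (V j \<omega>)) = (\<Sum>j<N. increment (poisson f K) j \<omega>)
    + (poisson f K (V 0 \<omega>) - poisson f K (V N \<omega>)) + (\<Sum>j<N. (P ^^ K) f (V j \<omega>))"
proof (induction N)
  case (Suc N)
  have "f (V N \<omega>) = poisson f K (V N \<omega>) - P (poisson f K) (V N \<omega>) + (P ^^ K) f (V N \<omega>)"
    using poisson_equation[OF f measurable_space[OF V_measurable \<omega>], of K] by simp
  then show ?case using Suc by (simp add: increment_def)
qed simp

definition gap_const :: real where
  "gap_const = 15 / (1 - \<rho>)\<^sup>2"

lemma gap_const_pos: "gap_const > 0"
  using rho_less by (simp add: gap_const_def)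

text \<open>The stopped martingale part has orthogonal increments, the value of the corrector at the
  random time is dominated by the sum of its values at all times, and the remainder \<open>P ^^ K\<close>
  disappears for \<open>K\<close> large compared with \<open>ln L\<close>, while the other two bounds do not depend on \<open>K\<close>.\<close>

lemma stopped_sum_square_le:
  assumes n: "stopping_index n L" and f: "f \<in> bounded_measurable S" and f0: "(\<integral>v. f v \<partial>\<nu>) = 0"
  shows "(\<integral>\<omega>. (\<Sum>j<n \<omega>. f (V j \<omega>))\<^sup>2 \<partial>\<Omega>) \<le> gap_const * (real L + 1) * (\<integral>v. (f v)\<^sup>2 \<partial>\<nu>)"
proof -
  have "(\<lambda>k. real L * \<rho> ^ k) \<longlonglongrightarrow> real L * 0"
    using rho_pos rho_less by (intro tendsto_intros LIMSEQ_power_zero) auto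
  then have "eventually (\<lambda>k. real L * \<rho> ^ k < 1) sequentially"
    by (auto dest: order_tendstoD(2)[of _ 0 _ 1])
  then obtain K where K: "real L * \<rho> ^ K \<le> 1"
    by (auto simp: eventually_sequentially intro: less_imp_le)
  define g where "g = poisson f K"
  define R where "R = (P ^^ K) f"
  let ?N = "\<integral>v. (f v)\<^sup>2 \<partial>\<nu>"
  let ?G = "\<integral>v. (g v)\<^sup>2 \<partial>\<nu>"
  have g: "g \<in> bounded_measurable S" unfolding g_def by (rule poisson_bounded_measurable[OF f])
  have R: "R \<in> bounded_measurable S" unfolding R_def by (rule iter_bounded_measurable[OF f])
  have g2: "(\<lambda>v. (g v)\<^sup>2) \<in> bounded_measurable S" and R2: "(\<lambda>v. (R v)\<^sup>2) \<in> bounded_measurable S"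
    using g R by (auto intro: bounded_measurable_intros)
  define c where "c j \<omega> = (of_bool (j < n \<omega>) :: real)" for j \<omega>
  have c: "c j \<in> bounded_measurable (H j)" for j
    unfolding c_def by (rule stopping_coefficient[OF n])
  let ?M = "\<lambda>\<omega>. \<Sum>j<L. c j \<omega> * increment g j \<omega>"
  have M: "?M \<in> bounded_measurable \<Omega>"
    by (intro bounded_measurable_sum bounded_measurable_mult bounded_history[OF c] increment_bounded[OF g])
  have pt: "(\<Sum>j<n \<omega>. f (V j \<omega>))\<^sup>2 \<le> 3 * (?M \<omega>)\<^sup>2 + 12 * (\<Sum>j\<le>L. (g (V j \<omega>))\<^sup>2) + 3 * (real L * (\<Sum>j<L. (R (V j \<omega>))\<^sup>2))"
    if \<omega>: "\<omega> \<in> space \<Omega>" for \<omega>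
  proof -
    have nL: "n \<omega> \<le> L" using n \<omega> by (rule stopping_index_le)
    have "(\<Sum>j<n \<omega>. f (V j \<omega>))\<^sup>2 = (?M \<omega> + (g (V 0 \<omega>) - g (V (n \<omega>) \<omega>)) + (\<Sum>j<n \<omega>. R (V j \<omega>)))\<^sup>2"
      unfolding poisson_decomposition[OF f \<omega>, of "n \<omega>" K] g_def[symmetric] R_def[symmetric] sum_stopped[OF nL, of "\<lambda>j. increment g j \<omega>"]
      by (simp add: c_def)
    also have "\<dots> \<le> 3 * (?M \<omega>)\<^sup>2 + 3 * (g (V 0 \<omega>) - g (V (n \<omega>) \<omega>))\<^sup>2 + 3 * (\<Sum>j<n \<omega>. R (V j \<omega>))\<^sup>2"
      by (rule power2_sum3_le)
    also have "(g (V 0 \<omega>) - g (V (n \<omega>) \<omega>))\<^sup>2 \<le> 2 * (g (V 0 \<omega>))\<^sup>2 + 2 * (g (V (n \<omega>) \<omega>))\<^sup>2"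
      using power2_sum2_le[of "g (V 0 \<omega>)" "- g (V (n \<omega>) \<omega>)"] by simp
    also have "(g (V 0 \<omega>))\<^sup>2 \<le> (\<Sum>j\<le>L. (g (V j \<omega>))\<^sup>2)"
      by (rule member_le_sum[where f="\<lambda>j. (g (V j \<omega>))\<^sup>2"]) auto
    also have "(g (V (n \<omega>) \<omega>))\<^sup>2 \<le> (\<Sum>j\<le>L. (g (V j \<omega>))\<^sup>2)"
      using nL by (intro member_le_sum[where f="\<lambda>j. (g (V j \<omega>))\<^sup>2"]) auto
    also have "(\<Sum>j<n \<omega>. R (V j \<omega>))\<^sup>2 \<le> real (n \<omega>) * (\<Sum>j<n \<omega>. (R (V j \<omega>))\<^sup>2)"
      using Cauchy_Schwarz_ineq_sum[of "\<lambda>_. 1" "\<lambda>j. R (V j \<omega>)" "{..<n \<omega>}"] by simp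
    also have "\<dots> \<le> real L * (\<Sum>j<L. (R (V j \<omega>))\<^sup>2)"
      using nL by (intro mult_mono sum_mono2 sum_nonneg) auto
    finally show ?thesis by simp
  qed
  have iM: "integrable \<Omega> (\<lambda>\<omega>. (?M \<omega>)\<^sup>2)"
    using bounded_measurable_power[OF M] by (rule bounded_measurable_integrable)
  have ig: "integrable \<Omega> (\<lambda>\<omega>. (g (V j \<omega>))\<^sup>2)" and iR: "integrable \<Omega> (\<lambda>\<omega>. (R (V j \<omega>))\<^sup>2)" for j
    using bounded_V[OF g2, of j] bounded_V[OF R2, of j] by (auto intro: bounded_measurable_integrable)
  have Eg: "(\<integral>\<omega>. (g (V j \<omega>))\<^sup>2 \<partial>\<Omega>) = ?G" and ER: "(\<integral>\<omega>. (R (V j \<omega>))\<^sup>2 \<partial>\<Omega>) = (\<integral>v. (R v)\<^sup>2 \<partial>\<nu>)" for j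
    using expectation_V_bounded[OF g2, of j] expectation_V_bounded[OF R2, of j] by auto
  have EM: "(\<integral>\<omega>. (?M \<omega>)\<^sup>2 \<partial>\<Omega>) \<le> real L * ?G"
  proof -
    have "(\<integral>\<omega>. (?M \<omega>)\<^sup>2 \<partial>\<Omega>) = (\<Sum>j<L. \<integral>\<omega>. (c j \<omega>)\<^sup>2 * cond_var g (V j \<omega>) \<partial>\<Omega>)"
      by (rule martingale_transform_square[OF c g])
    also have "\<dots> \<le> (\<Sum>j<L. \<integral>\<omega>. cond_var g (V j \<omega>) \<partial>\<Omega>)"
    proof (intro sum_mono integral_mono)
      fix j
      show "integrable \<Omega> (\<lambda>\<omega>. cond_var g (V j \<omega>))"
        using bounded_V[OF cond_var_bounded_measurable[OF g]] by (rule bounded_measurable_integrable)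
      show "integrable \<Omega> (\<lambda>\<omega>. (c j \<omega>)\<^sup>2 * cond_var g (V j \<omega>))"
        using bounded_measurable_mult[OF bounded_measurable_power[OF bounded_history[OF c]] bounded_V[OF cond_var_bounded_measurable[OF g]]]
        by (rule bounded_measurable_integrable)
      show "(c j \<omega>)\<^sup>2 * cond_var g (V j \<omega>) \<le> cond_var g (V j \<omega>)" if "\<omega> \<in> space \<Omega>" for \<omega>
        using cond_var_nonneg[OF g measurable_space[OF V_measurable that]] by (simp add: c_def)
    qed
    also have "\<dots> = (\<Sum>j<L. \<integral>v. cond_var g v \<partial>\<nu>)"
      by (simp only: expectation_V_bounded[OF cond_var_bounded_measurable[OF g]])
    also have "\<dots> \<le> real L * ?G"
      using integral_cond_var_le[OF g] by (simp add: mult_left_mono)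
    finally show ?thesis .
  qed
  have "(\<integral>\<omega>. (\<Sum>j<n \<omega>. f (V j \<omega>))\<^sup>2 \<partial>\<Omega>)
      \<le> (\<integral>\<omega>. 3 * (?M \<omega>)\<^sup>2 + 12 * (\<Sum>j\<le>L. (g (V j \<omega>))\<^sup>2) + 3 * (real L * (\<Sum>j<L. (R (V j \<omega>))\<^sup>2)) \<partial>\<Omega>)"
  proof (rule integral_mono[OF _ _ pt])
    show "integrable \<Omega> (\<lambda>\<omega>. (\<Sum>j<n \<omega>. f (V j \<omega>))\<^sup>2)"
      using bounded_measurable_power[OF stopped_sum_V_bounded_measurable[OF n f]] by (rule bounded_measurable_integrable)
  qed (use iM ig iR in auto)
  also have "\<dots> = 3 * (\<integral>\<omega>. (?M \<omega>)\<^sup>2 \<partial>\<Omega>) + 12 * ((real L + 1) * ?G) + 3 * (real L * (real L * (\<integral>v. (R v)\<^sup>2 \<partial>\<nu>)))"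
    using iM ig iR by (simp add: Eg ER add.commute)
  also have "(\<integral>\<omega>. (?M \<omega>)\<^sup>2 \<partial>\<Omega>) \<le> real L * ?G" by (rule EM)
  also have "real L * (real L * (\<integral>v. (R v)\<^sup>2 \<partial>\<nu>)) \<le> real L * (real L * ((\<rho> ^ K)\<^sup>2 * ?N))"
    unfolding R_def by (intro mult_left_mono iter_decay f f0) auto
  also have "\<dots> = (real L * \<rho> ^ K)\<^sup>2 * ?N" by (simp add: power2_eq_square)
  also have "\<dots> \<le> 1 * ?N"
    using K rho_pos by (intro mult_right_mono power_le_one) auto
  finally have "(\<integral>\<omega>. (\<Sum>j<n \<omega>. f (V j \<omega>))\<^sup>2 \<partial>\<Omega>) \<le> (15 * real L + 12) * ?G + 3 * ?N"
    by (simp add: algebra_simps)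
  also have "\<dots> \<le> (15 * real L + 12) * (?N / (1 - \<rho>)\<^sup>2) + 3 * (?N / (1 - \<rho>)\<^sup>2)"
  proof (intro add_mono mult_left_mono)
    show "?G \<le> ?N / (1 - \<rho>)\<^sup>2" unfolding g_def by (rule poisson_norm[OF f f0])
    have "(1 - \<rho>)\<^sup>2 \<le> 1" using rho_pos rho_less by (intro power_le_one) auto
    moreover have "?N \<ge> 0" by simp
    ultimately show "?N \<le> ?N / (1 - \<rho>)\<^sup>2"
      using rho_less by (simp add: pos_le_divide_eq mult_left_le)
  qed auto
  also have "\<dots> = 15 * (real L + 1) * (?N / (1 - \<rho>)\<^sup>2)"
  proof -
    have "(15 * l + 12) * X + 3 * X = 15 * (l + 1) * X" for l X :: real by (simp add: algebra_simps)
    then show ?thesis by blast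
  qed
  also have "\<dots> = gap_const * (real L + 1) * ?N"
    by (simp add: gap_const_def)
  finally show ?thesis .
qed

end


section \<open>Counting collisions\<close>

lemma initial_segment_card:
  assumes "finite A" "0 \<notin> A" "\<And>k l. k \<in> A \<Longrightarrow> 1 \<le> l \<Longrightarrow> l \<le> k \<Longrightarrow> l \<in> A"
  shows "A = {1..card A}"
proof (cases "A = {}")
  case False
  then have "Max A \<in> A" using assms by simp
  have "A = {1..Max A}"
  proof (intro equalityI subsetI)
    fix x assume "x \<in> A"
    then show "x \<in> {1..Max A}" using assms by (cases x) auto
  next
    fix x assume "x \<in> {1..Max A}"
    then show "x \<in> A" using assms(3)[OF \<open>Max A \<in> A\<close>, of x] by simp
  qed
  then show ?thesis by (metis card_atLeastAtMost diff_Suc_1 One_nat_def)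
qed simp

lemma summable_quadratic_geometric:
  fixes s :: real
  assumes "0 < s" "s < 1"
  shows "summable (\<lambda>j. (real j + 2)\<^sup>2 * s ^ j)"
proof -
  define r where "r = (1 + s) / 2"
  have r: "s < r" "r < 1" using assms by (auto simp: r_def)
  have "(\<lambda>j. (real j + 3)\<^sup>2 / (real j + 2)\<^sup>2 * s) \<longlonglongrightarrow> 1 * s"
    by (intro tendsto_mult tendsto_const) real_asymp
  then have "eventually (\<lambda>j. (real j + 3)\<^sup>2 / (real j + 2)\<^sup>2 * s < r) sequentially"
    using r by (intro order_tendstoD(2)) auto
  then obtain N where N: "\<And>j. j \<ge> N \<Longrightarrow> (real j + 3)\<^sup>2 / (real j + 2)\<^sup>2 * s < r"
    by (auto simp: eventually_sequentially)
  show ?thesis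
  proof (rule summable_ratio_test[OF r(2), of N])
    fix j assume "j \<ge> N"
    have "(real j + 3)\<^sup>2 * s = (real j + 3)\<^sup>2 / (real j + 2)\<^sup>2 * s * (real j + 2)\<^sup>2" by simp
    also have "\<dots> \<le> r * (real j + 2)\<^sup>2" using N[OF \<open>j \<ge> N\<close>] by (intro mult_right_mono) auto
    finally have "(real j + 3)\<^sup>2 * s * s ^ j \<le> r * (real j + 2)\<^sup>2 * s ^ j"
      using assms by (intro mult_right_mono) auto
    then show "norm ((real (Suc j) + 2)\<^sup>2 * s ^ Suc j) \<le> r * norm ((real j + 2)\<^sup>2 * s ^ j)"
      using assms by (simp add: algebra_simps abs_mult)
  qed
qed

locale flight_chain = gapped_chain \<Omega> S \<nu> \<eta> V \<rho>
  for \<Omega> :: "'w measure" and S \<nu> :: "'a measure" and \<eta> V \<rho> +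
  fixes \<tau> :: "'a \<Rightarrow> real"
  assumes flight_measurable[measurable]: "\<tau> \<in> borel_measurable S"
    and flight_pos: "v \<in> space S \<Longrightarrow> \<tau> v > 0"
    and flight_integrable: "integrable \<nu> \<tau>"
begin

definition arrival :: "nat \<Rightarrow> 'w \<Rightarrow> real" where
  "arrival k \<omega> = (\<Sum>j<k. \<tau> (V j \<omega>))"

definition mean_flight :: real where
  "mean_flight = (\<integral>v. \<tau> v \<partial>\<nu>)"

definition count :: "real \<Rightarrow> 'w \<Rightarrow> nat" where
  "count T \<omega> = card {k. k \<ge> 1 \<and> arrival k \<omega> \<le> T}"

definition capped_count :: "nat \<Rightarrow> real \<Rightarrow> 'w \<Rightarrow> nat" where
  "capped_count L T \<omega> = card {k \<in> {1..L}. arrival k \<omega> \<le> T}"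

lemma mean_flight_pos: "mean_flight > 0"
proof -
  have "(\<integral>v. 0 \<partial>\<nu>) < (\<integral>v. \<tau> v \<partial>\<nu>)"
    by (rule nu.integral_less_AE_space) (auto intro!: flight_integrable AE_I2 flight_pos)
  then show ?thesis by (simp add: mean_flight_def)
qed

lemma arrival_measurable[measurable]: "arrival k \<in> borel_measurable \<Omega>"
  unfolding arrival_def[abs_def] by measurable

lemma arrival_mono:
  assumes "\<omega> \<in> space \<Omega>" "k \<le> l"
  shows "arrival k \<omega> \<le> arrival l \<omega>"
  unfolding arrival_def using assms flight_pos[OF measurable_space[OF V_measurable assms(1)]]
  by (intro sum_mono2) (auto intro: less_imp_le)

lemma less_capped_count_iff:
  assumes \<omega>: "\<omega> \<in> space \<Omega>"
  shows "j < capped_count L T \<omega> \<longleftrightarrow> j < L \<and> arrival (Suc j) \<omega> \<le> T"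
proof -
  let ?A = "{k \<in> {1..L}. arrival k \<omega> \<le> T}"
  have "?A = {1..card ?A}"
    using arrival_mono[OF \<omega>] by (intro initial_segment_card) (auto intro: order_trans)
  then have "Suc j \<in> ?A \<longleftrightarrow> Suc j \<in> {1..card ?A}" by simp
  then show ?thesis by (auto simp: capped_count_def)
qed

lemma stopping_index_capped_count: "stopping_index (capped_count L T) L"
  unfolding stopping_index_def
proof (intro conjI allI ballI)
  fix j
  have [measurable]: "arrival (Suc j) \<in> borel_measurable (H j)"
    unfolding arrival_def[abs_def]
    by (intro borel_measurable_sum measurable_compose[OF V_history flight_measurable]) auto
  have "{\<omega> \<in> space \<Omega>. j < capped_count L T \<omega>} = {\<omega> \<in> space (H j). j < L \<and> arrival (Suc j) \<omega> \<le> T}"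
    by (auto simp: less_capped_count_iff)
  also have "\<dots> \<in> sets (H j)" by measurable
  finally show "{\<omega> \<in> space \<Omega>. j < capped_count L T \<omega>} \<in> sets (H j)" .
next
  show "capped_count L T \<omega> \<le> L" for \<omega>
    unfolding capped_count_def using card_mono[of "{1..L}" "{k \<in> {1..L}. arrival k \<omega> \<le> T}"]
    by (metis (no_types, lifting) card_atLeastAtMost diff_Suc_1 finite_atLeastAtMost mem_Collect_eq subsetI)
qed

lemma count_eq_capped_count:
  assumes "\<omega> \<in> space \<Omega>" "T < arrival L \<omega>"
  shows "count T \<omega> = capped_count L T \<omega>"
proof -
  have "k \<le> L" if "arrival k \<omega> \<le> T" for k
    using arrival_mono[OF assms(1), of L k] assms(2) that by (cases "k \<le> L") auto
  then have "{k. k \<ge> 1 \<and> arrival k \<omega> \<le> T} = {k \<in> {1..L}. arrival k \<omega> \<le> T}" by auto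
  then show ?thesis by (simp add: count_def capped_count_def)
qed

lemma count_measurable[measurable]: "count T \<in> \<Omega> \<rightarrow>\<^sub>M count_space UNIV"
  unfolding count_def[abs_def] by measurable

lemma arrival_count:
  assumes "\<omega> \<in> space \<Omega>" "finite {k. k \<ge> 1 \<and> arrival k \<omega> \<le> T}" "arrival (Suc l) \<omega> \<le> T"
  shows "arrival (count T \<omega>) \<omega> \<le> T" "l < count T \<omega>"
proof -
  let ?A = "{k. k \<ge> 1 \<and> arrival k \<omega> \<le> T}"
  have eq: "?A = {1..card ?A}"
    using arrival_mono[OF assms(1)] assms(2) by (intro initial_segment_card) (auto intro: order_trans)
  have "Suc l \<in> ?A" using assms(3) by simp
  from eq[THEN equalityD1, THEN subsetD, OF this] have l: "Suc l \<le> card ?A" by simp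
  then have "card ?A \<in> {1..card ?A}" by simp
  from eq[THEN equalityD2, THEN subsetD, OF this] have "card ?A \<in> ?A" .
  with l show "arrival (count T \<omega>) \<omega> \<le> T" "l < count T \<omega>" unfolding count_def by simp_all
qed

lemma P_square_norm_le:
  assumes w: "w \<in> bounded_measurable S"
  shows "(\<integral>v. (P w v)\<^sup>2 \<partial>\<nu>) \<le> \<rho>\<^sup>2 * (\<integral>v. (w v)\<^sup>2 \<partial>\<nu>) + (1 - \<rho>\<^sup>2) * (\<integral>v. w v \<partial>\<nu>)\<^sup>2"
proof -
  define m where "m = (\<integral>v. w v \<partial>\<nu>)"
  let ?w = "\<lambda>v. w v - m"
  have Pm: "(\<integral>v. P w v \<partial>\<nu>) = m" using integral_P_nu[OF w] by (simp add: m_def)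
  have w0: "?w \<in> bounded_measurable S" using w by (intro bounded_measurable_intros)
  have "(\<integral>v. ?w v \<partial>\<nu>) = 0" using w by (simp add: integrable_nu m_def)
  from gap[OF w0 this] have g: "(\<integral>v. (P ?w v)\<^sup>2 \<partial>\<nu>) \<le> \<rho>\<^sup>2 * (\<integral>v. (?w v)\<^sup>2 \<partial>\<nu>)" .
  have "P ?w v = P w v - m" if "v \<in> space S" for v
    using P_diff[OF w bounded_measurable_const that] P_const[OF that] by simp
  then have "(\<integral>v. (P ?w v)\<^sup>2 \<partial>\<nu>) = (\<integral>v. (P w v - m)\<^sup>2 \<partial>\<nu>)"
    by (intro Bochner_Integration.integral_cong) auto
  then have 1: "(\<integral>v. (P ?w v)\<^sup>2 \<partial>\<nu>) = (\<integral>v. (P w v)\<^sup>2 \<partial>\<nu>) - m\<^sup>2"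
    using integral_centered_square[OF P_bounded_measurable[OF w]] by (simp add: Pm)
  have 2: "(\<integral>v. (?w v)\<^sup>2 \<partial>\<nu>) = (\<integral>v. (w v)\<^sup>2 \<partial>\<nu>) - m\<^sup>2"
    unfolding m_def by (rule integral_centered_square[OF w])
  show ?thesis using g unfolding 1 2 m_def[symmetric] by (simp add: algebra_simps)
qed

text \<open>The operator \<open>u \<mapsto> P (f u)\<close> has norm less than one as soon as \<open>f \<le> 1\<close> is not almost
  everywhere one, by the gap on mean-zero functions and by Cauchy-Schwarz on the constants.\<close>

lemma multiplicative_functional_decay:
  assumes f: "f \<in> bounded_measurable S" and f01: "\<And>v. v \<in> space S \<Longrightarrow> 0 \<le> f v \<and> f v \<le> 1"
    and u: "u \<in> bounded_measurable S"
  shows "(\<integral>\<omega>. (\<Prod>j\<le>k. f (V j \<omega>)) * u (V k \<omega>) \<partial>\<Omega>)\<^sup>2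
    \<le> (\<rho>\<^sup>2 + (1 - \<rho>\<^sup>2) * (\<integral>v. (f v)\<^sup>2 \<partial>\<nu>)) ^ k * (\<integral>v. (u v)\<^sup>2 \<partial>\<nu>)"
  using u
proof (induction k arbitrary: u)
  case 0
  have fu: "(\<lambda>v. f v * u v) \<in> bounded_measurable S" using f 0 by (intro bounded_measurable_intros)
  have "(\<integral>\<omega>. (\<Prod>j\<le>0. f (V j \<omega>)) * u (V 0 \<omega>) \<partial>\<Omega>) = (\<integral>v. f v * u v \<partial>\<nu>)"
    using expectation_V_bounded[OF fu, of 0] by simp
  also have "\<dots>\<^sup>2 \<le> (\<integral>v. (f v * u v)\<^sup>2 \<partial>\<nu>)"
    using fu by (intro nu.expectation_square_le integrable_nu bounded_measurable_power)
      (auto dest: bounded_measurable_measurable)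
  also have "\<dots> \<le> (\<integral>v. (u v)\<^sup>2 \<partial>\<nu>)"
  proof (rule integral_mono)
    show "(f v * u v)\<^sup>2 \<le> (u v)\<^sup>2" if "v \<in> space \<nu>" for v
      using f01[of v] that by (auto simp: power_mult_distrib intro!: mult_left_le_one_le power_le_one)
  qed (use fu 0 in \<open>auto intro: integrable_nu bounded_measurable_power\<close>)
  finally show ?case by simp
next
  case (Suc k)
  let ?l = "\<rho>\<^sup>2 + (1 - \<rho>\<^sup>2) * (\<integral>v. (f v)\<^sup>2 \<partial>\<nu>)"
  have fu: "(\<lambda>v. f v * u v) \<in> bounded_measurable S" using f Suc.prems by (intro bounded_measurable_intros)
  have prod: "(\<lambda>\<omega>. \<Prod>j\<le>k. f (V j \<omega>)) \<in> bounded_measurable (H k)"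
    using f by (intro bounded_measurable_prod bounded_V_history) auto
  have rho1: "\<rho>\<^sup>2 < 1" using rho_pos rho_less by (simp add: power_less_one_iff)
  have l0: "?l \<ge> 0" using rho1 by (intro add_nonneg_nonneg mult_nonneg_nonneg) auto
  have "(\<integral>\<omega>. (\<Prod>j\<le>Suc k. f (V j \<omega>)) * u (V (Suc k) \<omega>) \<partial>\<Omega>)
      = (\<integral>\<omega>. (\<Prod>j\<le>k. f (V j \<omega>)) * (f (V (Suc k) \<omega>) * u (V (Suc k) \<omega>)) \<partial>\<Omega>)"
    by (simp add: mult_ac)
  also have "\<dots> = (\<integral>\<omega>. (\<Prod>j\<le>k. f (V j \<omega>)) * P (\<lambda>v. f v * u v) (V k \<omega>) \<partial>\<Omega>)"
    by (rule markov[OF prod fu])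
  also have "\<dots>\<^sup>2 \<le> ?l ^ k * (\<integral>v. (P (\<lambda>v. f v * u v) v)\<^sup>2 \<partial>\<nu>)"
    by (rule Suc.IH[OF P_bounded_measurable[OF fu]])
  also have "\<dots> \<le> ?l ^ k * (?l * (\<integral>v. (u v)\<^sup>2 \<partial>\<nu>))"
  proof (rule mult_left_mono)
    have h1: "(\<integral>v. (P (\<lambda>v. f v * u v) v)\<^sup>2 \<partial>\<nu>) \<le> \<rho>\<^sup>2 * (\<integral>v. (f v * u v)\<^sup>2 \<partial>\<nu>) + (1 - \<rho>\<^sup>2) * (\<integral>v. f v * u v \<partial>\<nu>)\<^sup>2"
      by (rule P_square_norm_le[OF fu])
    have h2: "(\<integral>v. (f v * u v)\<^sup>2 \<partial>\<nu>) \<le> (\<integral>v. (u v)\<^sup>2 \<partial>\<nu>)"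
    proof (rule integral_mono)
      show "(f v * u v)\<^sup>2 \<le> (u v)\<^sup>2" if "v \<in> space \<nu>" for v
        using f01[of v] that by (auto simp: power_mult_distrib intro!: mult_left_le_one_le power_le_one)
    qed (use fu Suc.prems in \<open>auto intro: integrable_nu bounded_measurable_power\<close>)
    have h3: "(\<integral>v. f v * u v \<partial>\<nu>)\<^sup>2 \<le> (\<integral>v. (f v)\<^sup>2 \<partial>\<nu>) * (\<integral>v. (u v)\<^sup>2 \<partial>\<nu>)"
      using f Suc.prems by (intro nu.expectation_cauchy_schwarz integrable_nu bounded_measurable_power)
        (auto dest: bounded_measurable_measurable)
    show "(\<integral>v. (P (\<lambda>v. f v * u v) v)\<^sup>2 \<partial>\<nu>) \<le> ?l * (\<integral>v. (u v)\<^sup>2 \<partial>\<nu>)"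
    proof -
      have "\<rho>\<^sup>2 * (\<integral>v. (f v * u v)\<^sup>2 \<partial>\<nu>) \<le> \<rho>\<^sup>2 * (\<integral>v. (u v)\<^sup>2 \<partial>\<nu>)"
        using h2 by (rule mult_left_mono) simp
      moreover have "(1 - \<rho>\<^sup>2) * (\<integral>v. f v * u v \<partial>\<nu>)\<^sup>2 \<le> (1 - \<rho>\<^sup>2) * ((\<integral>v. (f v)\<^sup>2 \<partial>\<nu>) * (\<integral>v. (u v)\<^sup>2 \<partial>\<nu>))"
        using h3 rho1 by (intro mult_left_mono) auto
      moreover have "?l * (\<integral>v. (u v)\<^sup>2 \<partial>\<nu>) = \<rho>\<^sup>2 * (\<integral>v. (u v)\<^sup>2 \<partial>\<nu>) + (1 - \<rho>\<^sup>2) * ((\<integral>v. (f v)\<^sup>2 \<partial>\<nu>) * (\<integral>v. (u v)\<^sup>2 \<partial>\<nu>))"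
        by (simp only: distrib_right mult.assoc)
      ultimately show ?thesis using h1 by linarith
    qed
  qed (use l0 in simp)
  finally show ?case by (simp add: mult_ac)
qed

text \<open>The fourth root of the bound on the squared norm in \<open>multiplicative_functional_decay\<close>. Up to
  the factor \<open>exp T\<close>, the probability of \<open>k\<close> further collisions by time \<open>T\<close> is then at most
  \<open>decay ^ k * decay ^ k\<close>: one power pays for \<open>exp T\<close>, the other one remains summable.\<close>

definition decay :: real where
  "decay = sqrt (sqrt (\<rho>\<^sup>2 + (1 - \<rho>\<^sup>2) * (\<integral>v. (exp (- \<tau> v))\<^sup>2 \<partial>\<nu>)))"

lemma exp_flight_bounded_measurable: "(\<lambda>v. exp (- \<tau> v)) \<in> bounded_measurable S"
  using flight_pos by (intro bounded_measurableI[where B=1]) (auto intro: less_imp_le)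

lemma decay_pos: "decay > 0" and decay_less: "decay < 1"
proof -
  have rho1: "\<rho>\<^sup>2 < 1" using rho_pos rho_less by (simp add: power_less_one_iff)
  let ?E = "\<integral>v. (exp (- \<tau> v))\<^sup>2 \<partial>\<nu>"
  have "?E < (\<integral>v. 1 \<partial>\<nu>)"
  proof (rule nu.integral_less_AE_space)
    show "integrable \<nu> (\<lambda>v. (exp (- \<tau> v))\<^sup>2)"
      using exp_flight_bounded_measurable by (intro integrable_nu bounded_measurable_power)
    show "AE v in \<nu>. (exp (- \<tau> v))\<^sup>2 < 1"
      by (rule AE_I2) (auto simp: power_less_one_iff flight_pos)
  qed (auto simp: nu.emeasure_space_1)
  then have "?E < 1" by (simp add: nu.prob_space)
  then have "(1 - \<rho>\<^sup>2) * ?E < (1 - \<rho>\<^sup>2) * 1" using rho1 by (intro mult_strict_left_mono) auto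
  moreover have "(1 - \<rho>\<^sup>2) * ?E \<ge> 0" using rho1 by (intro mult_nonneg_nonneg) auto
  moreover have "\<rho>\<^sup>2 > 0" using rho_pos by simp
  ultimately show "decay > 0" "decay < 1"
    unfolding decay_def by (auto intro: add_pos_nonneg)
qed

lemma prob_arrival_le:
  "prob {\<omega> \<in> space \<Omega>. arrival (Suc k) \<omega> \<le> T} \<le> exp T * decay ^ k * decay ^ k"
proof -
  let ?f = "\<lambda>v. exp (- \<tau> v)"
  let ?X = "\<lambda>\<omega>. \<Prod>j\<le>k. ?f (V j \<omega>)"
  let ?l = "\<rho>\<^sup>2 + (1 - \<rho>\<^sup>2) * (\<integral>v. (?f v)\<^sup>2 \<partial>\<nu>)"
  have rho1: "\<rho>\<^sup>2 < 1" using rho_pos rho_less by (simp add: power_less_one_iff)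
  have l0: "?l \<ge> 0" using rho1 by (intro add_nonneg_nonneg mult_nonneg_nonneg) auto
  have X: "?X \<in> bounded_measurable \<Omega>"
    by (intro bounded_measurable_prod bounded_V exp_flight_bounded_measurable)
  have X_eq: "?X \<omega> = exp (- arrival (Suc k) \<omega>)" for \<omega>
    by (simp add: arrival_def exp_sum[symmetric] sum_negf lessThan_Suc_atMost)
  have "(\<integral>\<omega>. ?X \<omega> \<partial>\<Omega>)\<^sup>2 \<le> ?l ^ k"
    using multiplicative_functional_decay[OF exp_flight_bounded_measurable _ bounded_measurable_const[of 1], of k]
    by (simp add: flight_pos less_imp_le)
  also have "\<dots> = (decay ^ k * decay ^ k)\<^sup>2"
  proof -
    have "decay * decay = sqrt ?l" using l0 by (simp add: decay_def)
    then have "?l = (decay * decay)\<^sup>2" using l0 by simp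
    then show ?thesis by (metis power_mult mult.commute power_mult_distrib)
  qed
  finally have "(\<integral>\<omega>. ?X \<omega> \<partial>\<Omega>)\<^sup>2 \<le> (decay ^ k * decay ^ k)\<^sup>2" .
  moreover have "0 \<le> decay ^ k * decay ^ k" using decay_pos by simp
  ultimately have EX: "(\<integral>\<omega>. ?X \<omega> \<partial>\<Omega>) \<le> decay ^ k * decay ^ k"
    by (rule power2_le_imp_le)
  have "prob {\<omega> \<in> space \<Omega>. arrival (Suc k) \<omega> \<le> T} = (\<integral>\<omega>. indicator {\<omega> \<in> space \<Omega>. arrival (Suc k) \<omega> \<le> T} \<omega> \<partial>\<Omega>)"
    by simp
  also have "\<dots> \<le> (\<integral>\<omega>. exp T * ?X \<omega> \<partial>\<Omega>)"
  proof (rule integral_mono)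
    show "integrable \<Omega> (\<lambda>\<omega>. exp T * ?X \<omega>)"
      using X by (intro bounded_measurable_integrable bounded_measurable_mult bounded_measurable_const)
    show "indicator {\<omega> \<in> space \<Omega>. arrival (Suc k) \<omega> \<le> T} \<omega> \<le> exp T * ?X \<omega>" for \<omega>
      unfolding X_eq by (auto simp: indicator_def exp_add[symmetric])
  qed (auto intro!: integrable_real_indicator simp: less_top[symmetric])
  also have "\<dots> = exp T * (\<integral>\<omega>. ?X \<omega> \<partial>\<Omega>)" by simp
  also have "\<dots> \<le> exp T * (decay ^ k * decay ^ k)" using EX by (intro mult_left_mono) auto
  finally show ?thesis by (simp add: mult.assoc)
qed

text \<open>The cap grows linearly with \<open>T\<close>, fast enough that more collisions than the cap are
  exponentially unlikely, and faster than the expected number \<open>T / mean_flight\<close>.\<close>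

definition cap_rate :: real where
  "cap_rate = 2 / ln (1 / decay) + 1 / mean_flight"

definition cap :: "real \<Rightarrow> nat" where
  "cap T = Suc (nat \<lceil>cap_rate * T\<rceil>)"

lemma cap_rate_pos: "cap_rate > 0"
proof -
  have "ln (1 / decay) > 0" using decay_pos decay_less by simp
  then show ?thesis using mean_flight_pos by (simp add: cap_rate_def add_pos_pos)
qed

lemma cap_bound: "T \<ge> 0 \<Longrightarrow> real (cap T) \<le> cap_rate * T + 2"
  using cap_rate_pos by (simp add: cap_def) linarith

definition tail_const :: real where
  "tail_const = (\<Sum>j. (real j + 2)\<^sup>2 * decay ^ j)"

text \<open>If infinitely many collisions happen before \<open>T\<close>, the count is \<open>0\<close>; otherwise all of the first
  \<open>count T\<close> arrivals are before \<open>T\<close>. In both cases one term of the series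
  \<open>\<Sum>j. (j + 2)\<^sup>2 1(arrival (Suc j) \<le> T)\<close> beyond the cap dominates.\<close>

lemma count_square_tail:
  assumes T: "T \<ge> 0"
  shows "integrable \<Omega> (\<lambda>\<omega>. (real (count T \<omega>) + 1)\<^sup>2 * indicator {\<omega> \<in> space \<Omega>. arrival (cap T) \<omega> \<le> T} \<omega>)"
      (is "integrable \<Omega> ?X")
    and "(\<integral>\<omega>. (real (count T \<omega>) + 1)\<^sup>2 * indicator {\<omega> \<in> space \<Omega>. arrival (cap T) \<omega> \<le> T} \<omega> \<partial>\<Omega>) \<le> tail_const * exp (- T)"
proof -
  obtain l where l: "cap T = Suc l" "cap_rate * T \<le> real l"
    unfolding cap_def by (auto intro: real_nat_ceiling_ge)
  define E where "E j = {\<omega> \<in> space \<Omega>. arrival (Suc j) \<omega> \<le> T}" for j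
  have E[measurable]: "E j \<in> sets \<Omega>" for j unfolding E_def by measurable
  define a where "a j = (if l \<le> j then (real j + 2)\<^sup>2 else 0)" for j
  have a0: "a j \<ge> 0" for j by (simp add: a_def)
  have pt: "ennreal (?X \<omega>) \<le> (\<Sum>j. ennreal (a j) * indicator (E j) \<omega>)" if \<omega>: "\<omega> \<in> space \<Omega>" for \<omega>
  proof (cases "arrival (Suc l) \<omega> \<le> T")
    case True
    let ?N = "count T \<omega>"
    obtain j where j: "l \<le> j" "\<omega> \<in> E j" "real ?N + 1 \<le> real j + 2"
    proof (cases "finite {k. k \<ge> 1 \<and> arrival k \<omega> \<le> T}")
      case True
      then have "arrival ?N \<omega> \<le> T" "l < ?N" using arrival_count[OF \<omega> _ \<open>arrival (Suc l) \<omega> \<le> T\<close>] by auto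
      then show ?thesis using \<omega> by (intro that[of "?N - 1"]) (auto simp: E_def of_nat_diff)
    next
      case False
      then have "?N = 0" by (simp add: count_def)
      then show ?thesis using \<omega> \<open>arrival (Suc l) \<omega> \<le> T\<close> by (intro that[of l]) (auto simp: E_def)
    qed
    have "ennreal (?X \<omega>) = ennreal ((real ?N + 1)\<^sup>2)" using True \<omega> by (simp add: l)
    also have "\<dots> \<le> ennreal ((real j + 2)\<^sup>2)" using j by (intro ennreal_leI power_mono) auto
    also have "\<dots> = ennreal (a j) * indicator (E j) \<omega>" using j by (simp add: a_def)
    also have "\<dots> \<le> (\<Sum>j. ennreal (a j) * indicator (E j) \<omega>)"
    proof -
      have single: "sum F {j} = F j" for F :: "nat \<Rightarrow> ennreal" by simp
      show ?thesis
        using sum_le_suminf[OF summableI, of "{j}" "\<lambda>j. ennreal (a j) * indicator (E j) \<omega>"]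
        unfolding single by simp
    qed
    finally show ?thesis .
  qed (use \<omega> in \<open>simp add: l\<close>)
  have summand: "a j * prob (E j) \<le> exp (- T) * ((real j + 2)\<^sup>2 * decay ^ j)" for j
  proof (cases "l \<le> j")
    case True
    have "decay ^ j = exp (- (real j * ln (1 / decay)))"
      using decay_pos by (simp add: ln_div powr_realpow[symmetric] powr_def)
    also have "\<dots> \<le> exp (- 2 * T)"
    proof -
      have ln: "ln (1 / decay) > 0" using decay_pos decay_less by simp
      have "2 * T = (2 / ln (1 / decay)) * T * ln (1 / decay)" using ln by simp
      also have "\<dots> \<le> cap_rate * T * ln (1 / decay)"
        using T ln mean_flight_pos by (intro mult_right_mono) (auto simp: cap_rate_def)
      also have "\<dots> \<le> real j * ln (1 / decay)" using l True ln by (intro mult_right_mono) auto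
      finally show ?thesis by simp
    qed
    finally have d: "decay ^ j \<le> exp (- 2 * T)" .
    have "prob (E j) \<le> exp T * decay ^ j * decay ^ j" unfolding E_def by (rule prob_arrival_le)
    also have "\<dots> \<le> exp T * exp (- 2 * T) * decay ^ j"
      using d decay_pos by (intro mult_right_mono mult_left_mono) auto
    also have "\<dots> = exp (- T) * decay ^ j" by (simp flip: exp_add)
    finally have "(real j + 2)\<^sup>2 * prob (E j) \<le> (real j + 2)\<^sup>2 * (exp (- T) * decay ^ j)"
      by (intro mult_left_mono) auto
    then show ?thesis using True by (simp add: a_def mult_ac)
  qed (use decay_pos in \<open>simp add: a_def\<close>)
  have sm: "summable (\<lambda>j. (real j + 2)\<^sup>2 * decay ^ j)"
    using decay_pos decay_less by (rule summable_quadratic_geometric)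
  have [measurable]: "?X \<in> borel_measurable \<Omega>" by measurable
  have "(\<integral>\<^sup>+\<omega>. ennreal (?X \<omega>) \<partial>\<Omega>) \<le> (\<integral>\<^sup>+\<omega>. (\<Sum>j. ennreal (a j) * indicator (E j) \<omega>) \<partial>\<Omega>)"
    by (intro nn_integral_mono pt)
  also have "\<dots> = (\<Sum>j. \<integral>\<^sup>+\<omega>. ennreal (a j) * indicator (E j) \<omega> \<partial>\<Omega>)"
    by (intro nn_integral_suminf) measurable
  also have "\<dots> = (\<Sum>j. ennreal (a j * prob (E j)))"
    using a0 by (simp add: nn_integral_cmult_indicator emeasure_eq_measure ennreal_mult)
  also have "\<dots> \<le> (\<Sum>j. ennreal (exp (- T) * ((real j + 2)\<^sup>2 * decay ^ j)))"
    by (intro suminf_le ennreal_leI summand summableI)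
  also have "\<dots> = ennreal (\<Sum>j. exp (- T) * ((real j + 2)\<^sup>2 * decay ^ j))"
    using sm decay_pos by (intro suminf_ennreal2 summable_mult) auto
  also have "(\<Sum>j. exp (- T) * ((real j + 2)\<^sup>2 * decay ^ j)) = exp (- T) * tail_const"
    unfolding tail_const_def by (rule suminf_mult[OF sm])
  finally have bound: "(\<integral>\<^sup>+\<omega>. ennreal (?X \<omega>) \<partial>\<Omega>) \<le> ennreal (exp (- T) * tail_const)" .
  show int: "integrable \<Omega> ?X"
    using bound by (intro integrableI_bounded) (auto simp: le_less_trans)
  have "tail_const \<ge> 0" unfolding tail_const_def using sm decay_pos by (intro suminf_nonneg) auto
  then show "(\<integral>\<omega>. ?X \<omega> \<partial>\<Omega>) \<le> tail_const * exp (- T)"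
    using bound nn_integral_eq_integral[OF int] by (simp add: mult.commute)
qed

lemma prob_cap_exceeded:
  assumes T: "T \<ge> 0"
  shows "prob {\<omega> \<in> space \<Omega>. arrival (cap T) \<omega> \<le> T} \<le> tail_const * exp (- T)"
proof -
  have "prob {\<omega> \<in> space \<Omega>. arrival (cap T) \<omega> \<le> T} = (\<integral>\<omega>. indicator {\<omega> \<in> space \<Omega>. arrival (cap T) \<omega> \<le> T} \<omega> \<partial>\<Omega>)"
    by simp
  also have "\<dots> \<le> (\<integral>\<omega>. (real (count T \<omega>) + 1)\<^sup>2 * indicator {\<omega> \<in> space \<Omega>. arrival (cap T) \<omega> \<le> T} \<omega> \<partial>\<Omega>)"
  proof (rule integral_mono[OF _ count_square_tail(1)[OF T]])
    show "integrable \<Omega> (\<lambda>\<omega>. indicator {\<omega> \<in> space \<Omega>. arrival (cap T) \<omega> \<le> T} \<omega> :: real)"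
      by (intro integrable_real_indicator) (auto simp: less_top[symmetric])
  qed (auto simp: indicator_def)
  also have "\<dots> \<le> tail_const * exp (- T)" by (rule count_square_tail(2)[OF T])
  finally show ?thesis .
qed


text \<open>Law of large numbers for the flight times: truncation at \<open>c\<close> makes the variance bound
  applicable, and the truncated mass is small uniformly in the number of summands.\<close>

lemma arrival_mean_L1:
  "(\<lambda>k. \<integral>\<omega>. \<bar>arrival k \<omega> / real k - mean_flight\<bar> \<partial>\<Omega>) \<longlonglongrightarrow> 0"
proof (rule LIMSEQ_I)
  fix e :: real assume e: "e > 0"
  define m where "m c = (\<integral>v. min (\<tau> v) (real c) \<partial>\<nu>)" for c :: nat
  have "m \<longlonglongrightarrow> mean_flight"
    unfolding m_def mean_flight_def
  proof (rule integral_dominated_convergence[where w=\<tau>])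
    show "AE v in \<nu>. (\<lambda>c. min (\<tau> v) (real c)) \<longlonglongrightarrow> \<tau> v"
    proof (rule AE_I2)
      fix v
      have "eventually (\<lambda>c. min (\<tau> v) (real c) = \<tau> v) sequentially"
        using eventually_ge_at_top[of "nat \<lceil>\<tau> v\<rceil>"] by eventually_elim (simp add: nat_ceiling_le_eq)
      then show "(\<lambda>c. min (\<tau> v) (real c)) \<longlonglongrightarrow> \<tau> v" by (rule tendsto_eventually)
    qed
    show "AE v in \<nu>. norm (min (\<tau> v) (real c)) \<le> \<tau> v" for c
    proof (rule AE_I2)
      fix v assume "v \<in> space \<nu>"
      then have "\<tau> v > 0" using flight_pos by simp
      then show "norm (min (\<tau> v) (real c)) \<le> \<tau> v" by (auto simp: abs_if min_def)
    qed
  qed (auto intro: flight_integrable)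
  then have "eventually (\<lambda>c. mean_flight - e / 4 < m c) sequentially"
    using e by (intro order_tendstoD(1)) auto
  then obtain c where c: "mean_flight - e / 4 < m c" by (auto simp: eventually_sequentially)
  let ?t = "\<lambda>v. min (\<tau> v) (real c)"
  let ?u = "\<lambda>v. ?t v - m c"
  have t: "?t \<in> bounded_measurable S"
  proof (rule bounded_measurableI[where B="real c"])
    fix v assume "v \<in> space S"
    then show "\<bar>min (\<tau> v) (real c)\<bar> \<le> real c" using flight_pos[of v] by (auto simp: abs_if min_def)
  qed simp
  have t0: "?u \<in> bounded_measurable S" using t by (intro bounded_measurable_diff bounded_measurable_const)
  have Et0: "(\<integral>v. ?u v \<partial>\<nu>) = 0" using t by (simp add: integrable_nu m_def nu.prob_space)
  define C where "C = gap_const * (\<integral>v. (?u v)\<^sup>2 \<partial>\<nu>)"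
  have "(\<lambda>k. sqrt (C * (real k + 1)) / real k) \<longlonglongrightarrow> 0"
  proof -
    have "(\<lambda>k. sqrt C * (sqrt (real k + 1) / real k)) \<longlonglongrightarrow> sqrt C * 0"
      by (intro tendsto_mult tendsto_const) real_asymp
    then show ?thesis by (simp add: real_sqrt_mult)
  qed
  then have "eventually (\<lambda>k. sqrt (C * (real k + 1)) / real k < e / 4) sequentially"
    using e by (intro order_tendstoD(2)) auto
  then have "eventually (\<lambda>k. (\<integral>\<omega>. \<bar>arrival k \<omega> / real k - mean_flight\<bar> \<partial>\<Omega>) < e) sequentially"
    using eventually_gt_at_top[of 0]
  proof eventually_elim
    fix k :: nat assume k: "sqrt (C * (real k + 1)) / real k < e / 4" "k > 0"
    let ?S = "\<lambda>\<omega>. \<Sum>j<k. ?u (V j \<omega>)"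
    let ?R = "\<lambda>\<omega>. \<Sum>j<k. \<tau> (V j \<omega>) - ?t (V j \<omega>)"
    have S: "?S \<in> bounded_measurable \<Omega>" by (intro bounded_measurable_sum bounded_V t0)
    have iR: "integrable \<Omega> (\<lambda>\<omega>. \<tau> (V j \<omega>) - ?t (V j \<omega>))" for j
      using integrable_V[OF flight_integrable, of j] bounded_V[OF t, of j]
      by (intro Bochner_Integration.integrable_diff) (auto intro: bounded_measurable_integrable)
    have ER: "(\<integral>\<omega>. \<tau> (V j \<omega>) - ?t (V j \<omega>) \<partial>\<Omega>) = mean_flight - m c" for j
      using integrable_V[OF flight_integrable, of j] bounded_V[OF t, of j] expectation_V[OF flight_measurable, of j] expectation_V_bounded[OF t, of j]
      by (simp add: bounded_measurable_integrable mean_flight_def m_def)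
    have "(\<integral>\<omega>. \<bar>arrival k \<omega> / real k - mean_flight\<bar> \<partial>\<Omega>)
        \<le> (\<integral>\<omega>. \<bar>?S \<omega>\<bar> / real k + ?R \<omega> / real k + (mean_flight - m c) \<partial>\<Omega>)"
    proof (rule integral_mono)
      show "integrable \<Omega> (\<lambda>\<omega>. \<bar>arrival k \<omega> / real k - mean_flight\<bar>)"
        unfolding arrival_def using integrable_V[OF flight_integrable] by auto
      show "integrable \<Omega> (\<lambda>\<omega>. \<bar>?S \<omega>\<bar> / real k + ?R \<omega> / real k + (mean_flight - m c))"
        using iR bounded_measurable_integrable[OF S] by auto
      fix \<omega> assume \<omega>: "\<omega> \<in> space \<Omega>"
      have "mean_flight \<ge> m c"
        unfolding m_def mean_flight_def using t by (intro integral_mono integrable_nu flight_integrable) auto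
      moreover have "?R \<omega> \<ge> 0" by (intro sum_nonneg) auto
      moreover have "arrival k \<omega> = ?S \<omega> + ?R \<omega> + real k * m c"
        by (simp add: arrival_def sum_subtractf sum.distrib)
      then have "arrival k \<omega> / real k - mean_flight = ?S \<omega> / real k + ?R \<omega> / real k - (mean_flight - m c)"
        using k by (simp add: add_divide_distrib)
      ultimately show "\<bar>arrival k \<omega> / real k - mean_flight\<bar> \<le> \<bar>?S \<omega>\<bar> / real k + ?R \<omega> / real k + (mean_flight - m c)"
        using k by (simp add: abs_le_iff) (smt (verit) divide_nonneg_nonneg divide_right_mono of_nat_0_le_iff abs_ge_self abs_ge_minus_self minus_divide_left)
    qed
    also have "\<dots> = (\<integral>\<omega>. \<bar>?S \<omega>\<bar> \<partial>\<Omega>) / real k + (\<Sum>j<k. mean_flight - m c) / real k + (mean_flight - m c)"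
      using iR bounded_measurable_integrable[OF S] by (simp add: ER prob_space del: sum_constant)
    also have "\<dots> = (\<integral>\<omega>. \<bar>?S \<omega>\<bar> \<partial>\<Omega>) / real k + 2 * (mean_flight - m c)" using k by simp
    also have "(\<integral>\<omega>. \<bar>?S \<omega>\<bar> \<partial>\<Omega>) \<le> sqrt (\<integral>\<omega>. (?S \<omega>)\<^sup>2 \<partial>\<Omega>)"
      using S by (intro expectation_abs_le_sqrt bounded_measurable_integrable bounded_measurable_power)
        (auto dest: bounded_measurable_measurable)
    also have "\<dots> \<le> sqrt (C * (real k + 1))"
      using stopped_sum_square_le[OF stopping_index_const t0 Et0, of k] by (simp add: C_def mult_ac)
    finally have "(\<integral>\<omega>. \<bar>arrival k \<omega> / real k - mean_flight\<bar> \<partial>\<Omega>) \<le> sqrt (C * (real k + 1)) / real k + 2 * (mean_flight - m c)"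
      using k by (simp add: divide_right_mono)
    moreover have "x < e" if "x \<le> y + 2 * (u - w)" "y < e / 4" "u - e / 4 < w" for x y u w :: real
      using that e by argo
    ultimately show "(\<integral>\<omega>. \<bar>arrival k \<omega> / real k - mean_flight\<bar> \<partial>\<Omega>) < e"
      using k(1) c by blast
  qed
  then obtain K where "\<And>k. k \<ge> K \<Longrightarrow> (\<integral>\<omega>. \<bar>arrival k \<omega> / real k - mean_flight\<bar> \<partial>\<Omega>) < e"
    by (auto simp: eventually_sequentially)
  then show "\<exists>K. \<forall>k\<ge>K. norm ((\<integral>\<omega>. \<bar>arrival k \<omega> / real k - mean_flight\<bar> \<partial>\<Omega>) - 0) < e"
    by auto
qed

lemma arrival_mean_prob:
  assumes d: "d > 0"
  shows "(\<lambda>k. prob {\<omega> \<in> space \<Omega>. \<bar>arrival k \<omega> / real k - mean_flight\<bar> \<ge> d}) \<longlonglongrightarrow> 0"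
proof (rule tendsto_sandwich[OF _ _ tendsto_const])
  show "(\<lambda>k. (\<integral>\<omega>. \<bar>arrival k \<omega> / real k - mean_flight\<bar> \<partial>\<Omega>) / d) \<longlonglongrightarrow> 0"
    using tendsto_divide[OF arrival_mean_L1 tendsto_const, of d] d by simp
  have "prob {\<omega> \<in> space \<Omega>. \<bar>arrival k \<omega> / real k - mean_flight\<bar> \<ge> d} \<le> (\<integral>\<omega>. \<bar>arrival k \<omega> / real k - mean_flight\<bar> \<partial>\<Omega>) / d" for k
  proof (rule integral_Markov_inequality_measure[where A="{}"])
    show "integrable \<Omega> (\<lambda>\<omega>. \<bar>arrival k \<omega> / real k - mean_flight\<bar>)"
      unfolding arrival_def using integrable_V[OF flight_integrable] by auto
  qed (use d in auto)
  then show "eventually (\<lambda>k. prob {\<omega> \<in> space \<Omega>. \<bar>arrival k \<omega> / real k - mean_flight\<bar> \<ge> d}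
      \<le> (\<integral>\<omega>. \<bar>arrival k \<omega> / real k - mean_flight\<bar> \<partial>\<Omega>) / d) sequentially" by simp
qed simp

definition truncated_count :: "real \<Rightarrow> 'w \<Rightarrow> nat" where
  "truncated_count T = capped_count (cap T) T"

lemma stopping_index_truncated_count: "stopping_index (truncated_count T) (cap T)"
  unfolding truncated_count_def by (rule stopping_index_capped_count)

text \<open>At least \<open>k\<close> collisions by time \<open>T\<close> means that the first \<open>k\<close> flights take at most \<open>T\<close>, so a
  deviation of the count from \<open>T / mean_flight\<close> forces one of two averages of flight times away
  from their mean.\<close>

lemma truncated_count_deviation:
  assumes d: "d > 0" "d \<le> 1 / mean_flight"
  shows "((\<lambda>T. prob {\<omega> \<in> space \<Omega>. \<bar>real (truncated_count T \<omega>) / T - 1 / mean_flight\<bar> > d}) \<longlongrightarrow> 0) at_top"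
proof -
  let ?q = "\<lambda>e k. prob {\<omega> \<in> space \<Omega>. \<bar>arrival k \<omega> / real k - mean_flight\<bar> \<ge> e}"
  define e1 where "e1 = mean_flight - 1 / (1 / mean_flight + d)"
  define e2 where "e2 = 1 / (1 / mean_flight - d / 2) - mean_flight"
  define k1 where "k1 T = nat \<lceil>(1 / mean_flight + d) * T\<rceil>" for T
  define k2 where "k2 T = nat \<lfloor>(1 / mean_flight - d / 2) * T\<rfloor>" for T
  have m0: "1 / mean_flight > 0" using mean_flight_pos by simp
  have dpos: "1 / mean_flight + d > 0" "1 / mean_flight - d / 2 > 0" using m0 d by auto
  have "1 / (1 / mean_flight + d) < 1 / (1 / mean_flight)" using m0 d by (intro divide_strict_left_mono) auto
  then have e1: "e1 > 0" by (simp add: e1_def)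
  have "1 / (1 / mean_flight) < 1 / (1 / mean_flight - d / 2)"
    using m0 d dpos by (intro divide_strict_left_mono) auto
  then have e2: "e2 > 0" by (simp add: e2_def)
  have "filterlim (\<lambda>T. nat \<lceil>c * T\<rceil>) at_top at_top" "filterlim (\<lambda>T. nat \<lfloor>c * T\<rfloor>) at_top at_top"
    if "c > 0" for c :: real
    using that by real_asymp+
  then have f1: "filterlim k1 at_top at_top" and f2: "filterlim k2 at_top at_top"
    unfolding k1_def k2_def using dpos by blast+
  have lim: "((\<lambda>T. ?q e1 (k1 T) + ?q e2 (k2 T)) \<longlongrightarrow> 0 + 0) at_top"
    by (intro tendsto_add filterlim_compose[OF arrival_mean_prob[OF e1] f1]
        filterlim_compose[OF arrival_mean_prob[OF e2] f2])
  have ev: "eventually (\<lambda>T. prob {\<omega> \<in> space \<Omega>. \<bar>real (truncated_count T \<omega>) / T - 1 / mean_flight\<bar> > d}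
      \<le> ?q e1 (k1 T) + ?q e2 (k2 T)) at_top"
    using eventually_gt_at_top[of 0] eventually_ge_at_top[of "2 / d"]
      f2[THEN filterlim_at_top[THEN iffD1], rule_format, of 1]
  proof eventually_elim
    fix T :: real assume T: "T > 0" "2 / d \<le> T" and "1 \<le> k2 T"
    then have k2pos: "k2 T > 0" by simp
    let ?A = "{\<omega> \<in> space \<Omega>. \<bar>real (truncated_count T \<omega>) / T - 1 / mean_flight\<bar> > d}"
    let ?B = "\<lambda>e k. {\<omega> \<in> space \<Omega>. \<bar>arrival k \<omega> / real k - mean_flight\<bar> \<ge> e}"
    have "?A \<subseteq> ?B e1 (k1 T) \<union> ?B e2 (k2 T)"
    proof
      fix \<omega> assume "\<omega> \<in> ?A"
      then have \<omega>: "\<omega> \<in> space \<Omega>" and dev: "\<bar>real (truncated_count T \<omega>) / T - 1 / mean_flight\<bar> > d" by auto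
      let ?n = "truncated_count T \<omega>"
      show "\<omega> \<in> ?B e1 (k1 T) \<union> ?B e2 (k2 T)"
      proof (cases "real ?n / T > 1 / mean_flight + d")
        case True
        then have n: "real ?n > (1 / mean_flight + d) * T" using T by (simp add: pos_less_divide_eq)
        have k1: "(1 / mean_flight + d) * T \<le> real (k1 T)" unfolding k1_def by (rule real_nat_ceiling_ge)
        have "(1 / mean_flight + d) * T > 0" using dpos T by simp
        then have k1pos: "real (k1 T) > 0" using k1 by linarith
        have "k1 T \<le> ?n" unfolding k1_def using n by (simp add: nat_ceiling_le_eq)
        then have "k1 T - 1 < ?n" using k1pos by auto
        then have "arrival (k1 T) \<omega> \<le> T"
          using k1pos unfolding truncated_count_def less_capped_count_iff[OF \<omega>] by simp
        then have "arrival (k1 T) \<omega> / real (k1 T) \<le> T / ((1 / mean_flight + d) * T)"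
          using k1 k1pos T dpos by (intro frac_le) auto
        also have "\<dots> = 1 / (1 / mean_flight + d)" using T by simp
        finally have "arrival (k1 T) \<omega> / real (k1 T) - mean_flight \<le> - e1" by (simp add: e1_def)
        then show ?thesis using \<omega> by auto
      next
        case False
        then have "real ?n / T < 1 / mean_flight - d" using dev by linarith
        then have n: "real ?n < (1 / mean_flight - d) * T" using T by (simp add: pos_divide_less_eq)
        have "real (k2 T) \<le> (1 / mean_flight - d / 2) * T"
          unfolding k2_def using dpos T by (simp add: of_nat_floor)
        have "d * T \<ge> 2" using T d by (simp add: field_simps)
        then have "real ?n < (1 / mean_flight - d / 2) * T - 1" using n by (simp add: algebra_simps)
        also have "\<dots> < real (k2 T)" unfolding k2_def using dpos T by linarith
        finally have "?n < k2 T" by simp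
        moreover have "k2 T \<le> cap T"
        proof -
          have "(1 / mean_flight - d / 2) * T \<le> cap_rate * T"
            using T d decay_pos decay_less by (intro mult_right_mono) (auto simp: cap_rate_def add_increasing)
          then show ?thesis unfolding k2_def cap_def
            by (smt (verit, best) floor_mono le_SucI nat_mono floor_le_ceiling)
        qed
        ultimately have "arrival (k2 T) \<omega> > T"
          using less_capped_count_iff[OF \<omega>, of "k2 T - 1" "cap T" T] k2pos
          unfolding truncated_count_def by (auto simp: not_less)
        then have "arrival (k2 T) \<omega> / real (k2 T) \<ge> T / ((1 / mean_flight - d / 2) * T)"
          using \<open>real (k2 T) \<le> (1 / mean_flight - d / 2) * T\<close> k2pos T by (intro frac_le) auto
        also have "T / ((1 / mean_flight - d / 2) * T) = 1 / (1 / mean_flight - d / 2)" using T by simp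
        finally have "arrival (k2 T) \<omega> / real (k2 T) - mean_flight \<ge> e2" by (simp add: e2_def)
        then show ?thesis using \<omega> by auto
      qed
    qed
    then have "prob ?A \<le> prob (?B e1 (k1 T) \<union> ?B e2 (k2 T))"
      by (intro finite_measure_mono) auto
    also have "\<dots> \<le> prob (?B e1 (k1 T)) + prob (?B e2 (k2 T))"
      by (intro measure_subadditive) (auto simp: emeasure_eq_measure)
    finally show "prob ?A \<le> ?q e1 (k1 T) + ?q e2 (k2 T)" .
  qed
  show ?thesis
    by (rule tendsto_sandwich[OF _ ev tendsto_const]) (use lim in auto)
qed

lemma truncated_count_measurable[measurable]: "(\<lambda>\<omega>. real (truncated_count T \<omega>)) \<in> borel_measurable \<Omega>"
  using stopping_real_bounded_measurable[OF stopping_index_truncated_count] by (rule bounded_measurable_measurable)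

text \<open>The cap bounds the count by a multiple of \<open>T\<close>, which upgrades convergence in probability to
  mean square.\<close>

lemma truncated_count_L2:
  "((\<lambda>T. \<integral>\<omega>. (real (truncated_count T \<omega>) / T - 1 / mean_flight)\<^sup>2 \<partial>\<Omega>) \<longlongrightarrow> 0) at_top"
proof (rule order_tendstoI)
  fix e :: real assume "0 < e"
  define d where "d = min (1 / mean_flight) (sqrt (e / 2))"
  define W where "W = cap_rate + 2 + 1 / mean_flight"
  have d: "d > 0" "d \<le> 1 / mean_flight" using mean_flight_pos \<open>0 < e\<close> by (auto simp: d_def)
  have "d\<^sup>2 \<le> (sqrt (e / 2))\<^sup>2" using d by (intro power_mono) (auto simp: d_def)
  then have d2: "d\<^sup>2 \<le> e / 2" using \<open>0 < e\<close> by simp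
  let ?A = "\<lambda>T. {\<omega> \<in> space \<Omega>. \<bar>real (truncated_count T \<omega>) / T - 1 / mean_flight\<bar> > d}"
  have "((\<lambda>T. W\<^sup>2 * prob (?A T)) \<longlongrightarrow> W\<^sup>2 * 0) at_top"
    by (intro tendsto_mult tendsto_const truncated_count_deviation d)
  then have "eventually (\<lambda>T. W\<^sup>2 * prob (?A T) < e / 2) at_top"
    using \<open>0 < e\<close> by (intro order_tendstoD(2)) auto
  then show "eventually (\<lambda>T. (\<integral>\<omega>. (real (truncated_count T \<omega>) / T - 1 / mean_flight)\<^sup>2 \<partial>\<Omega>) < e) at_top"
    using eventually_ge_at_top[of 1]
  proof eventually_elim
    fix T :: real assume T: "W\<^sup>2 * prob (?A T) < e / 2" "1 \<le> T"
    have bm: "(\<lambda>\<omega>. real (truncated_count T \<omega>) / T - 1 / mean_flight) \<in> bounded_measurable \<Omega>"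
      by (intro bounded_measurable_diff bounded_measurable_divide bounded_measurable_const
          stopping_real_bounded_measurable[OF stopping_index_truncated_count])
    have "(\<integral>\<omega>. (real (truncated_count T \<omega>) / T - 1 / mean_flight)\<^sup>2 \<partial>\<Omega>) \<le> (\<integral>\<omega>. d\<^sup>2 + W\<^sup>2 * indicator (?A T) \<omega> \<partial>\<Omega>)"
    proof (rule integral_mono)
      show "integrable \<Omega> (\<lambda>\<omega>. (real (truncated_count T \<omega>) / T - 1 / mean_flight)\<^sup>2)"
        using bm by (intro bounded_measurable_integrable bounded_measurable_power)
      show "integrable \<Omega> (\<lambda>\<omega>. d\<^sup>2 + W\<^sup>2 * indicator (?A T) \<omega>)"
        by (intro bounded_measurable_integrable bounded_measurable_intros) measurable
      fix \<omega> assume \<omega>: "\<omega> \<in> space \<Omega>"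
      let ?x = "real (truncated_count T \<omega>) / T - 1 / mean_flight"
      have "real (truncated_count T \<omega>) \<le> real (cap T)"
        using stopping_index_le[OF stopping_index_truncated_count \<omega>] by simp
      also have "\<dots> \<le> cap_rate * T + 2 * T" using cap_bound[of T] T by simp
      also have "\<dots> = (cap_rate + 2) * T" by (simp add: algebra_simps)
      finally have "real (truncated_count T \<omega>) / T \<le> cap_rate + 2" using T by (simp add: pos_divide_le_eq)
      moreover have "real (truncated_count T \<omega>) / T \<ge> 0" "1 / mean_flight > 0" using T mean_flight_pos by auto
      ultimately have "\<bar>?x\<bar> \<le> W" unfolding W_def using cap_rate_pos by linarith
      then have "?x\<^sup>2 \<le> W\<^sup>2" using power_mono[of "\<bar>?x\<bar>" W 2] by simp
      moreover have "?x\<^sup>2 \<le> d\<^sup>2" if "\<bar>?x\<bar> \<le> d" using power_mono[OF that, of 2] by simp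
      moreover have "0 \<le> d\<^sup>2" by simp
      ultimately show "?x\<^sup>2 \<le> d\<^sup>2 + W\<^sup>2 * indicator (?A T) \<omega>"
        using \<omega> by (cases "\<bar>?x\<bar> \<le> d") (auto simp: indicator_def not_le add_increasing)
    qed
    also have "\<dots> = d\<^sup>2 + W\<^sup>2 * prob (?A T)"
      by (subst Bochner_Integration.integral_add) (auto simp: prob_space intro!: integrable_real_indicator simp: less_top[symmetric])
    also have "\<dots> < e" using T d2 by linarith
    finally show "(\<integral>\<omega>. (real (truncated_count T \<omega>) / T - 1 / mean_flight)\<^sup>2 \<partial>\<Omega>) < e" .
  qed
next
  fix e :: real assume "e < 0"
  then show "eventually (\<lambda>T. e < (\<integral>\<omega>. (real (truncated_count T \<omega>) / T - 1 / mean_flight)\<^sup>2 \<partial>\<Omega>)) at_top"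
    by (intro always_eventually allI) (auto intro: less_le_trans)
qed

end


section \<open>The martingale at a random and at a fixed time\<close>

context gapped_chain
begin

lemma cond_var_centered_square:
  assumes g: "g \<in> bounded_measurable S" and G: "\<And>v. v \<in> space S \<Longrightarrow> \<bar>g v\<bar> \<le> G"
  shows "(\<integral>v. (cond_var g v - (\<integral>v. cond_var g v \<partial>\<nu>))\<^sup>2 \<partial>\<nu>) \<le> G\<^sup>2 * (\<integral>v. cond_var g v \<partial>\<nu>)"
proof -
  note cv = cond_var_bounded_measurable[OF g]
  have "(\<integral>v. (cond_var g v - (\<integral>v. cond_var g v \<partial>\<nu>))\<^sup>2 \<partial>\<nu>) \<le> (\<integral>v. (cond_var g v)\<^sup>2 \<partial>\<nu>)"
    by (rule integral_centered_square_le[OF cv])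
  also have "\<dots> \<le> (\<integral>v. G\<^sup>2 * cond_var g v \<partial>\<nu>)"
  proof (rule integral_mono)
    fix v assume "v \<in> space \<nu>"
    then have v: "v \<in> space S" by simp
    then show "(cond_var g v)\<^sup>2 \<le> G\<^sup>2 * cond_var g v"
      using cond_var_le[OF g G v] cond_var_nonneg[OF g v]
      by (auto simp: power2_eq_square intro: mult_right_mono)
  qed (intro integrable_nu bounded_measurable_intros cv)+
  also have "\<dots> = G\<^sup>2 * (\<integral>v. cond_var g v \<partial>\<nu>)" by simp
  finally show ?thesis .
qed

lemma expectation_martingale_square:
  assumes g: "g \<in> bounded_measurable S"
  shows "(\<integral>\<omega>. (\<Sum>j<k. increment g j \<omega>)\<^sup>2 \<partial>\<Omega>) = real k * (\<integral>v. cond_var g v \<partial>\<nu>)"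
  using martingale_transform_square[of "\<lambda>_ _. 1", OF bounded_measurable_const g, of k]
  by (simp add: expectation_V_bounded[OF cond_var_bounded_measurable[OF g]])

lemma expectation_martingale:
  assumes g: "g \<in> bounded_measurable S"
  shows "(\<integral>\<omega>. (\<Sum>j<k. increment g j \<omega>) \<partial>\<Omega>) = 0"
proof -
  have "(\<integral>\<omega>. increment g j \<omega> \<partial>\<Omega>) = 0" for j
    using increment_orthogonal[OF bounded_measurable_const[of 1] g, of j] by simp
  then show ?thesis
    by (subst Bochner_Integration.integral_sum) (auto intro: bounded_measurable_integrable increment_bounded[OF g])
qed

lemma martingale_bounded: "g \<in> bounded_measurable S \<Longrightarrow> (\<lambda>\<omega>. \<Sum>j<k. increment g j \<omega>) \<in> bounded_measurable \<Omega>"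
  by (intro bounded_measurable_sum increment_bounded)

text \<open>The difference between the martingale at the random time \<open>n\<close> and at the fixed time \<open>m\<close> is
  again a martingale transform. Its second moment is the conditional variance accumulated between
  the two times, and this is close to \<open>\<sigma>\<^sup>2 \<bar>n - m\<bar>\<close> by \<open>stopped_sum_square_le\<close> applied to the
  conditional variance.\<close>

lemma stopped_martingale_difference:
  assumes n: "stopping_index n L" and m: "m \<le> L"
    and g: "g \<in> bounded_measurable S" and G: "\<And>v. v \<in> space S \<Longrightarrow> \<bar>g v\<bar> \<le> G"
  defines "\<sigma>2 \<equiv> \<integral>v. cond_var g v \<partial>\<nu>"
  shows "(\<integral>\<omega>. ((\<Sum>j<n \<omega>. increment g j \<omega>) - (\<Sum>j<m. increment g j \<omega>))\<^sup>2 \<partial>\<Omega>)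
    \<le> \<sigma>2 * (\<integral>\<omega>. \<bar>real (n \<omega>) - real m\<bar> \<partial>\<Omega>) + 2 * sqrt (gap_const * (real L + 1) * (G\<^sup>2 * \<sigma>2))"
proof -
  note cv = cond_var_bounded_measurable[OF g]
  let ?q = "\<lambda>v. cond_var g v - \<sigma>2"
  have q: "?q \<in> bounded_measurable S" by (intro bounded_measurable_intros cv)
  have q0: "(\<integral>v. ?q v \<partial>\<nu>) = 0" using cv nu.prob_space by (simp add: integrable_nu \<sigma>2_def)
  have q2: "(\<integral>v. (?q v)\<^sup>2 \<partial>\<nu>) \<le> G\<^sup>2 * \<sigma>2"
    unfolding \<sigma>2_def by (rule cond_var_centered_square[OF g G])
  have s0: "\<sigma>2 \<ge> 0"
    unfolding \<sigma>2_def by (intro integral_nonneg_AE AE_I2) (auto intro: cond_var_nonneg[OF g])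
  have fluct: "(\<integral>\<omega>. \<bar>\<Sum>j<k \<omega>. ?q (V j \<omega>)\<bar> \<partial>\<Omega>) \<le> sqrt (gap_const * (real L + 1) * (G\<^sup>2 * \<sigma>2))"
    if k: "stopping_index k l" and l: "l \<le> L" for k l
  proof -
    have S: "(\<lambda>\<omega>. \<Sum>j<k \<omega>. ?q (V j \<omega>)) \<in> bounded_measurable \<Omega>"
      by (rule stopped_sum_V_bounded_measurable[OF k q])
    have "(\<integral>\<omega>. \<bar>\<Sum>j<k \<omega>. ?q (V j \<omega>)\<bar> \<partial>\<Omega>) \<le> sqrt (\<integral>\<omega>. (\<Sum>j<k \<omega>. ?q (V j \<omega>))\<^sup>2 \<partial>\<Omega>)"
      using S by (intro expectation_abs_le_sqrt bounded_measurable_integrable bounded_measurable_power)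
        (auto dest: bounded_measurable_measurable)
    also have "(\<integral>\<omega>. (\<Sum>j<k \<omega>. ?q (V j \<omega>))\<^sup>2 \<partial>\<Omega>) \<le> gap_const * (real l + 1) * (\<integral>v. (?q v)\<^sup>2 \<partial>\<nu>)"
      by (rule stopped_sum_square_le[OF k q q0])
    also have "\<dots> \<le> gap_const * (real L + 1) * (G\<^sup>2 * \<sigma>2)"
      using q2 gap_const_pos l s0 by (intro mult_mono mult_left_mono) auto
    finally show ?thesis by simp
  qed
  define c where "c j \<omega> = (of_bool (j < n \<omega>) - of_bool (j < m) :: real)" for j \<omega>
  have c: "c j \<in> bounded_measurable (H j)" for j
    unfolding c_def[abs_def] by (intro bounded_measurable_diff bounded_measurable_const stopping_coefficient[OF n])
  have S: "(\<lambda>\<omega>. \<Sum>j<k \<omega>. ?q (V j \<omega>)) \<in> bounded_measurable \<Omega>" if "stopping_index k l" for k l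
    by (rule stopped_sum_V_bounded_measurable[OF that q])
  have "(\<integral>\<omega>. ((\<Sum>j<n \<omega>. increment g j \<omega>) - (\<Sum>j<m. increment g j \<omega>))\<^sup>2 \<partial>\<Omega>)
      = (\<integral>\<omega>. (\<Sum>j<L. c j \<omega> * increment g j \<omega>)\<^sup>2 \<partial>\<Omega>)"
  proof (intro Bochner_Integration.integral_cong refl arg_cong[where f="\<lambda>x. x\<^sup>2"])
    fix \<omega> assume "\<omega> \<in> space \<Omega>"
    then have nL: "n \<omega> \<le> L" using n by (intro stopping_index_le)
    show "(\<Sum>j<n \<omega>. increment g j \<omega>) - (\<Sum>j<m. increment g j \<omega>) = (\<Sum>j<L. c j \<omega> * increment g j \<omega>)"
      unfolding sum_stopped[OF nL] sum_stopped[OF m] c_def left_diff_distrib sum_subtractf ..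
  qed
  also have "\<dots> = (\<Sum>j<L. \<integral>\<omega>. (c j \<omega>)\<^sup>2 * cond_var g (V j \<omega>) \<partial>\<Omega>)"
    by (rule martingale_transform_square[OF c g])
  also have "\<dots> = (\<integral>\<omega>. (\<Sum>j<L. (c j \<omega>)\<^sup>2 * cond_var g (V j \<omega>)) \<partial>\<Omega>)"
    by (intro Bochner_Integration.integral_sum[symmetric] bounded_measurable_integrable bounded_measurable_mult
        bounded_measurable_power bounded_history[OF c] bounded_V[OF cv])
  also have "\<dots> \<le> (\<integral>\<omega>. \<sigma>2 * \<bar>real (n \<omega>) - real m\<bar> + \<bar>\<Sum>j<n \<omega>. ?q (V j \<omega>)\<bar> + \<bar>\<Sum>j<m. ?q (V j \<omega>)\<bar> \<partial>\<Omega>)"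
  proof (rule integral_mono)
    show "integrable \<Omega> (\<lambda>\<omega>. \<Sum>j<L. (c j \<omega>)\<^sup>2 * cond_var g (V j \<omega>))"
      by (intro bounded_measurable_integrable bounded_measurable_sum bounded_measurable_mult
        bounded_measurable_power bounded_history[OF c] bounded_V[OF cv])
    show "integrable \<Omega> (\<lambda>\<omega>. \<sigma>2 * \<bar>real (n \<omega>) - real m\<bar> + \<bar>\<Sum>j<n \<omega>. ?q (V j \<omega>)\<bar> + \<bar>\<Sum>j<m. ?q (V j \<omega>)\<bar>)"
      by (intro bounded_measurable_integrable bounded_measurable_add bounded_measurable_mult bounded_measurable_abs
          bounded_measurable_diff bounded_measurable_const S[OF n] S[OF stopping_index_const]
          stopping_real_bounded_measurable[OF n])
    fix \<omega> assume \<omega>: "\<omega> \<in> space \<Omega>"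
    let ?x = "\<lambda>j. cond_var g (V j \<omega>)"
    have nL: "n \<omega> \<le> L" using n \<omega> by (rule stopping_index_le)
    have "(\<Sum>j<L. (c j \<omega>)\<^sup>2 * ?x j) \<le> \<bar>(\<Sum>j<n \<omega>. ?x j) - (\<Sum>j<m. ?x j)\<bar>"
    proof (cases "m \<le> n \<omega>")
      case True
      then have "(c j \<omega>)\<^sup>2 = c j \<omega>" for j by (auto simp: c_def)
      then have "(\<Sum>j<L. (c j \<omega>)\<^sup>2 * ?x j) = (\<Sum>j<n \<omega>. ?x j) - (\<Sum>j<m. ?x j)"
        by (simp add: sum_stopped[OF nL] sum_stopped[OF m] c_def left_diff_distrib sum_subtractf)
      then show ?thesis by linarith
    next
      case False
      then have "(c j \<omega>)\<^sup>2 = - c j \<omega>" for j by (auto simp: c_def)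
      then have "(\<Sum>j<L. (c j \<omega>)\<^sup>2 * ?x j) = (\<Sum>j<m. ?x j) - (\<Sum>j<n \<omega>. ?x j)"
        by (simp add: sum_stopped[OF nL] sum_stopped[OF m] c_def left_diff_distrib sum_subtractf)
      then show ?thesis by linarith
    qed
    moreover have "(\<Sum>j<n \<omega>. ?x j) = \<sigma>2 * real (n \<omega>) + (\<Sum>j<n \<omega>. ?q (V j \<omega>))"
      "(\<Sum>j<m. ?x j) = \<sigma>2 * real m + (\<Sum>j<m. ?q (V j \<omega>))"
      by (simp_all add: sum_subtractf)
    moreover have "\<bar>\<sigma>2 * real (n \<omega>) - \<sigma>2 * real m\<bar> = \<sigma>2 * \<bar>real (n \<omega>) - real m\<bar>"
      using s0 by (simp add: abs_mult flip: right_diff_distrib)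
    ultimately show "(\<Sum>j<L. (c j \<omega>)\<^sup>2 * ?x j) \<le> \<sigma>2 * \<bar>real (n \<omega>) - real m\<bar> + \<bar>\<Sum>j<n \<omega>. ?q (V j \<omega>)\<bar> + \<bar>\<Sum>j<m. ?q (V j \<omega>)\<bar>"
      by linarith
  qed
  also have "\<dots> = \<sigma>2 * (\<integral>\<omega>. \<bar>real (n \<omega>) - real m\<bar> \<partial>\<Omega>) + (\<integral>\<omega>. \<bar>\<Sum>j<n \<omega>. ?q (V j \<omega>)\<bar> \<partial>\<Omega>) + (\<integral>\<omega>. \<bar>\<Sum>j<m. ?q (V j \<omega>)\<bar> \<partial>\<Omega>)"
  proof -
    have i: "integrable \<Omega> (\<lambda>\<omega>. \<bar>real (n \<omega>) - real m\<bar>)"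
      by (intro bounded_measurable_integrable bounded_measurable_abs bounded_measurable_diff bounded_measurable_const
          stopping_real_bounded_measurable[OF n])
    have j: "integrable \<Omega> (\<lambda>\<omega>. \<bar>\<Sum>j<n \<omega>. ?q (V j \<omega>)\<bar>)" "integrable \<Omega> (\<lambda>\<omega>. \<bar>\<Sum>j<m. ?q (V j \<omega>)\<bar>)"
      by (intro bounded_measurable_integrable bounded_measurable_abs S[OF n] S[OF stopping_index_const])+
    show ?thesis
      by (subst Bochner_Integration.integral_add, (intro Bochner_Integration.integrable_add integrable_mult_right i j)+)
         (subst Bochner_Integration.integral_add, (intro integrable_mult_right i j)+, simp)
  qed
  also have "\<dots> \<le> \<sigma>2 * (\<integral>\<omega>. \<bar>real (n \<omega>) - real m\<bar> \<partial>\<Omega>) + 2 * sqrt (gap_const * (real L + 1) * (G\<^sup>2 * \<sigma>2))"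
    using fluct[OF n order_refl] fluct[OF stopping_index_const m] by simp
  finally show ?thesis .
qed

text \<open>The three contributions are the change of time for the martingale, the boundary terms of the
  corrector, and the remainder of the Neumann series.\<close>

lemma stopped_sum_approximation:
  fixes K :: nat
  assumes n: "stopping_index n L" and m: "m \<le> L"
    and f: "f \<in> bounded_measurable S" and f0: "(\<integral>v. f v \<partial>\<nu>) = 0"
    and B: "\<And>v. v \<in> space S \<Longrightarrow> \<bar>f v\<bar> \<le> B"
  defines "g \<equiv> poisson f K"
  defines "\<sigma>2 \<equiv> \<integral>v. cond_var g v \<partial>\<nu>"
  shows "(\<integral>\<omega>. ((\<Sum>j<n \<omega>. f (V j \<omega>)) - (\<Sum>j<m. increment g j \<omega>))\<^sup>2 \<partial>\<Omega>)
    \<le> 3 * (\<sigma>2 * (\<integral>\<omega>. \<bar>real (n \<omega>) - real m\<bar> \<partial>\<Omega>) + 2 * sqrt (gap_const * (real L + 1) * ((real K * B)\<^sup>2 * \<sigma>2)))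
      + 12 * (real K * B)\<^sup>2 + 3 * (gap_const * (real L + 1) * ((\<rho> ^ K)\<^sup>2 * (\<integral>v. (f v)\<^sup>2 \<partial>\<nu>)))"
proof -
  let ?R = "(P ^^ K) f"
  have g: "g \<in> bounded_measurable S" unfolding g_def by (rule poisson_bounded_measurable[OF f])
  have G: "\<bar>g v\<bar> \<le> real K * B" if "v \<in> space S" for v
    unfolding g_def by (rule poisson_bound[OF f B that])
  have R: "?R \<in> bounded_measurable S" by (rule iter_bounded_measurable[OF f])
  have R0: "(\<integral>v. ?R v \<partial>\<nu>) = 0" using f0 by (simp add: integral_iter[OF f])
  let ?A = "\<lambda>\<omega>. (\<Sum>j<n \<omega>. increment g j \<omega>) - (\<Sum>j<m. increment g j \<omega>)"
  let ?C = "\<lambda>\<omega>. \<Sum>j<n \<omega>. ?R (V j \<omega>)"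
  have A: "?A \<in> bounded_measurable \<Omega>"
    by (intro bounded_measurable_diff stopped_sum_bounded_measurable[OF n] martingale_bounded increment_bounded g)
  have C: "?C \<in> bounded_measurable \<Omega>" by (rule stopped_sum_V_bounded_measurable[OF n R])
  have F: "(\<lambda>\<omega>. (\<Sum>j<n \<omega>. f (V j \<omega>)) - (\<Sum>j<m. increment g j \<omega>)) \<in> bounded_measurable \<Omega>"
    by (intro bounded_measurable_diff stopped_sum_V_bounded_measurable[OF n] martingale_bounded f g)
  have "(\<integral>\<omega>. ((\<Sum>j<n \<omega>. f (V j \<omega>)) - (\<Sum>j<m. increment g j \<omega>))\<^sup>2 \<partial>\<Omega>)
      \<le> (\<integral>\<omega>. 3 * (?A \<omega>)\<^sup>2 + 12 * (real K * B)\<^sup>2 + 3 * (?C \<omega>)\<^sup>2 \<partial>\<Omega>)"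
  proof (rule integral_mono)
    show "integrable \<Omega> (\<lambda>\<omega>. ((\<Sum>j<n \<omega>. f (V j \<omega>)) - (\<Sum>j<m. increment g j \<omega>))\<^sup>2)"
      by (intro bounded_measurable_integrable bounded_measurable_power F)
    show "integrable \<Omega> (\<lambda>\<omega>. 3 * (?A \<omega>)\<^sup>2 + 12 * (real K * B)\<^sup>2 + 3 * (?C \<omega>)\<^sup>2)"
      by (intro bounded_measurable_integrable bounded_measurable_add bounded_measurable_mult bounded_measurable_power
          bounded_measurable_const A C)
    fix \<omega> assume \<omega>: "\<omega> \<in> space \<Omega>"
    let ?b = "g (V 0 \<omega>) - g (V (n \<omega>) \<omega>)"
    have "(\<Sum>j<n \<omega>. f (V j \<omega>)) - (\<Sum>j<m. increment g j \<omega>) = ?A \<omega> + ?b + ?C \<omega>"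
      unfolding poisson_decomposition[OF f \<omega>, of "n \<omega>" K] g_def by simp
    then have "((\<Sum>j<n \<omega>. f (V j \<omega>)) - (\<Sum>j<m. increment g j \<omega>))\<^sup>2 \<le> 3 * (?A \<omega>)\<^sup>2 + 3 * ?b\<^sup>2 + 3 * (?C \<omega>)\<^sup>2"
      using power2_sum3_le by metis
    moreover have "\<bar>?b\<bar> \<le> 2 * (real K * B)"
      using G[OF measurable_space[OF V_measurable \<omega>], of 0] G[OF measurable_space[OF V_measurable \<omega>], of "n \<omega>"] by linarith
    then have "?b\<^sup>2 \<le> 4 * (real K * B)\<^sup>2"
      using power_mono[of "\<bar>?b\<bar>" "2 * (real K * B)" 2] by (simp add: power_mult_distrib)
    ultimately show "((\<Sum>j<n \<omega>. f (V j \<omega>)) - (\<Sum>j<m. increment g j \<omega>))\<^sup>2 \<le> 3 * (?A \<omega>)\<^sup>2 + 12 * (real K * B)\<^sup>2 + 3 * (?C \<omega>)\<^sup>2"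
      by linarith
  qed
  also have "\<dots> = 3 * (\<integral>\<omega>. (?A \<omega>)\<^sup>2 \<partial>\<Omega>) + 12 * (real K * B)\<^sup>2 + 3 * (\<integral>\<omega>. (?C \<omega>)\<^sup>2 \<partial>\<Omega>)"
  proof -
    have i: "integrable \<Omega> (\<lambda>\<omega>. (?A \<omega>)\<^sup>2)" "integrable \<Omega> (\<lambda>\<omega>. (?C \<omega>)\<^sup>2)"
      by (intro bounded_measurable_integrable bounded_measurable_power A C)+
    show ?thesis using i by (simp add: prob_space)
  qed
  also have "(\<integral>\<omega>. (?A \<omega>)\<^sup>2 \<partial>\<Omega>) \<le> \<sigma>2 * (\<integral>\<omega>. \<bar>real (n \<omega>) - real m\<bar> \<partial>\<Omega>)
      + 2 * sqrt (gap_const * (real L + 1) * ((real K * B)\<^sup>2 * \<sigma>2))"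
    unfolding \<sigma>2_def by (rule stopped_martingale_difference[OF n m g G])
  also have "(\<integral>\<omega>. (?C \<omega>)\<^sup>2 \<partial>\<Omega>) \<le> gap_const * (real L + 1) * (\<integral>v. (?R v)\<^sup>2 \<partial>\<nu>)"
    by (rule stopped_sum_square_le[OF n R R0])
  also have "\<dots> \<le> gap_const * (real L + 1) * ((\<rho> ^ K)\<^sup>2 * (\<integral>v. (f v)\<^sup>2 \<partial>\<nu>))"
    using gap_const_pos by (intro mult_left_mono iter_decay f f0) auto
  finally show ?thesis by simp
qed


section \<open>Characteristic functions of the martingale\<close>

text \<open>Identities that hold against all real functions of the past extend to complex ones by taking
  real and imaginary parts.\<close>

lemma complex_test_function:
  fixes Y :: "'w \<Rightarrow> complex"
  assumes eq: "\<And>F. F \<in> bounded_measurable (H k) \<Longrightarrow> (\<integral>\<omega>. F \<omega> * A \<omega> \<partial>\<Omega>) = (\<integral>\<omega>. F \<omega> * B \<omega> \<partial>\<Omega>)"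
    and A: "A \<in> bounded_measurable \<Omega>" and B: "B \<in> bounded_measurable \<Omega>"
    and Y: "Y \<in> borel_measurable (H k)" "\<And>\<omega>. cmod (Y \<omega>) \<le> 1"
  shows "(\<integral>\<omega>. Y \<omega> * of_real (A \<omega>) \<partial>\<Omega>) = (\<integral>\<omega>. Y \<omega> * of_real (B \<omega>) \<partial>\<Omega>)"
proof -
  have R: "(\<lambda>\<omega>. Re (Y \<omega>)) \<in> bounded_measurable (H k)" and I: "(\<lambda>\<omega>. Im (Y \<omega>)) \<in> bounded_measurable (H k)"
    using Y(1) order_trans[OF abs_Re_le_cmod Y(2)] order_trans[OF abs_Im_le_cmod Y(2)]
    by (auto intro!: bounded_measurableI[where B=1])
  have [measurable]: "Y \<in> borel_measurable \<Omega>" using Y(1) by (rule history_measurable)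
  have int: "integrable \<Omega> (\<lambda>\<omega>. Y \<omega> * of_real (C \<omega>))" if C: "C \<in> bounded_measurable \<Omega>" for C
  proof -
    have "integrable \<Omega> C" using C by (rule bounded_measurable_integrable)
    moreover have [measurable]: "C \<in> borel_measurable \<Omega>" using C by (rule bounded_measurable_measurable)
    have "(\<lambda>\<omega>. Y \<omega> * of_real (C \<omega>)) \<in> borel_measurable \<Omega>" by measurable
    moreover have "AE \<omega> in \<Omega>. norm (Y \<omega> * of_real (C \<omega>)) \<le> norm (C \<omega>)"
      by (intro AE_I2) (simp add: norm_mult mult_left_le_one_le Y(2))
    ultimately show ?thesis by (rule Bochner_Integration.integrable_bound)
  qed
  show ?thesis
  proof (rule complex_eqI)
    show "Re (\<integral>\<omega>. Y \<omega> * of_real (A \<omega>) \<partial>\<Omega>) = Re (\<integral>\<omega>. Y \<omega> * of_real (B \<omega>) \<partial>\<Omega>)"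
      unfolding integral_Re[OF int[OF A], symmetric] integral_Re[OF int[OF B], symmetric]
      using eq[OF R] by simp
    show "Im (\<integral>\<omega>. Y \<omega> * of_real (A \<omega>) \<partial>\<Omega>) = Im (\<integral>\<omega>. Y \<omega> * of_real (B \<omega>) \<partial>\<Omega>)"
      unfolding integral_Im[OF int[OF A], symmetric] integral_Im[OF int[OF B], symmetric]
      using eq[OF I] by simp
  qed
qed

definition mart_exp :: "('a \<Rightarrow> real) \<Rightarrow> real \<Rightarrow> nat \<Rightarrow> 'w \<Rightarrow> complex" where
  "mart_exp g s k \<omega> = iexp (s * (\<Sum>j<k. increment g j \<omega>))"

lemma norm_mart_exp[simp]: "cmod (mart_exp g s k \<omega>) = 1"
  by (simp add: mart_exp_def)

lemma mart_exp_history: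
  "g \<in> bounded_measurable S \<Longrightarrow> mart_exp g s k \<in> borel_measurable (H k)"
proof -
  assume g: "g \<in> bounded_measurable S"
  have "(\<lambda>\<omega>. s * (\<Sum>j<k. increment g j \<omega>)) \<in> borel_measurable (H k)"
    by (intro borel_measurable_times borel_measurable_const borel_measurable_sum bounded_measurable_measurable
        increment_history g) auto
  moreover have "(\<lambda>x. iexp x) \<in> borel_measurable borel" by measurable
  ultimately have "(\<lambda>\<omega>. iexp (s * (\<Sum>j<k. increment g j \<omega>))) \<in> borel_measurable (H k)"
    by (rule measurable_compose)
  then show ?thesis by (simp add: mart_exp_def[abs_def])
qed

lemma mart_exp_Suc: "mart_exp g s (Suc k) \<omega> = mart_exp g s k \<omega> * iexp (s * increment g k \<omega>)"
  by (simp add: mart_exp_def distrib_left exp_add[symmetric])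

lemma integrable_mart_exp_mult:
  assumes g: "g \<in> bounded_measurable S" and A: "A \<in> bounded_measurable \<Omega>"
  shows "integrable \<Omega> (\<lambda>\<omega>. mart_exp g s k \<omega> * complex_of_real (A \<omega>))"
proof (rule Bochner_Integration.integrable_bound[of \<Omega> A])
  show "integrable \<Omega> A" using A by (rule bounded_measurable_integrable)
  have [measurable]: "A \<in> borel_measurable \<Omega>" using A by (rule bounded_measurable_measurable)
  have [measurable]: "mart_exp g s k \<in> borel_measurable \<Omega>" by (rule history_measurable[OF mart_exp_history[OF g]])
  show "(\<lambda>\<omega>. mart_exp g s k \<omega> * complex_of_real (A \<omega>)) \<in> borel_measurable \<Omega>" by measurable
qed (simp add: norm_mult)

lemma expectation_increment_square:
  assumes g: "g \<in> bounded_measurable S"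
  shows "(\<integral>\<omega>. (increment g k \<omega>)\<^sup>2 \<partial>\<Omega>) = (\<integral>v. cond_var g v \<partial>\<nu>)"
  using increment_square[OF bounded_measurable_const[of 1] g, of k]
  by (simp add: expectation_V_bounded[OF cond_var_bounded_measurable[OF g]])

text \<open>Peeling off one increment at a time and averaging \<open>q\<close> once for each gains a factor \<open>\<rho>\<close>
  at every step, and the last term is the mean of \<open>q\<close>, which vanishes.\<close>

lemma mart_exp_decorrelation:
  assumes g: "g \<in> bounded_measurable S"
    and q: "q \<in> bounded_measurable S" and q0: "(\<integral>v. q v \<partial>\<nu>) = 0"
  defines "\<sigma>2 \<equiv> \<integral>v. cond_var g v \<partial>\<nu>"
  shows "cmod (\<integral>\<omega>. mart_exp g s k \<omega> * of_real (q (V k \<omega>)) \<partial>\<Omega>)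
    \<le> \<bar>s\<bar> * sqrt \<sigma>2 * sqrt (\<integral>v. (q v)\<^sup>2 \<partial>\<nu>) / (1 - \<rho>)"
  using q q0
proof (induction k arbitrary: q)
  case 0
  have "(\<integral>\<omega>. mart_exp g s 0 \<omega> * of_real (q (V 0 \<omega>)) \<partial>\<Omega>) = of_real (\<integral>\<omega>. q (V 0 \<omega>) \<partial>\<Omega>)"
    by (simp add: mart_exp_def)
  also have "(\<integral>\<omega>. q (V 0 \<omega>) \<partial>\<Omega>) = 0" using expectation_V_bounded[OF 0(1)] 0(2) by simp
  finally have "(\<integral>\<omega>. mart_exp g s 0 \<omega> * of_real (q (V 0 \<omega>)) \<partial>\<Omega>) = 0" by simp
  moreover have "\<sigma>2 \<ge> 0"
    unfolding \<sigma>2_def by (intro integral_nonneg_AE AE_I2) (auto intro: cond_var_nonneg[OF g])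
  ultimately show ?case using rho_less by simp
next
  case (Suc k)
  note q = Suc.prems(1) and q0 = Suc.prems(2)
  let ?Y = "mart_exp g s"
  let ?D = "increment g k"
  have Pq: "P q \<in> bounded_measurable S" by (rule P_bounded_measurable[OF q])
  have Pq0: "(\<integral>v. P q v \<partial>\<nu>) = 0" using integral_P_nu[OF q] q0 by simp
  have s0: "\<sigma>2 \<ge> 0"
    unfolding \<sigma>2_def by (intro integral_nonneg_AE AE_I2) (auto intro: cond_var_nonneg[OF g])
  have i1: "integrable \<Omega> (\<lambda>\<omega>. ?Y (Suc k) \<omega> * complex_of_real (q (V (Suc k) \<omega>)))"
   and i2: "integrable \<Omega> (\<lambda>\<omega>. ?Y k \<omega> * complex_of_real (q (V (Suc k) \<omega>)))"
    by (intro integrable_mart_exp_mult[OF g] bounded_V q)+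
  have "(\<integral>\<omega>. ?Y k \<omega> * of_real (q (V (Suc k) \<omega>)) \<partial>\<Omega>) = (\<integral>\<omega>. ?Y k \<omega> * of_real (P q (V k \<omega>)) \<partial>\<Omega>)"
    by (rule complex_test_function[OF markov]) (auto intro: q bounded_V Pq mart_exp_history g)
  then have "(\<integral>\<omega>. ?Y (Suc k) \<omega> * of_real (q (V (Suc k) \<omega>)) \<partial>\<Omega>)
      = (\<integral>\<omega>. ?Y (Suc k) \<omega> * of_real (q (V (Suc k) \<omega>)) - ?Y k \<omega> * of_real (q (V (Suc k) \<omega>)) \<partial>\<Omega>)
        + (\<integral>\<omega>. ?Y k \<omega> * of_real (P q (V k \<omega>)) \<partial>\<Omega>)"
    using i1 i2 by simp
  moreover have "cmod (\<integral>\<omega>. ?Y (Suc k) \<omega> * of_real (q (V (Suc k) \<omega>)) - ?Y k \<omega> * of_real (q (V (Suc k) \<omega>)) \<partial>\<Omega>)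
      \<le> \<bar>s\<bar> * sqrt \<sigma>2 * sqrt (\<integral>v. (q v)\<^sup>2 \<partial>\<nu>)"
  proof -
    have aD: "(\<lambda>\<omega>. \<bar>?D \<omega>\<bar>) \<in> bounded_measurable \<Omega>" and aq: "(\<lambda>\<omega>. \<bar>q (V (Suc k) \<omega>)\<bar>) \<in> bounded_measurable \<Omega>"
      by (intro bounded_measurable_abs increment_bounded[OF g] bounded_V[OF q])+
    have "cmod (\<integral>\<omega>. ?Y (Suc k) \<omega> * of_real (q (V (Suc k) \<omega>)) - ?Y k \<omega> * of_real (q (V (Suc k) \<omega>)) \<partial>\<Omega>)
      \<le> (\<integral>\<omega>. \<bar>s\<bar> * (\<bar>?D \<omega>\<bar> * \<bar>q (V (Suc k) \<omega>)\<bar>) \<partial>\<Omega>)"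
    proof (rule order_trans[OF integral_norm_bound integral_mono])
      show "integrable \<Omega> (\<lambda>\<omega>. cmod (?Y (Suc k) \<omega> * of_real (q (V (Suc k) \<omega>)) - ?Y k \<omega> * of_real (q (V (Suc k) \<omega>))))"
        using i1 i2 by auto
      show "integrable \<Omega> (\<lambda>\<omega>. \<bar>s\<bar> * (\<bar>?D \<omega>\<bar> * \<bar>q (V (Suc k) \<omega>)\<bar>))"
        by (intro bounded_measurable_integrable bounded_measurable_mult bounded_measurable_const aD aq)
      fix \<omega>
      have "?Y (Suc k) \<omega> * of_real (q (V (Suc k) \<omega>)) - ?Y k \<omega> * of_real (q (V (Suc k) \<omega>))
          = ?Y k \<omega> * (iexp (s * ?D \<omega>) - 1) * of_real (q (V (Suc k) \<omega>))"
        by (simp add: mart_exp_Suc algebra_simps)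
      also have "cmod \<dots> = cmod (iexp (s * ?D \<omega>) - 1) * \<bar>q (V (Suc k) \<omega>)\<bar>" by (simp add: norm_mult)
      also have "\<dots> \<le> \<bar>s * ?D \<omega>\<bar> * \<bar>q (V (Suc k) \<omega>)\<bar>"
        using iexp_approx1[of "s * ?D \<omega>" 0] by (intro mult_right_mono) auto
      finally show "cmod (?Y (Suc k) \<omega> * of_real (q (V (Suc k) \<omega>)) - ?Y k \<omega> * of_real (q (V (Suc k) \<omega>)))
          \<le> \<bar>s\<bar> * (\<bar>?D \<omega>\<bar> * \<bar>q (V (Suc k) \<omega>)\<bar>)" by (simp add: abs_mult mult.assoc)
    qed
    also have "\<dots> = \<bar>s\<bar> * (\<integral>\<omega>. \<bar>?D \<omega>\<bar> * \<bar>q (V (Suc k) \<omega>)\<bar> \<partial>\<Omega>)" by simp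
    also have "(\<integral>\<omega>. \<bar>?D \<omega>\<bar> * \<bar>q (V (Suc k) \<omega>)\<bar> \<partial>\<Omega>) \<le> sqrt (\<sigma>2 * (\<integral>v. (q v)\<^sup>2 \<partial>\<nu>))"
    proof (rule real_le_rsqrt)
      have "(\<integral>\<omega>. \<bar>?D \<omega>\<bar> * \<bar>q (V (Suc k) \<omega>)\<bar> \<partial>\<Omega>)\<^sup>2 \<le> (\<integral>\<omega>. \<bar>?D \<omega>\<bar>\<^sup>2 \<partial>\<Omega>) * (\<integral>\<omega>. \<bar>q (V (Suc k) \<omega>)\<bar>\<^sup>2 \<partial>\<Omega>)"
        using aD aq by (intro expectation_cauchy_schwarz bounded_measurable_integrable bounded_measurable_power)
          (auto dest: bounded_measurable_measurable)
      also have "\<dots> = \<sigma>2 * (\<integral>v. (q v)\<^sup>2 \<partial>\<nu>)"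
        unfolding \<sigma>2_def using expectation_increment_square[OF g, of k] expectation_V_bounded[OF bounded_measurable_power[OF q], of "Suc k" 2] by simp
      finally show "(\<integral>\<omega>. \<bar>?D \<omega>\<bar> * \<bar>q (V (Suc k) \<omega>)\<bar> \<partial>\<Omega>)\<^sup>2 \<le> \<sigma>2 * (\<integral>v. (q v)\<^sup>2 \<partial>\<nu>)" .
    qed
    finally show ?thesis by (simp add: mult_left_mono real_sqrt_mult mult.assoc)
  qed
  moreover have "cmod (\<integral>\<omega>. ?Y k \<omega> * of_real (P q (V k \<omega>)) \<partial>\<Omega>)
      \<le> \<bar>s\<bar> * sqrt \<sigma>2 * (\<rho> * sqrt (\<integral>v. (q v)\<^sup>2 \<partial>\<nu>)) / (1 - \<rho>)"
  proof -
    have "cmod (\<integral>\<omega>. ?Y k \<omega> * of_real (P q (V k \<omega>)) \<partial>\<Omega>) \<le> \<bar>s\<bar> * sqrt \<sigma>2 * sqrt (\<integral>v. (P q v)\<^sup>2 \<partial>\<nu>) / (1 - \<rho>)"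
      by (rule Suc.IH[OF Pq Pq0])
    also have "sqrt (\<integral>v. (P q v)\<^sup>2 \<partial>\<nu>) \<le> sqrt (\<rho>\<^sup>2 * (\<integral>v. (q v)\<^sup>2 \<partial>\<nu>))"
      by (rule real_sqrt_le_mono[OF gap[OF q q0]])
    also have "\<dots> = \<rho> * sqrt (\<integral>v. (q v)\<^sup>2 \<partial>\<nu>)" using rho_pos by (simp add: real_sqrt_mult)
    finally show ?thesis using s0 rho_less by (simp add: divide_right_mono mult_left_mono)
  qed
  ultimately have "cmod (\<integral>\<omega>. ?Y (Suc k) \<omega> * of_real (q (V (Suc k) \<omega>)) \<partial>\<Omega>)
      \<le> \<bar>s\<bar> * sqrt \<sigma>2 * sqrt (\<integral>v. (q v)\<^sup>2 \<partial>\<nu>) + \<bar>s\<bar> * sqrt \<sigma>2 * (\<rho> * sqrt (\<integral>v. (q v)\<^sup>2 \<partial>\<nu>)) / (1 - \<rho>)"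
    by (simp only:) (rule norm_triangle_le, linarith)
  also have "\<dots> = \<bar>s\<bar> * sqrt \<sigma>2 * sqrt (\<integral>v. (q v)\<^sup>2 \<partial>\<nu>) / (1 - \<rho>)"
    using rho_less by (simp add: field_simps)
  finally show ?case .
qed

text \<open>Third-order expansion of the new factor: the linear term vanishes, the quadratic one is
  averaged to the conditional variance, whose fluctuation decorrelates from the past, and the cubic
  one is controlled by \<open>G\<close> times the second moment.\<close>

lemma mart_exp_step:
  assumes g: "g \<in> bounded_measurable S" and G: "\<And>v. v \<in> space S \<Longrightarrow> \<bar>g v\<bar> \<le> G"
  defines "\<sigma>2 \<equiv> \<integral>v. cond_var g v \<partial>\<nu>"
  shows "cmod ((\<integral>\<omega>. mart_exp g s (Suc k) \<omega> \<partial>\<Omega>) - of_real (1 - s\<^sup>2 * \<sigma>2 / 2) * (\<integral>\<omega>. mart_exp g s k \<omega> \<partial>\<Omega>))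
    \<le> \<bar>s\<bar> ^ 3 * G * \<sigma>2 / (1 - \<rho>)"
proof -
  let ?Y = "mart_exp g s"
  let ?D = "increment g k"
  let ?q = "\<lambda>v. cond_var g v - \<sigma>2"
  note cv = cond_var_bounded_measurable[OF g]
  have q: "?q \<in> bounded_measurable S" by (intro bounded_measurable_intros cv)
  have q0: "(\<integral>v. ?q v \<partial>\<nu>) = 0" using cv nu.prob_space by (simp add: integrable_nu \<sigma>2_def)
  have q2: "(\<integral>v. (?q v)\<^sup>2 \<partial>\<nu>) \<le> G\<^sup>2 * \<sigma>2"
    unfolding \<sigma>2_def by (rule cond_var_centered_square[OF g G])
  have s0: "\<sigma>2 \<ge> 0"
    unfolding \<sigma>2_def by (intro integral_nonneg_AE AE_I2) (auto intro: cond_var_nonneg[OF g])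
  have G0: "G \<ge> 0" using G nu.not_empty by (metis abs_ge_zero all_not_in_conv order_trans space_nu)
  have D: "?D \<in> bounded_measurable \<Omega>" by (rule increment_bounded[OF g])
  have D2: "(\<lambda>\<omega>. (?D \<omega>)\<^sup>2) \<in> bounded_measurable \<Omega>" by (rule bounded_measurable_power[OF D])
  have iY: "integrable \<Omega> (?Y j)" for j
    using integrable_mart_exp_mult[OF g bounded_measurable_const[of 1], of s j] by simp
  have iD: "integrable \<Omega> (\<lambda>\<omega>. ?Y k \<omega> * complex_of_real (?D \<omega>))"
    by (rule integrable_mart_exp_mult[OF g D])
  have iD2: "integrable \<Omega> (\<lambda>\<omega>. ?Y k \<omega> * complex_of_real ((?D \<omega>)\<^sup>2))"
    by (rule integrable_mart_exp_mult[OF g D2])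
  have iq: "integrable \<Omega> (\<lambda>\<omega>. ?Y k \<omega> * complex_of_real (?q (V k \<omega>)))"
    by (rule integrable_mart_exp_mult[OF g bounded_V[OF q]])
  have eD: "(\<integral>\<omega>. ?Y k \<omega> * of_real (?D \<omega>) \<partial>\<Omega>) = 0"
  proof -
    have "(\<integral>\<omega>. ?Y k \<omega> * of_real (?D \<omega>) \<partial>\<Omega>) = (\<integral>\<omega>. ?Y k \<omega> * of_real 0 \<partial>\<Omega>)"
      by (rule complex_test_function[where k=k])
         (auto intro: D bounded_measurable_const mart_exp_history g simp: increment_orthogonal[OF _ g])
    then show ?thesis by simp
  qed
  have eD2: "(\<integral>\<omega>. ?Y k \<omega> * of_real ((?D \<omega>)\<^sup>2) \<partial>\<Omega>)
      = (\<integral>\<omega>. ?Y k \<omega> * of_real (?q (V k \<omega>)) \<partial>\<Omega>) + of_real \<sigma>2 * (\<integral>\<omega>. ?Y k \<omega> \<partial>\<Omega>)"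
  proof -
    have "(\<integral>\<omega>. ?Y k \<omega> * of_real ((?D \<omega>)\<^sup>2) \<partial>\<Omega>) = (\<integral>\<omega>. ?Y k \<omega> * of_real (cond_var g (V k \<omega>)) \<partial>\<Omega>)"
      by (rule complex_test_function[where k=k, OF increment_square[OF _ g]])
         (auto intro: D2 bounded_V cv mart_exp_history g)
    also have "\<dots> = (\<integral>\<omega>. ?Y k \<omega> * of_real (?q (V k \<omega>)) + of_real \<sigma>2 * ?Y k \<omega> \<partial>\<Omega>)"
      by (intro Bochner_Integration.integral_cong) (auto simp: algebra_simps)
    also have "\<dots> = (\<integral>\<omega>. ?Y k \<omega> * of_real (?q (V k \<omega>)) \<partial>\<Omega>) + of_real \<sigma>2 * (\<integral>\<omega>. ?Y k \<omega> \<partial>\<Omega>)"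
      using iq iY by (subst Bochner_Integration.integral_add) auto
    finally show ?thesis .
  qed
  let ?R = "\<lambda>\<omega>. ?Y k \<omega> * (iexp (s * ?D \<omega>) - (1 + \<i> * of_real (s * ?D \<omega>) - of_real ((s * ?D \<omega>)\<^sup>2 / 2)))"
  have R_eq: "?R \<omega> = ?Y (Suc k) \<omega> - ?Y k \<omega> - (\<i> * of_real s) * (?Y k \<omega> * of_real (?D \<omega>))
      + of_real (s\<^sup>2 / 2) * (?Y k \<omega> * of_real ((?D \<omega>)\<^sup>2))" for \<omega>
    by (simp add: mart_exp_Suc power_mult_distrib algebra_simps)
  have iR: "integrable \<Omega> ?R" unfolding R_eq using iY iD iD2 by auto
  have "(\<integral>\<omega>. ?R \<omega> \<partial>\<Omega>) = (\<integral>\<omega>. ?Y (Suc k) \<omega> \<partial>\<Omega>) - (\<integral>\<omega>. ?Y k \<omega> \<partial>\<Omega>)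
      - (\<i> * of_real s) * (\<integral>\<omega>. ?Y k \<omega> * of_real (?D \<omega>) \<partial>\<Omega>)
      + of_real (s\<^sup>2 / 2) * (\<integral>\<omega>. ?Y k \<omega> * of_real ((?D \<omega>)\<^sup>2) \<partial>\<Omega>)"
    unfolding R_eq using iY iD iD2 by simp
  then have eqn: "(\<integral>\<omega>. ?Y (Suc k) \<omega> \<partial>\<Omega>) - of_real (1 - s\<^sup>2 * \<sigma>2 / 2) * (\<integral>\<omega>. ?Y k \<omega> \<partial>\<Omega>)
      = (\<integral>\<omega>. ?R \<omega> \<partial>\<Omega>) - of_real (s\<^sup>2 / 2) * (\<integral>\<omega>. ?Y k \<omega> * of_real (?q (V k \<omega>)) \<partial>\<Omega>)"
    unfolding eD eD2 by (simp add: algebra_simps)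
  have A: "cmod (\<integral>\<omega>. ?R \<omega> \<partial>\<Omega>) \<le> \<bar>s\<bar> ^ 3 * G * \<sigma>2 / 3"
  proof -
    have "cmod (\<integral>\<omega>. ?R \<omega> \<partial>\<Omega>) \<le> (\<integral>\<omega>. \<bar>s\<bar> ^ 3 * G / 3 * (?D \<omega>)\<^sup>2 \<partial>\<Omega>)"
    proof (rule order_trans[OF integral_norm_bound integral_mono])
      show "integrable \<Omega> (\<lambda>\<omega>. cmod (?R \<omega>))" using iR by auto
      show "integrable \<Omega> (\<lambda>\<omega>. \<bar>s\<bar> ^ 3 * G / 3 * (?D \<omega>)\<^sup>2)"
        by (intro bounded_measurable_integrable bounded_measurable_mult bounded_measurable_const D2)
      fix \<omega> assume \<omega>: "\<omega> \<in> space \<Omega>"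
      have V: "V j \<omega> \<in> space S" for j using measurable_space[OF V_measurable \<omega>] .
      have "\<bar>?D \<omega>\<bar> \<le> \<bar>g (V (Suc k) \<omega>)\<bar> + \<bar>P g (V k \<omega>)\<bar>"
        unfolding increment_def by (rule abs_triangle_ineq4)
      also have "\<dots> \<le> 2 * G" using G[OF V, of "Suc k"] P_bound[OF g G V, of k] by simp
      finally have D_le: "\<bar>?D \<omega>\<bar> \<le> 2 * G" .
      have sum2: "(\<Sum>j\<le>2. (\<i> * of_real x) ^ j / fact j) = 1 + \<i> * of_real x - of_real (x\<^sup>2 / 2)" for x :: real
        by (simp add: numeral_2_eq_2 power2_eq_square algebra_simps)
      have "cmod (?R \<omega>) = cmod (iexp (s * ?D \<omega>) - (1 + \<i> * of_real (s * ?D \<omega>) - of_real ((s * ?D \<omega>)\<^sup>2 / 2)))"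
        by (simp only: norm_mult norm_mart_exp mult_1_left)
      also have "\<dots> \<le> \<bar>s * ?D \<omega>\<bar> ^ 3 / 6"
        using iexp_approx1[of "s * ?D \<omega>" 2] unfolding sum2 by (simp add: fact_numeral numeral_3_eq_3)
      also have "\<dots> = \<bar>s\<bar> ^ 3 / 6 * (\<bar>?D \<omega>\<bar> * (?D \<omega>)\<^sup>2)"
      proof -
        have "\<bar>x * y\<bar> ^ 3 / 6 = \<bar>x\<bar> ^ 3 / 6 * (\<bar>y\<bar> * y\<^sup>2)" for x y :: real
          by (cases "y \<ge> 0") (simp_all add: abs_mult power_mult_distrib power3_eq_cube power2_eq_square)
        then show ?thesis .
      qed
      also have "\<dots> \<le> \<bar>s\<bar> ^ 3 / 6 * (2 * G * (?D \<omega>)\<^sup>2)"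
        using D_le by (intro mult_left_mono mult_right_mono) auto
      finally show "cmod (?R \<omega>) \<le> \<bar>s\<bar> ^ 3 * G / 3 * (?D \<omega>)\<^sup>2" by (simp add: mult_ac)
    qed
    also have "\<dots> = \<bar>s\<bar> ^ 3 * G * \<sigma>2 / 3"
      unfolding \<sigma>2_def by (simp add: expectation_increment_square[OF g])
    finally show ?thesis .
  qed
  have B: "cmod (of_real (s\<^sup>2 / 2) * (\<integral>\<omega>. ?Y k \<omega> * of_real (?q (V k \<omega>)) \<partial>\<Omega>)) \<le> \<bar>s\<bar> ^ 3 * G * \<sigma>2 / (2 * (1 - \<rho>))"
  proof -
    have "cmod (of_real (s\<^sup>2 / 2) * (\<integral>\<omega>. ?Y k \<omega> * of_real (?q (V k \<omega>)) \<partial>\<Omega>))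
        = s\<^sup>2 / 2 * cmod (\<integral>\<omega>. ?Y k \<omega> * of_real (?q (V k \<omega>)) \<partial>\<Omega>)"
    proof -
      have "\<bar>s\<^sup>2 / 2\<bar> = s\<^sup>2 / 2" by simp
      then show ?thesis by (simp only: norm_mult norm_of_real)
    qed
    also have "\<dots> \<le> s\<^sup>2 / 2 * (\<bar>s\<bar> * sqrt \<sigma>2 * sqrt (\<integral>v. (?q v)\<^sup>2 \<partial>\<nu>) / (1 - \<rho>))"
      unfolding \<sigma>2_def by (intro mult_left_mono mart_exp_decorrelation g q[unfolded \<sigma>2_def] q0[unfolded \<sigma>2_def]) auto
    also have "\<dots> \<le> s\<^sup>2 / 2 * (\<bar>s\<bar> * sqrt \<sigma>2 * (G * sqrt \<sigma>2) / (1 - \<rho>))"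
    proof (intro mult_left_mono divide_right_mono)
      have "sqrt (\<integral>v. (?q v)\<^sup>2 \<partial>\<nu>) \<le> sqrt (G\<^sup>2 * \<sigma>2)" by (rule real_sqrt_le_mono[OF q2])
      then show "sqrt (\<integral>v. (?q v)\<^sup>2 \<partial>\<nu>) \<le> G * sqrt \<sigma>2" using G0 by (simp add: real_sqrt_mult)
    qed (use rho_less s0 in auto)
    also have "\<dots> = \<bar>s\<bar> ^ 3 * G * (sqrt \<sigma>2 * sqrt \<sigma>2) / (2 * (1 - \<rho>))"
    proof -
      have "s\<^sup>2 = \<bar>s\<bar> * \<bar>s\<bar>" by (simp add: power2_eq_square)
      then show ?thesis by (simp add: power3_eq_cube)
    qed
    finally show ?thesis using s0 by simp
  qed
  have "cmod ((\<integral>\<omega>. ?Y (Suc k) \<omega> \<partial>\<Omega>) - of_real (1 - s\<^sup>2 * \<sigma>2 / 2) * (\<integral>\<omega>. ?Y k \<omega> \<partial>\<Omega>))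
      \<le> \<bar>s\<bar> ^ 3 * G * \<sigma>2 / 3 + \<bar>s\<bar> ^ 3 * G * \<sigma>2 / (2 * (1 - \<rho>))"
    unfolding eqn by (rule order_trans[OF norm_triangle_ineq4 add_mono[OF A B]])
  also have "\<dots> \<le> \<bar>s\<bar> ^ 3 * G * \<sigma>2 / (1 - \<rho>)"
  proof -
    have "x / 3 + x / (2 * d) \<le> x / d" if "x \<ge> 0" "0 < d" "d \<le> 1" for x d :: real
    proof -
      have "x * d \<le> x * 1" using that by (intro mult_left_mono) auto
      then show ?thesis using that by (simp add: field_simps)
    qed
    from this[of "\<bar>s\<bar> ^ 3 * G * \<sigma>2" "1 - \<rho>"] show ?thesis using G0 s0 rho_pos rho_less by simp
  qed
  finally show ?thesis .
qed

lemma martingale_char_bound: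
  assumes g: "g \<in> bounded_measurable S" and G: "\<And>v. v \<in> space S \<Longrightarrow> \<bar>g v\<bar> \<le> G"
  defines "\<sigma>2 \<equiv> \<integral>v. cond_var g v \<partial>\<nu>"
  assumes small: "s\<^sup>2 * \<sigma>2 / 2 \<le> 1"
  shows "cmod ((\<integral>\<omega>. iexp (s * (\<Sum>j<k. increment g j \<omega>)) \<partial>\<Omega>) - of_real ((1 - s\<^sup>2 * \<sigma>2 / 2) ^ k))
    \<le> real k * (\<bar>s\<bar> ^ 3 * G * \<sigma>2 / (1 - \<rho>))"
proof (induction k)
  case 0
  then show ?case by (simp add: prob_space)
next
  case (Suc k)
  let ?E = "\<lambda>k. \<integral>\<omega>. mart_exp g s k \<omega> \<partial>\<Omega>"
  let ?w = "1 - s\<^sup>2 * \<sigma>2 / 2"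
  let ?e = "\<bar>s\<bar> ^ 3 * G * \<sigma>2 / (1 - \<rho>)"
  have s0: "\<sigma>2 \<ge> 0"
    unfolding \<sigma>2_def by (intro integral_nonneg_AE AE_I2) (auto intro: cond_var_nonneg[OF g])
  have w: "0 \<le> ?w" "?w \<le> 1" using small s0 by auto
  have "?E (Suc k) - of_real (?w ^ Suc k) = (?E (Suc k) - of_real ?w * ?E k) + of_real ?w * (?E k - of_real (?w ^ k))"
    by (simp add: algebra_simps)
  also have "cmod \<dots> \<le> ?e + ?w * (real k * ?e)"
  proof (rule norm_triangle_mono)
    show "cmod (?E (Suc k) - of_real ?w * ?E k) \<le> ?e"
      unfolding \<sigma>2_def by (rule mart_exp_step[OF g G])
    have "cmod (?E k - of_real (?w ^ k)) \<le> real k * ?e" using Suc unfolding mart_exp_def .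
    then show "cmod (of_real ?w * (?E k - of_real (?w ^ k))) \<le> ?w * (real k * ?e)"
      unfolding norm_mult norm_of_real abs_of_nonneg[OF w(1)] by (rule mult_left_mono) (rule w)
  qed
  also have "\<dots> \<le> ?e + 1 * (real k * ?e)"
  proof -
    have "0 \<le> real k * ?e" using Suc by (rule order_trans[OF norm_ge_zero])
    then show ?thesis using w by (intro add_left_mono mult_right_mono) auto
  qed
  also have "\<dots> = real (Suc k) * ?e"
  proof -
    have "x + 1 * (real k * x) = real (Suc k) * x" for x :: real by (simp add: algebra_simps)
    then show ?thesis .
  qed
  finally show ?case unfolding mart_exp_def .
qed

end


section \<open>Truncation of a slowly varying observable\<close>

lemma truncate_square: "(truncate c z)\<^sup>2 = z\<^sup>2 * indicator {x. \<bar>x\<bar> \<le> c} z"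
  by (simp add: truncate_def indicator_def)

lemma abs_truncate_le: "c \<ge> 0 \<Longrightarrow> \<bar>truncate c z\<bar> \<le> c"
  by (simp add: truncate_def indicator_def)

lemma abs_truncate_le_self: "\<bar>truncate c z\<bar> \<le> \<bar>z\<bar>"
  by (simp add: truncate_def indicator_def)

lemma truncate_measurable[measurable]: "truncate c \<in> borel_measurable borel"
  unfolding truncate_def[abs_def] by measurable

lemma asymp_equiv_ln_quotient:
  assumes "f \<sim>[at_top] (\<lambda>a. C * ln a)" "C > 0"
  shows "((\<lambda>a. f a / ln a) \<longlongrightarrow> C) (at_top :: real filter)"
proof -
  have "eventually (\<lambda>a. f a \<noteq> 0 \<or> C * ln a \<noteq> 0) at_top"
    using eventually_gt_at_top[of 1] by eventually_elim (use assms(2) in auto)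
  with assms(1) have "((\<lambda>a. f a / (C * ln a)) \<longlongrightarrow> 1) at_top"
    by (rule asymp_equivD_strong)
  then have "((\<lambda>a. C * (f a / (C * ln a))) \<longlongrightarrow> C * 1) at_top"
    by (intro tendsto_mult tendsto_const)
  then show ?thesis using assms(2) by simp
qed

context prob_space
begin

text \<open>The notation \<open>truncate\<close> sets values beyond the level to zero, so \<open>tail_moment\<close> is the first
  moment of the part that is cut off.\<close>

definition truncated_moment :: "('a \<Rightarrow> real) \<Rightarrow> real \<Rightarrow> real" where
  "truncated_moment Z a = (\<integral>v. (truncate a (Z v))\<^sup>2 \<partial>M)"

definition tail_moment :: "('a \<Rightarrow> real) \<Rightarrow> real \<Rightarrow> real" where
  "tail_moment Z a = (\<integral>v. \<bar>Z v - truncate a (Z v)\<bar> \<partial>M)"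

lemma truncate_bounded_measurable:
  assumes [measurable]: "Z \<in> borel_measurable M"
  shows "(\<lambda>v. truncate c (Z v)) \<in> bounded_measurable M"
proof (rule bounded_measurableI)
  show "\<bar>truncate c (Z v)\<bar> \<le> \<bar>c\<bar>" for v by (simp add: truncate_def indicator_def)
qed measurable

lemma integral_truncate_difference_square:
  assumes Z: "Z \<in> borel_measurable M" and "b \<le> a"
  shows "(\<integral>v. (truncate a (Z v) - truncate b (Z v))\<^sup>2 \<partial>M) = truncated_moment Z a - truncated_moment Z b"
proof -
  have "(\<integral>v. (truncate a (Z v) - truncate b (Z v))\<^sup>2 \<partial>M) = (\<integral>v. (truncate a (Z v))\<^sup>2 - (truncate b (Z v))\<^sup>2 \<partial>M)"
    using \<open>b \<le> a\<close> by (intro Bochner_Integration.integral_cong) (auto simp: truncate_def indicator_def)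
  then show ?thesis
    unfolding truncated_moment_def
    by (simp add: bounded_measurable_integrable bounded_measurable_power truncate_bounded_measurable Z)
qed

lemma truncated_moment_nonneg: "truncated_moment Z a \<ge> 0"
  by (simp add: truncated_moment_def)

lemma integrable_tail: "integrable M Z \<Longrightarrow> integrable M (\<lambda>v. \<bar>Z v - truncate a (Z v)\<bar>)"
  using bounded_measurable_integrable[OF truncate_bounded_measurable, of Z a] by auto

lemma tail_moment_nonneg: "tail_moment Z a \<ge> 0"
  by (simp add: tail_moment_def)

lemma tail_moment_tendsto_0:
  assumes Z: "integrable M Z" and x: "filterlim x at_top sequentially"
  shows "(\<lambda>n. tail_moment Z (x n)) \<longlonglongrightarrow> 0"
proof -
  have [measurable]: "Z \<in> borel_measurable M" using Z by simp
  have "(\<lambda>n. \<integral>v. \<bar>Z v - truncate (x n) (Z v)\<bar> \<partial>M) \<longlonglongrightarrow> (\<integral>v. 0 \<partial>M)"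
  proof (rule integral_dominated_convergence[where w="\<lambda>v. \<bar>Z v\<bar>"])
    show "AE v in M. (\<lambda>n. \<bar>Z v - truncate (x n) (Z v)\<bar>) \<longlonglongrightarrow> 0"
    proof (rule AE_I2)
      fix v
      have "eventually (\<lambda>n. \<bar>Z v\<bar> \<le> x n) sequentially" using x by (simp add: filterlim_at_top)
      then have "eventually (\<lambda>n. \<bar>Z v - truncate (x n) (Z v)\<bar> = 0) sequentially"
        by eventually_elim (simp add: truncate_def)
      then show "(\<lambda>n. \<bar>Z v - truncate (x n) (Z v)\<bar>) \<longlonglongrightarrow> 0" by (rule tendsto_eventually)
    qed
    show "AE v in M. norm \<bar>Z v - truncate (x n) (Z v)\<bar> \<le> \<bar>Z v\<bar>" for n
      by (simp add: truncate_def indicator_def)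
  qed (use Z in auto)
  then show ?thesis by (simp add: tail_moment_def)
qed

lemma tail_moment_step:
  assumes Z: "integrable M Z" and a: "a > 0"
  shows "tail_moment Z a - tail_moment Z (2 * a) \<le> (truncated_moment Z (2 * a) - truncated_moment Z a) / a"
proof -
  have [measurable]: "Z \<in> borel_measurable M" using Z by simp
  have "tail_moment Z a - tail_moment Z (2 * a) = (\<integral>v. \<bar>Z v - truncate a (Z v)\<bar> - \<bar>Z v - truncate (2 * a) (Z v)\<bar> \<partial>M)"
    unfolding tail_moment_def using integrable_tail[OF Z] by simp
  also have "\<dots> \<le> (\<integral>v. ((truncate (2 * a) (Z v))\<^sup>2 - (truncate a (Z v))\<^sup>2) / a \<partial>M)"
  proof (rule integral_mono)
    fix v
    have "\<bar>z\<bar> \<le> z\<^sup>2 / a" if "a \<le> \<bar>z\<bar>" for z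
    proof -
      have "\<bar>z\<bar> * a \<le> \<bar>z\<bar> * \<bar>z\<bar>" using that by (intro mult_left_mono) auto
      then show ?thesis using a by (simp add: field_simps power2_eq_square)
    qed
    then show "\<bar>Z v - truncate a (Z v)\<bar> - \<bar>Z v - truncate (2 * a) (Z v)\<bar> \<le> ((truncate (2 * a) (Z v))\<^sup>2 - (truncate a (Z v))\<^sup>2) / a"
      using a by (auto simp: truncate_def indicator_def)
  next
    show "integrable M (\<lambda>v. ((truncate (2 * a) (Z v))\<^sup>2 - (truncate a (Z v))\<^sup>2) / a)"
      by (intro bounded_measurable_integrable bounded_measurable_divide bounded_measurable_diff
          bounded_measurable_power truncate_bounded_measurable) measurable
  qed (intro Bochner_Integration.integrable_diff integrable_tail Z)
  also have "\<dots> = (truncated_moment Z (2 * a) - truncated_moment Z a) / a"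
    unfolding truncated_moment_def
    by (simp add: bounded_measurable_integrable bounded_measurable_power truncate_bounded_measurable)
  finally show ?thesis .
qed

text \<open>The tail gains \<open>e (ln a) / a\<close> from each doubling of \<open>a\<close>, and
  \<open>\<psi> a = e (2 ln a + 2 ln 2) / a\<close> solves \<open>\<psi> a - \<psi> (2 a) = e (ln a) / a\<close>.\<close>

lemma tail_moment_bound:
  assumes Z: "integrable M Z" and A: "A \<ge> 1" and e: "e \<ge> 0"
    and inc: "\<And>x. x \<ge> A \<Longrightarrow> truncated_moment Z (2 * x) - truncated_moment Z x \<le> e * ln x"
    and a: "a \<ge> A"
  shows "tail_moment Z a \<le> e * (2 * ln a + 2 * ln 2) / a"
proof -
  define \<psi> where "\<psi> x = e * (2 * ln x + 2 * ln 2) / x" for x :: real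
  have step: "tail_moment Z x - \<psi> x \<le> tail_moment Z (2 * x) - \<psi> (2 * x)" if x: "x \<ge> A" for x
  proof -
    have "x > 0" using x A by linarith
    have "tail_moment Z x - tail_moment Z (2 * x) \<le> (truncated_moment Z (2 * x) - truncated_moment Z x) / x"
      by (rule tail_moment_step[OF Z \<open>x > 0\<close>])
    also have "\<dots> \<le> e * ln x / x" using inc[OF x] \<open>x > 0\<close> by (intro divide_right_mono) auto
    also have "\<dots> = \<psi> x - \<psi> (2 * x)"
      using \<open>x > 0\<close> unfolding \<psi>_def by (simp add: ln_mult field_simps)
    finally show ?thesis by linarith
  qed
  have it: "tail_moment Z a - \<psi> a \<le> tail_moment Z (2 ^ n * a) - \<psi> (2 ^ n * a) \<and> A \<le> 2 ^ n * a" for n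
  proof (induction n)
    case (Suc n)
    have "2 * (2 ^ n * a) \<ge> A" using Suc a A by linarith
    then show ?case using Suc step[of "2 ^ n * a"] by (simp add: mult.assoc)
  qed (use a in simp)
  have lim: "filterlim (\<lambda>n. 2 ^ n * a) at_top sequentially"
  proof -
    have "a > 0" using a A by linarith
    then show ?thesis by real_asymp
  qed
  have "tail_moment Z a - \<psi> a \<le> tail_moment Z (2 ^ n * a)" for n
  proof -
    have "\<psi> x \<ge> 0" if "x \<ge> 1" for x
      unfolding \<psi>_def using that e by (intro divide_nonneg_nonneg mult_nonneg_nonneg) auto
    then have "\<psi> (2 ^ n * a) \<ge> 0" using it[of n] A by (meson order_trans)
    then show ?thesis using it[of n] by linarith
  qed
  then have "tail_moment Z a - \<psi> a \<le> 0"
    by (intro LIMSEQ_le_const[OF tail_moment_tendsto_0[OF Z lim]]) auto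
  then show ?thesis by (simp add: \<psi>_def)
qed

text \<open>Slow variation makes the truncated second moment grow by \<open>o(ln a)\<close> when \<open>a\<close> is doubled.\<close>

lemma tail_moment_asymp:
  assumes Z: "integrable M Z" and C: "((\<lambda>a. truncated_moment Z a / ln a) \<longlongrightarrow> C) at_top"
  shows "((\<lambda>a. tail_moment Z a * a / ln a) \<longlongrightarrow> 0) at_top"
proof (rule order_tendstoI)
  fix e :: real assume "0 < e"
  have "((\<lambda>x. truncated_moment Z (2 * x) / ln (2 * x) * (ln (2 * x) / ln x) - truncated_moment Z x / ln x) \<longlongrightarrow> C * 1 - C) at_top"
  proof (intro tendsto_diff tendsto_mult C)
    show "((\<lambda>x. truncated_moment Z (2 * x) / ln (2 * x)) \<longlongrightarrow> C) at_top"
      by (rule filterlim_compose[OF C]) real_asymp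
    show "((\<lambda>x::real. ln (2 * x) / ln x) \<longlongrightarrow> 1) at_top" by real_asymp
  qed
  then have "eventually (\<lambda>x. truncated_moment Z (2 * x) / ln (2 * x) * (ln (2 * x) / ln x) - truncated_moment Z x / ln x < e / 8) at_top"
    using \<open>0 < e\<close> by (intro order_tendstoD(2)) auto
  then have "eventually (\<lambda>x. truncated_moment Z (2 * x) - truncated_moment Z x \<le> (e / 8) * ln x) at_top"
    using eventually_gt_at_top[of 1]
  proof eventually_elim
    fix x :: real assume x: "truncated_moment Z (2 * x) / ln (2 * x) * (ln (2 * x) / ln x) - truncated_moment Z x / ln x < e / 8" "1 < x"
    have "ln (2 * x) > 0" "ln x > 0" using x(2) by auto
    then have "(truncated_moment Z (2 * x) - truncated_moment Z x) / ln x < e / 8"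
      using x(1) by (simp add: diff_divide_distrib)
    then show "truncated_moment Z (2 * x) - truncated_moment Z x \<le> (e / 8) * ln x"
      using \<open>ln x > 0\<close> by (simp add: divide_less_eq less_imp_le)
  qed
  then obtain A where A: "\<And>x. x \<ge> A \<Longrightarrow> truncated_moment Z (2 * x) - truncated_moment Z x \<le> (e / 8) * ln x"
    by (auto simp: eventually_at_top_linorder)
  show "eventually (\<lambda>a. tail_moment Z a * a / ln a < e) at_top"
    using eventually_ge_at_top[of "max A 1"] eventually_ge_at_top[of 2]
  proof eventually_elim
    fix a :: real assume a: "max A 1 \<le> a" "2 \<le> a"
    have "tail_moment Z a \<le> (e / 8) * (2 * ln a + 2 * ln 2) / a"
      using \<open>0 < e\<close> a by (intro tail_moment_bound[OF Z, of "max A 1"] A) auto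
    then have "tail_moment Z a * a \<le> (e / 8) * (2 * ln a + 2 * ln 2)"
      using a by (simp add: pos_le_divide_eq)
    also have "\<dots> \<le> (e / 8) * (4 * ln a)" using \<open>0 < e\<close> a by (intro mult_left_mono) auto
    also have "\<dots> < e * ln a" using \<open>0 < e\<close> a by simp
    finally show "tail_moment Z a * a / ln a < e" using a by (simp add: divide_less_eq)
  qed
next
  fix e :: real assume "e < 0"
  show "eventually (\<lambda>a. e < tail_moment Z a * a / ln a) at_top"
    using eventually_gt_at_top[of 1]
    by eventually_elim (use \<open>e < 0\<close> tail_moment_nonneg in \<open>auto intro!: less_le_trans[of e 0]\<close>)
qed

text \<open>Since \<open>Z\<close> has mean zero, the mean of the truncated part is minus that of the tail.\<close>

lemma mean_truncate_le:
  assumes Z: "integrable M Z" and Z0: "(\<integral>v. Z v \<partial>M) = 0"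
  shows "\<bar>\<integral>v. truncate a (Z v) \<partial>M\<bar> \<le> tail_moment Z a"
proof -
  have t: "integrable M (\<lambda>v. truncate a (Z v))"
    using Z by (intro bounded_measurable_integrable truncate_bounded_measurable) auto
  have "(\<integral>v. truncate a (Z v) \<partial>M) = - (\<integral>v. Z v - truncate a (Z v) \<partial>M)"
    using Z t Z0 by simp
  then show ?thesis
    unfolding tail_moment_def using integral_abs_bound[of M "\<lambda>v. Z v - truncate a (Z v)"] by simp
qed

lemma prob_exceeds_le:
  assumes Z: "integrable M Z" and a: "a > 0"
  shows "prob {v \<in> space M. \<bar>Z v\<bar> > a} \<le> tail_moment Z a / a"
proof -
  have [measurable]: "Z \<in> borel_measurable M" using Z by simp
  have "prob {v \<in> space M. \<bar>Z v\<bar> > a} \<le> prob {v \<in> space M. \<bar>Z v - truncate a (Z v)\<bar> \<ge> a}"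
    using a by (intro finite_measure_mono) (auto simp: truncate_def)
  also have "\<dots> \<le> (\<integral>v. \<bar>Z v - truncate a (Z v)\<bar> \<partial>M) / a"
    by (rule integral_Markov_inequality_measure[where A="{}"]) (use integrable_tail[OF Z] a in auto)
  finally show ?thesis by (simp add: tail_moment_def)
qed


section \<open>Perturbation in mean square\<close>

definition square_int :: "('a \<Rightarrow> real) \<Rightarrow> bool" where
  "square_int f \<longleftrightarrow> f \<in> borel_measurable M \<and> integrable M (\<lambda>x. (f x)\<^sup>2)"

definition ms_null :: "(real \<Rightarrow> 'a \<Rightarrow> real) \<Rightarrow> bool" where
  "ms_null U \<longleftrightarrow> eventually (\<lambda>a. square_int (U a)) at_top \<and> ((\<lambda>a. \<integral>x. (U a x)\<^sup>2 \<partial>M) \<longlongrightarrow> 0) at_top"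

lemma square_int_bounded: "f \<in> bounded_measurable M \<Longrightarrow> square_int f"
  unfolding square_int_def by (auto intro: bounded_measurable_measurable bounded_measurable_integrable bounded_measurable_power)

lemma square_int_add: "square_int f \<Longrightarrow> square_int g \<Longrightarrow> square_int (\<lambda>x. f x + g x)"
  unfolding square_int_def by (auto intro: integrable_square_add)

lemma square_int_uminus: "square_int f \<Longrightarrow> square_int (\<lambda>x. - f x)"
  by (simp add: square_int_def)

lemma square_int_add_le:
  assumes "square_int f" "square_int g"
  shows "(\<integral>x. (f x + g x)\<^sup>2 \<partial>M) \<le> 2 * (\<integral>x. (f x)\<^sup>2 \<partial>M) + 2 * (\<integral>x. (g x)\<^sup>2 \<partial>M)"
proof -
  have "(\<integral>x. (f x + g x)\<^sup>2 \<partial>M) \<le> (\<integral>x. 2 * (f x)\<^sup>2 + 2 * (g x)\<^sup>2 \<partial>M)"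
    using assms square_int_add[OF assms] power2_sum2_le by (intro integral_mono) (auto simp: square_int_def)
  then show ?thesis using assms by (simp add: square_int_def)
qed

lemma ms_nullI:
  assumes "eventually (\<lambda>a. square_int (U a)) at_top"
    and "eventually (\<lambda>a. (\<integral>x. (U a x)\<^sup>2 \<partial>M) \<le> b a) at_top" and "(b \<longlongrightarrow> 0) at_top"
  shows "ms_null U"
  unfolding ms_null_def
  by (intro conjI assms(1) tendsto_sandwich[OF _ assms(2) tendsto_const assms(3)]) simp

lemma ms_null_bounded:
  assumes "eventually (\<lambda>a. U a \<in> borel_measurable M) at_top"
    and le: "eventually (\<lambda>a. \<forall>x\<in>space M. \<bar>U a x\<bar> \<le> c a) at_top" and c: "(c \<longlongrightarrow> 0) at_top"
  shows "ms_null U"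
proof (rule ms_nullI)
  show "eventually (\<lambda>a. square_int (U a)) at_top"
    using assms(1) le by eventually_elim (auto intro!: square_int_bounded bounded_measurableI)
  show "eventually (\<lambda>a. (\<integral>x. (U a x)\<^sup>2 \<partial>M) \<le> (c a)\<^sup>2) at_top"
    using assms(1) le
  proof eventually_elim
    case (elim a)
    then have U: "square_int (U a)" by (auto intro!: square_int_bounded bounded_measurableI)
    have "(\<integral>x. (U a x)\<^sup>2 \<partial>M) \<le> (\<integral>x. (c a)\<^sup>2 \<partial>M)"
    proof (rule integral_mono)
      show "(U a x)\<^sup>2 \<le> (c a)\<^sup>2" if "x \<in> space M" for x
        using elim(2) that power_mono[of "\<bar>U a x\<bar>" "c a" 2] by simp
    qed (use U in \<open>auto simp: square_int_def\<close>)
    then show ?case by (simp add: prob_space)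
  qed
  show "((\<lambda>a. (c a)\<^sup>2) \<longlongrightarrow> 0) at_top" using tendsto_power[OF c, of 2] by simp
qed

lemma ms_null_add:
  assumes "ms_null U" "ms_null W"
  shows "ms_null (\<lambda>a x. U a x + W a x)"
proof (rule ms_nullI)
  show "eventually (\<lambda>a. square_int (\<lambda>x. U a x + W a x)) at_top"
    using assms unfolding ms_null_def by (auto elim: eventually_elim2 intro: square_int_add)
  show "eventually (\<lambda>a. (\<integral>x. (U a x + W a x)\<^sup>2 \<partial>M) \<le> 2 * (\<integral>x. (U a x)\<^sup>2 \<partial>M) + 2 * (\<integral>x. (W a x)\<^sup>2 \<partial>M)) at_top"
    using assms unfolding ms_null_def by (auto elim: eventually_elim2 intro: square_int_add_le)
  show "((\<lambda>a. 2 * (\<integral>x. (U a x)\<^sup>2 \<partial>M) + 2 * (\<integral>x. (W a x)\<^sup>2 \<partial>M)) \<longlongrightarrow> 0) at_top"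
    using assms unfolding ms_null_def by (auto intro!: tendsto_eq_intros)
qed

lemma ms_null_uminus: "ms_null U \<Longrightarrow> ms_null (\<lambda>a x. - U a x)"
  unfolding ms_null_def by (auto elim: eventually_mono intro: square_int_uminus)

lemma ms_null_cong:
  assumes "eventually (\<lambda>a. \<forall>x\<in>space M. U a x = W a x) at_top" "ms_null U"
  shows "ms_null W"
proof (rule ms_nullI[where b="\<lambda>a. \<integral>x. (U a x)\<^sup>2 \<partial>M"])
  have int_eq: "(\<integral>x. (W a x)\<^sup>2 \<partial>M) = (\<integral>x. (U a x)\<^sup>2 \<partial>M)" if "\<forall>x\<in>space M. U a x = W a x" for a
    using that by (intro Bochner_Integration.integral_cong) auto
  show "eventually (\<lambda>a. square_int (W a)) at_top"
    using assms(1) assms(2)[unfolded ms_null_def, THEN conjunct1]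
  proof eventually_elim
    fix a assume "\<forall>x\<in>space M. U a x = W a x" "square_int (U a)"
    then show "square_int (W a)"
      using measurable_cong[of M "U a" "W a" borel]
        Bochner_Integration.integrable_cong[of M M "\<lambda>x. (U a x)\<^sup>2" "\<lambda>x. (W a x)\<^sup>2"] by (simp add: square_int_def)
  qed
  show "eventually (\<lambda>a. (\<integral>x. (W a x)\<^sup>2 \<partial>M) \<le> (\<integral>x. (U a x)\<^sup>2 \<partial>M)) at_top"
    using assms(1) by eventually_elim (simp add: int_eq)
  show "((\<lambda>a. \<integral>x. (U a x)\<^sup>2 \<partial>M) \<longlongrightarrow> 0) at_top" using assms(2) by (simp add: ms_null_def)
qed

lemma second_moment_perturbation:
  assumes A: "eventually (\<lambda>a. square_int (A a)) at_top" and U: "ms_null U"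
    and B: "eventually (\<lambda>a. (\<integral>x. (A a x)\<^sup>2 \<partial>M) \<le> B) at_top"
  shows "((\<lambda>a. (\<integral>x. (A a x + U a x)\<^sup>2 \<partial>M) - (\<integral>x. (A a x)\<^sup>2 \<partial>M)) \<longlongrightarrow> 0) at_top"
proof (rule Lim_null_comparison)
  let ?u = "\<lambda>a. \<integral>x. (U a x)\<^sup>2 \<partial>M"
  have U0: "(?u \<longlongrightarrow> 0) at_top" and Ui: "eventually (\<lambda>a. square_int (U a)) at_top"
    using U by (auto simp: ms_null_def)
  show "((\<lambda>a. 2 * sqrt (\<bar>B\<bar> * ?u a) + ?u a) \<longlongrightarrow> 0) at_top"
    using U0 by (auto intro!: tendsto_eq_intros)
  show "eventually (\<lambda>a. norm ((\<integral>x. (A a x + U a x)\<^sup>2 \<partial>M) - (\<integral>x. (A a x)\<^sup>2 \<partial>M)) \<le> 2 * sqrt (\<bar>B\<bar> * ?u a) + ?u a) at_top"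
    using A Ui B
  proof eventually_elim
    case (elim a)
    have i: "integrable M (\<lambda>x. A a x * U a x)"
      using elim by (intro integrable_mult_of_squares) (auto simp: square_int_def)
    have "(\<integral>x. (A a x + U a x)\<^sup>2 \<partial>M) = (\<integral>x. (A a x)\<^sup>2 + (U a x)\<^sup>2 + 2 * (A a x * U a x) \<partial>M)"
      by (simp add: power2_sum mult.assoc)
    also have "\<dots> = (\<integral>x. (A a x)\<^sup>2 \<partial>M) + ?u a + 2 * (\<integral>x. A a x * U a x \<partial>M)"
      using elim i by (simp add: square_int_def)
    finally have "(\<integral>x. (A a x + U a x)\<^sup>2 \<partial>M) - (\<integral>x. (A a x)\<^sup>2 \<partial>M) = ?u a + 2 * (\<integral>x. A a x * U a x \<partial>M)" by simp
    moreover have "\<bar>\<integral>x. A a x * U a x \<partial>M\<bar> \<le> sqrt (\<bar>B\<bar> * ?u a)"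
    proof (rule real_le_rsqrt)
      have "(\<integral>x. A a x * U a x \<partial>M)\<^sup>2 \<le> (\<integral>x. (A a x)\<^sup>2 \<partial>M) * ?u a"
        using elim by (intro expectation_cauchy_schwarz) (auto simp: square_int_def)
      also have "\<dots> \<le> \<bar>B\<bar> * ?u a" using elim(3) by (intro mult_right_mono) auto
      finally show "\<bar>\<integral>x. A a x * U a x \<partial>M\<bar>\<^sup>2 \<le> \<bar>B\<bar> * ?u a" by simp
    qed
    moreover have "?u a \<ge> 0" by simp
    ultimately show ?case unfolding real_norm_def by linarith
  qed
qed

end


section \<open>The truncated observable in the scaling limit\<close>

text \<open>The order of magnitude \<open>a\<^sup>2 / ln a\<close> of the number of collisions.\<close>

definition area :: "real \<Rightarrow> real" where
  "area a = a * (a / ln a)"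

locale observable_chain = flight_chain \<Omega> S \<nu> \<eta> V \<rho> \<tau>
  for \<Omega> :: "'w measure" and S \<nu> :: "'a measure" and \<eta> V \<rho> \<tau> +
  fixes Z :: "'a \<Rightarrow> real" and r \<gamma> :: real
  assumes Z_measurable[measurable]: "Z \<in> borel_measurable S"
    and slowly_varying: "slowly_varying_observable \<nu> Z"
    and r_pos: "r > 0" and gamma: "\<gamma> > 1"
begin

abbreviation "moment \<equiv> nu.truncated_moment Z"

definition level :: "real \<Rightarrow> real" where
  "level a = a * r / ln a powr \<gamma>"

definition drift :: "real \<Rightarrow> real" where
  "drift a = (\<integral>v. truncate (level a) (Z v) \<partial>\<nu>)"

definition centered :: "real \<Rightarrow> 'a \<Rightarrow> real" where
  "centered a v = truncate (level a) (Z v) - drift a"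

text \<open>The number of terms of the Poisson series grows like \<open>ln a\<close>; this is where \<open>\<gamma> > 1\<close>
  makes the corrector \<open>o(a)\<close> uniformly.\<close>

definition depth :: "real \<Rightarrow> nat" where
  "depth a = nat \<lceil>ln a\<rceil>"

definition corrector :: "real \<Rightarrow> 'a \<Rightarrow> real" where
  "corrector a = poisson (centered a) (depth a)"

definition mart_var :: "real \<Rightarrow> real" where
  "mart_var a = (\<integral>v. cond_var (corrector a) v \<partial>\<nu>)"

definition clock :: "real \<Rightarrow> real \<Rightarrow> real" where
  "clock t a = area a * t"

definition steps :: "real \<Rightarrow> real \<Rightarrow> nat" where
  "steps t a = nat \<lfloor>clock t a / mean_flight\<rfloor>"

definition mart :: "real \<Rightarrow> real \<Rightarrow> 'w \<Rightarrow> real" where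
  "mart t a \<omega> = (\<Sum>j<steps t a. increment (corrector a) j \<omega>)"

abbreviation num :: "real \<Rightarrow> real \<Rightarrow> 'w \<Rightarrow> nat" where
  "num t a \<equiv> truncated_count (clock t a)"

lemma Z_measurable_nu[measurable]: "Z \<in> borel_measurable \<nu>"
  by simp

lemma Z_integrable: "integrable \<nu> Z" and Z_mean: "(\<integral>v. Z v \<partial>\<nu>) = 0"
  using slowly_varying by (auto simp: slowly_varying_observable_def)

lemma truncate_Z_bounded: "(\<lambda>v. truncate c (Z v)) \<in> bounded_measurable S"
  using nu.truncate_bounded_measurable[OF Z_measurable_nu] by (simp add: bounded_measurable_nu)

lemma moment_asymp: obtains C where "C > 0" "((\<lambda>a. moment a / ln a) \<longlongrightarrow> C) at_top"
proof -
  from slowly_varying obtain C where C: "C > 0"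
    "(\<lambda>a. \<integral>v. (Z v)\<^sup>2 * indicator {x. \<bar>x\<bar> \<le> a} (Z v) \<partial>\<nu>) \<sim>[at_top] (\<lambda>a. C * ln a)"
    by (auto simp: slowly_varying_observable_def)
  have "((\<lambda>a. moment a / ln a) \<longlongrightarrow> C) at_top"
    using asymp_equiv_ln_quotient[OF C(2,1)] by (simp add: nu.truncated_moment_def truncate_square)
  with C(1) show thesis by (rule that)
qed

lemma level_pos: "a > 1 \<Longrightarrow> level a > 0"
  using r_pos by (simp add: level_def)

lemma level_le: "eventually (\<lambda>a. level a \<le> a) at_top"
proof -
  have "((\<lambda>a. r / ln a powr \<gamma>) \<longlongrightarrow> 0) at_top" using gamma by real_asymp
  then have "eventually (\<lambda>a. r / ln a powr \<gamma> < 1) at_top" by (intro order_tendstoD(2)) auto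
  then show ?thesis using eventually_gt_at_top[of 0]
  proof eventually_elim
    case (elim a)
    have "a * (r / ln a powr \<gamma>) \<le> a * 1" using elim by (intro mult_left_mono) auto
    then show ?case by (simp add: level_def)
  qed
qed

lemma level_quotient: "((\<lambda>a. level a / a) \<longlongrightarrow> 0) at_top"
proof -
  have "((\<lambda>a. r / ln a powr \<gamma>) \<longlongrightarrow> 0) at_top" using gamma by real_asymp
  then show ?thesis
    by (rule Lim_transform_eventually)
       (use eventually_gt_at_top[of 0] in \<open>auto elim!: eventually_mono simp: level_def\<close>)
qed

lemma corrector_size: "((\<lambda>a. real (depth a) * (2 * level a) / a) \<longlongrightarrow> 0) at_top"
proof -
  have up: "((\<lambda>a. (ln a + 1) * 2 * (r / ln a powr \<gamma>)) \<longlongrightarrow> 0) at_top" using r_pos gamma by real_asymp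
  have ub: "eventually (\<lambda>a. real (depth a) * (2 * level a) / a \<le> (ln a + 1) * 2 * (r / ln a powr \<gamma>)) at_top"
    using eventually_gt_at_top[of 1]
  proof eventually_elim
    case (elim a)
    then have "ln a > 0" by simp
    then have "real (depth a) \<le> ln a + 1" unfolding depth_def by linarith
    then have "real (depth a) * (2 * (r / ln a powr \<gamma>)) \<le> (ln a + 1) * (2 * (r / ln a powr \<gamma>))"
      using r_pos by (intro mult_right_mono) auto
    then show ?case using elim by (simp add: level_def mult_ac)
  qed
  have lb: "eventually (\<lambda>a. 0 \<le> real (depth a) * (2 * level a) / a) at_top"
    using eventually_gt_at_top[of 1]
  proof eventually_elim
    case (elim a)
    then show ?case using level_pos[OF elim] by simp
  qed
  show ?thesis by (rule tendsto_sandwich[OF lb ub tendsto_const up])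
qed

text \<open>Replacing \<open>a\<close> by \<open>level a\<close> changes its logarithm only by a term of order \<open>ln (ln a)\<close>.\<close>

lemma level_moment_asymp:
  assumes C: "((\<lambda>a. moment a / ln a) \<longlongrightarrow> C) at_top"
  shows "((\<lambda>a. moment (level a) / ln a) \<longlongrightarrow> C) at_top"
proof -
  have lim: "filterlim level at_top at_top" unfolding level_def using r_pos gamma by real_asymp
  have "((\<lambda>a. ln (a * r / ln a powr \<gamma>) / ln a) \<longlongrightarrow> 1) at_top" using r_pos gamma by real_asymp
  then have "((\<lambda>a. moment (level a) / ln (level a) * (ln (level a) / ln a)) \<longlongrightarrow> C * 1) at_top"
    by (intro tendsto_mult filterlim_compose[OF C lim]) (simp add: level_def)
  moreover have "eventually (\<lambda>a. moment (level a) / ln (level a) * (ln (level a) / ln a) = moment (level a) / ln a) at_top"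
    using lim[THEN filterlim_at_top_dense[THEN iffD1], rule_format, of 1] by eventually_elim simp
  ultimately show ?thesis by (auto elim: Lim_transform_eventually)
qed

lemma centered_bounded: "centered a \<in> bounded_measurable S"
  unfolding centered_def[abs_def] by (intro bounded_measurable_intros truncate_Z_bounded)

lemma centered_mean: "(\<integral>v. centered a v \<partial>\<nu>) = 0"
  using truncate_Z_bounded by (simp add: centered_def integrable_nu drift_def)

lemma abs_drift_le_level: "a > 1 \<Longrightarrow> \<bar>drift a\<bar> \<le> level a"
proof -
  assume "a > 1"
  then have "level a \<ge> 0" using level_pos[of a] by simp
  have "\<bar>drift a\<bar> \<le> (\<integral>v. \<bar>truncate (level a) (Z v)\<bar> \<partial>\<nu>)" unfolding drift_def by (rule integral_abs_bound)
  also have "\<dots> \<le> (\<integral>v. level a \<partial>\<nu>)"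
    using \<open>level a \<ge> 0\<close> by (intro integral_mono integrable_nu bounded_measurable_abs truncate_Z_bounded bounded_measurable_const abs_truncate_le)
  finally show ?thesis by simp
qed

lemma abs_centered_le: "a > 1 \<Longrightarrow> \<bar>centered a v\<bar> \<le> 2 * level a"
  using abs_truncate_le[of "level a" "Z v"] abs_drift_le_level[of a] level_pos[of a]
  unfolding centered_def by linarith

lemma centered_square: "(\<integral>v. (centered a v)\<^sup>2 \<partial>\<nu>) \<le> moment (level a)"
  unfolding centered_def drift_def nu.truncated_moment_def
  by (rule integral_centered_square_le[OF truncate_Z_bounded])

lemma corrector_bounded: "corrector a \<in> bounded_measurable S"
  unfolding corrector_def by (rule poisson_bounded_measurable[OF centered_bounded])

lemma abs_corrector_le: "a > 1 \<Longrightarrow> v \<in> space S \<Longrightarrow> \<bar>corrector a v\<bar> \<le> real (depth a) * (2 * level a)"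
  unfolding corrector_def by (rule poisson_bound[OF centered_bounded abs_centered_le])

lemma mart_var_nonneg: "mart_var a \<ge> 0"
  unfolding mart_var_def by (intro integral_nonneg_AE AE_I2) (auto intro: cond_var_nonneg[OF corrector_bounded])

lemma mart_var_le: "mart_var a \<le> moment (level a) / (1 - \<rho>)\<^sup>2"
proof -
  have "mart_var a \<le> (\<integral>v. (corrector a v)\<^sup>2 \<partial>\<nu>)"
    unfolding mart_var_def by (rule integral_cond_var_le[OF corrector_bounded])
  also have "\<dots> \<le> (\<integral>v. (centered a v)\<^sup>2 \<partial>\<nu>) / (1 - \<rho>)\<^sup>2"
    unfolding corrector_def by (rule poisson_norm[OF centered_bounded centered_mean])
  also have "\<dots> \<le> moment (level a) / (1 - \<rho>)\<^sup>2"
    by (intro divide_right_mono centered_square) simp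
  finally show ?thesis .
qed

lemma mart_bounded: "mart t a \<in> bounded_measurable \<Omega>"
  unfolding mart_def[abs_def] by (rule martingale_bounded[OF corrector_bounded])

lemma clock_at_top: "t > 0 \<Longrightarrow> filterlim (clock t) at_top at_top"
  unfolding clock_def[abs_def] area_def by real_asymp

lemma area_pos: "a > 1 \<Longrightarrow> area a > 0"
  by (simp add: area_def)

lemma inverse_area: "((\<lambda>a. 1 / area a) \<longlongrightarrow> 0) at_top"
  unfolding area_def by real_asymp

lemma steps_bounds:
  assumes "a > 1" "t > 0"
  shows "real (steps t a) \<le> clock t a / mean_flight" "clock t a / mean_flight < real (steps t a) + 1"
proof -
  have "clock t a / mean_flight \<ge> 0"
    using area_pos[OF assms(1)] assms(2) mean_flight_pos by (simp add: clock_def)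
  then show "real (steps t a) \<le> clock t a / mean_flight" "clock t a / mean_flight < real (steps t a) + 1"
    unfolding steps_def by linarith+
qed

lemma steps_le_cap:
  assumes "a > 1" "t > 0"
  shows "steps t a \<le> cap (clock t a)"
proof -
  have T: "clock t a \<ge> 0" using area_pos[OF assms(1)] assms(2) by (simp add: clock_def)
  have "real (steps t a) \<le> clock t a / mean_flight" by (rule steps_bounds[OF assms])
  also have "\<dots> \<le> cap_rate * clock t a"
    using T decay_pos decay_less by (simp add: cap_rate_def distrib_right)
  also have "\<dots> \<le> real (nat \<lceil>cap_rate * clock t a\<rceil>)" by (rule real_nat_ceiling_ge)
  finally show ?thesis by (simp add: cap_def)
qed

lemma steps_quotient:
  assumes t: "t > 0"
  shows "((\<lambda>a. real (steps t a) / area a) \<longlongrightarrow> t / mean_flight) at_top"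
proof (rule tendsto_sandwich)
  show "eventually (\<lambda>a. t / mean_flight - 1 / area a \<le> real (steps t a) / area a) at_top"
    using eventually_gt_at_top[of 1]
  proof eventually_elim
    case (elim a)
    have "clock t a / mean_flight - 1 \<le> real (steps t a)" using steps_bounds(2)[OF elim t] by simp
    then have "(clock t a / mean_flight - 1) / area a \<le> real (steps t a) / area a"
      using area_pos[OF elim] by (intro divide_right_mono) auto
    then show ?case using area_pos[OF elim] by (simp add: clock_def diff_divide_distrib)
  qed
  show "eventually (\<lambda>a. real (steps t a) / area a \<le> t / mean_flight) at_top"
    using eventually_gt_at_top[of 1]
  proof eventually_elim
    case (elim a)
    have "real (steps t a) / area a \<le> (clock t a / mean_flight) / area a"
      using area_pos[OF elim] steps_bounds(1)[OF elim t] by (intro divide_right_mono) auto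
    then show ?case using area_pos[OF elim] by (simp add: clock_def)
  qed
  show "((\<lambda>a. t / mean_flight - 1 / area a) \<longlongrightarrow> t / mean_flight) at_top"
    using tendsto_diff[OF tendsto_const inverse_area] by simp
qed simp

lemma cap_quotient:
  assumes t: "t > 0"
  shows "eventually (\<lambda>a. real (cap (clock t a)) + 1 \<le> (cap_rate * t + 3 * (1 / area a)) * area a) at_top"
  using eventually_gt_at_top[of 1]
proof eventually_elim
  case (elim a)
  then have "clock t a \<ge> 0" using area_pos[OF elim] t by (simp add: clock_def)
  then show ?case using cap_bound[of "clock t a"] area_pos[OF elim] by (simp add: clock_def algebra_simps)
qed

lemma num_bounded: "(\<lambda>\<omega>. real (num t a \<omega>)) \<in> bounded_measurable \<Omega>"
  by (rule stopping_real_bounded_measurable[OF stopping_index_truncated_count])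

lemma num_le_cap: "\<omega> \<in> space \<Omega> \<Longrightarrow> num t a \<omega> \<le> cap (clock t a)"
  by (rule stopping_index_le[OF stopping_index_truncated_count])

lemma num_concentration:
  assumes t: "t > 0"
  shows "ms_null (\<lambda>a \<omega>. (real (num t a \<omega>) - real (steps t a)) / area a)"
proof (rule ms_null_cong[OF _ ms_null_add])
  let ?U = "\<lambda>a \<omega>. t * (real (num t a \<omega>) / clock t a - 1 / mean_flight)"
  let ?W = "\<lambda>a \<omega>. t / mean_flight - real (steps t a) / area a"
  show "ms_null ?U"
  proof (rule ms_nullI)
    show "eventually (\<lambda>a. square_int (?U a)) at_top"
      by (intro always_eventually allI square_int_bounded bounded_measurable_mult bounded_measurable_diff
          bounded_measurable_divide bounded_measurable_const num_bounded)
    show "eventually (\<lambda>a. (\<integral>\<omega>. (?U a \<omega>)\<^sup>2 \<partial>\<Omega>)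
        \<le> t\<^sup>2 * (\<integral>\<omega>. (real (num t a \<omega>) / clock t a - 1 / mean_flight)\<^sup>2 \<partial>\<Omega>)) at_top"
      by (simp add: power_mult_distrib)
    have "((\<lambda>a. t\<^sup>2 * (\<integral>\<omega>. (real (num t a \<omega>) / clock t a - 1 / mean_flight)\<^sup>2 \<partial>\<Omega>)) \<longlongrightarrow> t\<^sup>2 * 0) at_top"
      by (intro tendsto_mult tendsto_const filterlim_compose[OF truncated_count_L2 clock_at_top[OF t]])
    then show "((\<lambda>a. t\<^sup>2 * (\<integral>\<omega>. (real (num t a \<omega>) / clock t a - 1 / mean_flight)\<^sup>2 \<partial>\<Omega>)) \<longlongrightarrow> 0) at_top" by simp
  qed
  show "ms_null ?W"
  proof (rule ms_null_bounded)
    show "((\<lambda>a. \<bar>t / mean_flight - real (steps t a) / area a\<bar>) \<longlongrightarrow> 0) at_top"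
      using tendsto_rabs[OF tendsto_diff[OF tendsto_const steps_quotient[OF t], of "t / mean_flight"]] by simp
  qed auto
  show "eventually (\<lambda>a. \<forall>\<omega>\<in>space \<Omega>. ?U a \<omega> + ?W a \<omega> = (real (num t a \<omega>) - real (steps t a)) / area a) at_top"
    using eventually_gt_at_top[of 1]
  proof eventually_elim
    case (elim a)
    then show ?case using t area_pos[OF elim] by (auto simp: clock_def field_simps)
  qed
qed

lemma num_concentration_L1:
  assumes t: "t > 0"
  shows "((\<lambda>a. (\<integral>\<omega>. \<bar>real (num t a \<omega>) - real (steps t a)\<bar> \<partial>\<Omega>) / area a) \<longlongrightarrow> 0) at_top"
proof (rule tendsto_sandwich[OF _ _ tendsto_const])
  let ?e = "\<lambda>a. \<integral>\<omega>. ((real (num t a \<omega>) - real (steps t a)) / area a)\<^sup>2 \<partial>\<Omega>"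
  show "((\<lambda>a. sqrt (?e a)) \<longlongrightarrow> 0) at_top"
    using tendsto_real_sqrt[of ?e 0 at_top] num_concentration[OF t] by (simp add: ms_null_def)
  show "eventually (\<lambda>a. 0 \<le> (\<integral>\<omega>. \<bar>real (num t a \<omega>) - real (steps t a)\<bar> \<partial>\<Omega>) / area a) at_top"
    using eventually_gt_at_top[of 1] by eventually_elim (auto intro!: divide_nonneg_nonneg dest: area_pos)
  show "eventually (\<lambda>a. (\<integral>\<omega>. \<bar>real (num t a \<omega>) - real (steps t a)\<bar> \<partial>\<Omega>) / area a \<le> sqrt (?e a)) at_top"
    using eventually_gt_at_top[of 1]
  proof eventually_elim
    case (elim a)
    have b: "(\<lambda>\<omega>. (real (num t a \<omega>) - real (steps t a)) / area a) \<in> bounded_measurable \<Omega>"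
      by (intro bounded_measurable_divide bounded_measurable_diff bounded_measurable_const num_bounded)
    have "(\<integral>\<omega>. \<bar>real (num t a \<omega>) - real (steps t a)\<bar> \<partial>\<Omega>) / area a = (\<integral>\<omega>. \<bar>(real (num t a \<omega>) - real (steps t a)) / area a\<bar> \<partial>\<Omega>)"
      using area_pos[OF elim] by simp
    also have "\<dots> \<le> sqrt (?e a)"
      by (intro expectation_abs_le_sqrt bounded_measurable_measurable bounded_measurable_integrable bounded_measurable_power b)
    finally show ?case .
  qed
qed

text \<open>Every quantity in \<open>stopped_sum_approximation\<close> is normalised by its order of magnitude: \<open>area a\<close>
  for counts, \<open>ln a\<close> for second moments and \<open>a\<close> for the corrector. Their product
  \<open>area a * ln a = a\<^sup>2\<close> is the square of the scale of the sum.\<close>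

lemma centered_sum_approximation:
  assumes t: "t > 0"
  shows "ms_null (\<lambda>a \<omega>. ((\<Sum>j<num t a \<omega>. centered a (V j \<omega>)) - mart t a \<omega>) / a)"
proof -
  obtain C where C: "C > 0" "((\<lambda>a. moment a / ln a) \<longlongrightarrow> C) at_top" by (rule moment_asymp)
  define R where "R a = moment (level a) / ln a" for a
  define d where "d a = (\<integral>\<omega>. \<bar>real (num t a \<omega>) - real (steps t a)\<bar> \<partial>\<Omega>) / area a" for a
  define k where "k a = real (depth a) * (2 * level a) / a" for a
  define l where "l a = cap_rate * t + 3 * (1 / area a)" for a
  define v where "v a = R a / (1 - \<rho>)\<^sup>2" for a
  define b where "b a = 3 * (v a * d a + 2 * sqrt (gap_const * l a * ((k a)\<^sup>2 * v a))) + 12 * (k a)\<^sup>2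
      + 3 * (gap_const * l a * ((\<rho> ^ depth a)\<^sup>2 * R a))" for a
  have R: "(R \<longlongrightarrow> C) at_top" unfolding R_def by (rule level_moment_asymp[OF C(2)])
  have d: "(d \<longlongrightarrow> 0) at_top" unfolding d_def by (rule num_concentration_L1[OF t])
  have k: "(k \<longlongrightarrow> 0) at_top" unfolding k_def by (rule corrector_size)
  have l: "(l \<longlongrightarrow> cap_rate * t) at_top"
    unfolding l_def using tendsto_add[OF tendsto_const tendsto_mult[OF tendsto_const inverse_area]] by fastforce
  have v: "(v \<longlongrightarrow> C / (1 - \<rho>)\<^sup>2) at_top" unfolding v_def using R rho_less by (intro tendsto_divide tendsto_const) auto
  have "filterlim depth at_top at_top" unfolding depth_def[abs_def] by real_asymp
  then have rho: "((\<lambda>a. \<rho> ^ depth a) \<longlongrightarrow> 0) at_top"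
    using rho_pos rho_less by (intro filterlim_compose[OF LIMSEQ_power_zero]) auto
  have "(b \<longlongrightarrow> 3 * (C / (1 - \<rho>)\<^sup>2 * 0 + 2 * sqrt (gap_const * (cap_rate * t) * (0\<^sup>2 * (C / (1 - \<rho>)\<^sup>2)))) + 12 * 0\<^sup>2
      + 3 * (gap_const * (cap_rate * t) * (0\<^sup>2 * C))) at_top"
    unfolding b_def by (intro tendsto_intros R d k l v rho)
  then have b0: "(b \<longlongrightarrow> 0) at_top" by simp
  show ?thesis
  proof (rule ms_nullI[OF _ _ b0])
    have bm: "(\<lambda>\<omega>. (\<Sum>j<num t a \<omega>. centered a (V j \<omega>)) - mart t a \<omega>) \<in> bounded_measurable \<Omega>" for a
      by (intro bounded_measurable_diff mart_bounded stopped_sum_V_bounded_measurable[OF stopping_index_truncated_count] centered_bounded)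
    then show "eventually (\<lambda>a. square_int (\<lambda>\<omega>. ((\<Sum>j<num t a \<omega>. centered a (V j \<omega>)) - mart t a \<omega>) / a)) at_top"
      by (intro always_eventually allI square_int_bounded bounded_measurable_divide)
    show "eventually (\<lambda>a. (\<integral>\<omega>. (((\<Sum>j<num t a \<omega>. centered a (V j \<omega>)) - mart t a \<omega>) / a)\<^sup>2 \<partial>\<Omega>) \<le> b a) at_top"
      using eventually_gt_at_top[of 1] cap_quotient[OF t]
    proof eventually_elim
      case (elim a)
      let ?B = "2 * level a"
      let ?L = "real (cap (clock t a)) + 1"
      let ?x = "\<integral>v. (centered a v)\<^sup>2 \<partial>\<nu>"
      have a: "a > 0" "ln a > 0" "area a > 0" using elim area_pos by auto
      have aa: "area a * ln a = a\<^sup>2" using a by (simp add: area_def power2_eq_square)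
      have R_eq: "moment (level a) = R a * ln a" using a by (simp add: R_def)
      have R0: "R a \<ge> 0" using a by (simp add: R_def nu.truncated_moment_nonneg)
      have v0: "v a \<ge> 0" using R0 by (simp add: v_def)
      have L: "?L \<le> l a * area a" using elim(2) by (simp add: l_def)
      have l0: "l a \<ge> 0" using a t cap_rate_pos by (simp add: l_def)
      have s: "mart_var a \<le> v a * ln a" using mart_var_le[of a] by (simp add: R_eq v_def)
      have x: "?x \<le> R a * ln a" using centered_square[of a] R_eq by simp
      have kB: "real (depth a) * ?B = k a * a" using a by (simp add: k_def)
      have "(\<integral>\<omega>. ((\<Sum>j<num t a \<omega>. centered a (V j \<omega>)) - mart t a \<omega>)\<^sup>2 \<partial>\<Omega>)
        \<le> 3 * (mart_var a * (\<integral>\<omega>. \<bar>real (num t a \<omega>) - real (steps t a)\<bar> \<partial>\<Omega>)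
            + 2 * sqrt (gap_const * ?L * ((real (depth a) * ?B)\<^sup>2 * mart_var a)))
          + 12 * (real (depth a) * ?B)\<^sup>2 + 3 * (gap_const * ?L * ((\<rho> ^ depth a)\<^sup>2 * ?x))"
        unfolding mart_def corrector_def mart_var_def
        by (rule stopped_sum_approximation[OF stopping_index_truncated_count steps_le_cap[OF elim(1) t]
            centered_bounded centered_mean abs_centered_le[OF elim(1)]])
      also have "\<dots> \<le> 3 * (v a * ln a * (d a * area a)
            + 2 * sqrt (gap_const * (l a * area a) * ((k a * a)\<^sup>2 * (v a * ln a))))
          + 12 * (k a * a)\<^sup>2 + 3 * (gap_const * (l a * area a) * ((\<rho> ^ depth a)\<^sup>2 * (R a * ln a)))"
        unfolding kB
      proof (intro add_mono mult_left_mono order_refl mult_mono real_sqrt_le_mono s L x)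
        show "(\<integral>\<omega>. \<bar>real (num t a \<omega>) - real (steps t a)\<bar> \<partial>\<Omega>) \<le> d a * area a"
          using a by (simp add: d_def)
      qed (use a gap_const_pos l0 v0 R0 mart_var_nonneg rho_pos in auto)
      also have "\<dots> = b a * a\<^sup>2"
      proof -
        have e1: "sqrt (gap_const * (l a * area a) * ((k a * a)\<^sup>2 * (v a * ln a))) = sqrt (gap_const * l a * ((k a)\<^sup>2 * v a)) * a\<^sup>2"
        proof -
          have "gap_const * (l a * area a) * ((k a * a)\<^sup>2 * (v a * ln a))
            = gap_const * l a * ((k a)\<^sup>2 * v a) * ((area a * ln a) * a\<^sup>2)" by (simp add: power_mult_distrib)
          also have "\<dots> = gap_const * l a * ((k a)\<^sup>2 * v a) * (a\<^sup>2)\<^sup>2"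
            unfolding aa by (simp only: power2_eq_square[of "a\<^sup>2"])
          finally have eq: "gap_const * (l a * area a) * ((k a * a)\<^sup>2 * (v a * ln a))
            = gap_const * l a * ((k a)\<^sup>2 * v a) * (a\<^sup>2)\<^sup>2" .
          have "sqrt (x * (a\<^sup>2)\<^sup>2) = sqrt x * a\<^sup>2" for x
            unfolding real_sqrt_mult real_sqrt_abs abs_power2 by (rule refl)
          then show ?thesis unfolding eq .
        qed
        have e2: "v a * ln a * (d a * area a) = v a * d a * a\<^sup>2"
          unfolding aa[symmetric] by simp
        have e3: "gap_const * (l a * area a) * ((\<rho> ^ depth a)\<^sup>2 * (R a * ln a))
            = gap_const * l a * ((\<rho> ^ depth a)\<^sup>2 * R a) * a\<^sup>2"
          unfolding aa[symmetric] by simp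
        show ?thesis unfolding e1 e2 e3 b_def by (simp add: power_mult_distrib algebra_simps)
      qed
      finally show ?case using a by (simp add: power_divide pos_divide_le_eq)
    qed
  qed
qed

text \<open>Between the levels \<open>level a\<close> and \<open>a\<close> the second moment is \<open>o(ln a)\<close>, because
  \<open>ln (level a) \<sim> ln a\<close>; and the mean at level \<open>a\<close> is \<open>o(ln a / a)\<close>.\<close>

lemma full_sum_approximation:
  assumes t: "t > 0"
  shows "ms_null (\<lambda>a \<omega>. ((\<Sum>j<num t a \<omega>. truncate a (Z (V j \<omega>))) - mart t a \<omega>) / a)"
proof -
  obtain C where C: "C > 0" "((\<lambda>a. moment a / ln a) \<longlongrightarrow> C) at_top" by (rule moment_asymp)
  define e where "e a = (\<integral>v. truncate a (Z v) \<partial>\<nu>)" for a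
  define W where "W a v = truncate a (Z v) - truncate (level a) (Z v) - (e a - drift a)" for a v
  define l where "l a = cap_rate * t + 3 * (1 / area a)" for a
  have l: "(l \<longlongrightarrow> cap_rate * t) at_top"
    unfolding l_def using tendsto_add[OF tendsto_const tendsto_mult[OF tendsto_const inverse_area]] by fastforce
  have Wb: "W a \<in> bounded_measurable S" for a
    unfolding W_def[abs_def] by (intro bounded_measurable_diff bounded_measurable_const truncate_Z_bounded)
  have W0: "(\<integral>v. W a v \<partial>\<nu>) = 0" for a
    unfolding W_def e_def drift_def using truncate_Z_bounded by (simp add: integrable_nu)
  have 1: "ms_null (\<lambda>a \<omega>. (\<Sum>j<num t a \<omega>. W a (V j \<omega>)) / a)"
  proof (rule ms_nullI)
    show "eventually (\<lambda>a. square_int (\<lambda>\<omega>. (\<Sum>j<num t a \<omega>. W a (V j \<omega>)) / a)) at_top"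
      by (intro always_eventually allI square_int_bounded bounded_measurable_divide
          stopped_sum_V_bounded_measurable[OF stopping_index_truncated_count] Wb)
    have "((\<lambda>a. gap_const * l a * (moment a / ln a - moment (level a) / ln a)) \<longlongrightarrow> gap_const * (cap_rate * t) * (C - C)) at_top"
      by (intro tendsto_intros l C level_moment_asymp)
    then show "((\<lambda>a. gap_const * l a * (moment a / ln a - moment (level a) / ln a)) \<longlongrightarrow> 0) at_top" by simp
    show "eventually (\<lambda>a. (\<integral>\<omega>. ((\<Sum>j<num t a \<omega>. W a (V j \<omega>)) / a)\<^sup>2 \<partial>\<Omega>)
        \<le> gap_const * l a * (moment a / ln a - moment (level a) / ln a)) at_top"
      using eventually_gt_at_top[of 1] cap_quotient[OF t] level_le
    proof eventually_elim
      case (elim a)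
      have a: "a > 0" "ln a > 0" "area a > 0" using elim area_pos by auto
      have aa: "area a * ln a = a\<^sup>2" using a by (simp add: area_def power2_eq_square)
      have "(\<integral>v. (W a v)\<^sup>2 \<partial>\<nu>) \<le> (\<integral>v. (truncate a (Z v) - truncate (level a) (Z v))\<^sup>2 \<partial>\<nu>)"
      proof -
        have "(\<integral>v. truncate a (Z v) - truncate (level a) (Z v) \<partial>\<nu>) = e a - drift a"
          unfolding e_def drift_def using truncate_Z_bounded by (simp add: integrable_nu)
        then show ?thesis
          unfolding W_def
          using integral_centered_square_le[OF bounded_measurable_diff[OF truncate_Z_bounded[of a] truncate_Z_bounded[of "level a"]]] by simp
      qed
      also have "\<dots> = moment a - moment (level a)"
        by (rule nu.integral_truncate_difference_square[OF Z_measurable_nu elim(3)])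
      finally have W2: "(\<integral>v. (W a v)\<^sup>2 \<partial>\<nu>) \<le> moment a - moment (level a)" .
      have "(\<integral>\<omega>. (\<Sum>j<num t a \<omega>. W a (V j \<omega>))\<^sup>2 \<partial>\<Omega>) \<le> gap_const * (real (cap (clock t a)) + 1) * (\<integral>v. (W a v)\<^sup>2 \<partial>\<nu>)"
        by (rule stopped_sum_square_le[OF stopping_index_truncated_count Wb W0])
      also have "\<dots> \<le> gap_const * (l a * area a) * (moment a - moment (level a))"
        using elim(2) W2 gap_const_pos a t cap_rate_pos
        by (intro mult_mono mult_left_mono) (auto simp: l_def)
      also have "\<dots> = gap_const * l a * (moment a / ln a - moment (level a) / ln a) * (area a * ln a)"
        using a by (simp add: diff_divide_distrib[symmetric])
      finally show ?case unfolding aa using a by (simp add: power_divide pos_divide_le_eq)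
    qed
  qed
  have 2: "ms_null (\<lambda>a \<omega>. real (num t a \<omega>) * e a / a)"
  proof (rule ms_null_bounded)
    show "eventually (\<lambda>a. (\<lambda>\<omega>. real (num t a \<omega>) * e a / a) \<in> borel_measurable \<Omega>) at_top" by simp
    have "((\<lambda>a. l a * (nu.tail_moment Z a * a / ln a)) \<longlongrightarrow> cap_rate * t * 0) at_top"
      by (intro tendsto_mult l nu.tail_moment_asymp[OF Z_integrable C(2)])
    then show "((\<lambda>a. l a * (nu.tail_moment Z a * a / ln a)) \<longlongrightarrow> 0) at_top" by simp
    show "eventually (\<lambda>a. \<forall>\<omega>\<in>space \<Omega>. \<bar>real (num t a \<omega>) * e a / a\<bar> \<le> l a * (nu.tail_moment Z a * a / ln a)) at_top"
      using eventually_gt_at_top[of 1] cap_quotient[OF t]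
    proof eventually_elim
      case (elim a)
      have a: "a > 0" "ln a > 0" "area a > 0" using elim area_pos by auto
      show ?case
      proof
        fix \<omega> assume "\<omega> \<in> space \<Omega>"
        then have "real (num t a \<omega>) \<le> l a * area a" using num_le_cap[of \<omega> t a] elim(2) by (simp add: l_def)
        moreover have "\<bar>e a\<bar> \<le> nu.tail_moment Z a" unfolding e_def by (rule nu.mean_truncate_le[OF Z_integrable Z_mean])
        ultimately have "real (num t a \<omega>) * \<bar>e a\<bar> \<le> l a * area a * nu.tail_moment Z a"
          by (intro mult_mono) (auto intro: order_trans)
        then have "real (num t a \<omega>) * \<bar>e a\<bar> / a \<le> l a * area a * nu.tail_moment Z a / a"
          using a by (intro divide_right_mono) auto
        also have "\<dots> = l a * (nu.tail_moment Z a * a / ln a)" using a by (simp add: area_def)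
        finally show "\<bar>real (num t a \<omega>) * e a / a\<bar> \<le> l a * (nu.tail_moment Z a * a / ln a)"
          using a by (simp add: abs_mult)
      qed
    qed
  qed
  have "ms_null (\<lambda>a \<omega>. ((\<Sum>j<num t a \<omega>. centered a (V j \<omega>)) - mart t a \<omega>) / a
      + ((\<Sum>j<num t a \<omega>. W a (V j \<omega>)) / a + real (num t a \<omega>) * e a / a))"
    by (intro ms_null_add centered_sum_approximation t 1 2)
  moreover have "((\<Sum>j<N. centered a (V j \<omega>)) - mart t a \<omega>) / a + ((\<Sum>j<N. W a (V j \<omega>)) / a + real N * e a / a)
      = ((\<Sum>j<N. truncate a (Z (V j \<omega>))) - mart t a \<omega>) / a" for a \<omega> N
    by (simp add: centered_def W_def sum_subtractf sum.distrib add_divide_distrib[symmetric] algebra_simps)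
  ultimately show ?thesis by simp
qed

lemma count_sum_measurable[measurable (raw)]:
  assumes [measurable]: "\<And>j. x j \<in> borel_measurable \<Omega>"
  shows "(\<lambda>\<omega>. \<Sum>j<count T \<omega>. (x j \<omega> :: real)) \<in> borel_measurable \<Omega>"
  by (rule measurable_compose_countable[of "\<lambda>k \<omega>. \<Sum>j<k. x j \<omega>"]) measurable

lemma count_sum_Suc_measurable[measurable (raw)]:
  assumes [measurable]: "\<And>j. x j \<in> borel_measurable \<Omega>"
  shows "(\<lambda>\<omega>. \<Sum>j\<le>count T \<omega>. (x j \<omega> :: real)) \<in> borel_measurable \<Omega>"
  by (rule measurable_compose_countable[of "\<lambda>k \<omega>. \<Sum>j\<le>k. x j \<omega>"]) measurable

text \<open>Beyond the cap the crude bound \<open>\<bar>f\<bar> \<le> a\<close> is enough, since the second moment of the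
  count is exponentially small there.\<close>

lemma count_sum_truncation:
  assumes t: "t > 0" and f: "\<And>a. f a \<in> bounded_measurable S"
    and fa: "eventually (\<lambda>a. \<forall>v\<in>space S. \<bar>f a v\<bar> \<le> a) at_top"
  shows "ms_null (\<lambda>a \<omega>. ((\<Sum>j<count (clock t a) \<omega>. f a (V j \<omega>)) - (\<Sum>j<num t a \<omega>. f a (V j \<omega>))) / a)"
proof (rule ms_nullI)
  let ?U = "\<lambda>a \<omega>. ((\<Sum>j<count (clock t a) \<omega>. f a (V j \<omega>)) - (\<Sum>j<num t a \<omega>. f a (V j \<omega>))) / a"
  let ?E = "\<lambda>T. {\<omega> \<in> space \<Omega>. arrival (cap T) \<omega> \<le> T}"
  let ?b = "\<lambda>T. 2 * (tail_const * exp (- T)) + 2 * (cap_rate * T + 2)\<^sup>2 * (tail_const * exp (- T))"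
  have meas: "?U a \<in> borel_measurable \<Omega>" for a
  proof -
    have [measurable]: "f a \<in> borel_measurable S" by (rule bounded_measurable_measurable[OF f])
    have [measurable]: "(\<lambda>\<omega>. \<Sum>j<num t a \<omega>. f a (V j \<omega>)) \<in> borel_measurable \<Omega>"
      by (intro bounded_measurable_measurable stopped_sum_V_bounded_measurable[OF stopping_index_truncated_count] f)
    show ?thesis by measurable
  qed
  have bound: "integrable \<Omega> (\<lambda>\<omega>. (?U a \<omega>)\<^sup>2) \<and> (\<integral>\<omega>. (?U a \<omega>)\<^sup>2 \<partial>\<Omega>) \<le> ?b (clock t a)"
    if a: "a > 1" and fa: "\<forall>v\<in>space S. \<bar>f a v\<bar> \<le> a" for a
  proof -
    define T where "T = clock t a"
    have T: "T \<ge> 0" using area_pos[OF a] t by (simp add: T_def clock_def)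
    let ?N = "\<lambda>\<omega>. real (count T \<omega>)"
    let ?D = "\<lambda>\<omega>. 2 * ((?N \<omega> + 1)\<^sup>2 * indicator (?E T) \<omega>) + 2 * (real (cap T))\<^sup>2 * indicator (?E T) \<omega>"
    have iD: "integrable \<Omega> ?D"
      by (intro Bochner_Integration.integrable_add integrable_mult_right count_square_tail(1)[OF T] integrable_real_indicator)
         (auto simp: less_top[symmetric])
    have pt: "(?U a \<omega>)\<^sup>2 \<le> ?D \<omega>" if \<omega>: "\<omega> \<in> space \<Omega>" for \<omega>
    proof (cases "T < arrival (cap T) \<omega>")
      case True
      then show ?thesis
        using count_eq_capped_count[OF \<omega> True] by (simp add: truncated_count_def T_def)
    next
      case False
      have S: "\<bar>\<Sum>j<N. f a (V j \<omega>)\<bar> \<le> real N * a" for N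
        using order_trans[OF sum_abs sum_mono[where g="\<lambda>_. a"], of "{..<N}" "\<lambda>j. f a (V j \<omega>)"] fa measurable_space[OF V_measurable \<omega>] by simp
      have "\<bar>(\<Sum>j<count T \<omega>. f a (V j \<omega>)) - (\<Sum>j<num t a \<omega>. f a (V j \<omega>))\<bar> \<le> ?N \<omega> * a + real (num t a \<omega>) * a"
        using S[of "count T \<omega>"] S[of "num t a \<omega>"] by linarith
      also have "\<dots> \<le> (?N \<omega> + 1) * a + real (cap T) * a"
        using num_le_cap[OF \<omega>, of t a] a by (intro add_mono mult_right_mono) (auto simp: T_def)
      finally have "\<bar>?U a \<omega>\<bar> \<le> (?N \<omega> + 1) + real (cap T)"
        using a by (simp add: T_def pos_divide_le_eq distrib_right)
      then have "(?U a \<omega>)\<^sup>2 \<le> ((?N \<omega> + 1) + real (cap T))\<^sup>2"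
        using power_mono[of "\<bar>?U a \<omega>\<bar>" _ 2] by (simp only: power2_abs abs_ge_zero)
      also have "\<dots> \<le> 2 * (?N \<omega> + 1)\<^sup>2 + 2 * (real (cap T))\<^sup>2" by (rule power2_sum2_le)
      finally show ?thesis using False \<omega> by (simp add: indicator_def)
    qed
    have i: "integrable \<Omega> (\<lambda>\<omega>. (?U a \<omega>)\<^sup>2)"
    proof (rule Bochner_Integration.integrable_bound[OF iD])
      show "(\<lambda>\<omega>. (?U a \<omega>)\<^sup>2) \<in> borel_measurable \<Omega>" using meas[of a] by (rule borel_measurable_power)
      show "AE \<omega> in \<Omega>. norm ((?U a \<omega>)\<^sup>2) \<le> norm (?D \<omega>)"
      proof (rule AE_I2)
        fix \<omega> assume "\<omega> \<in> space \<Omega>"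
        then have "(?U a \<omega>)\<^sup>2 \<le> ?D \<omega>" by (rule pt)
        then show "norm ((?U a \<omega>)\<^sup>2) \<le> norm (?D \<omega>)" by simp
      qed
    qed
    have "(\<integral>\<omega>. (?U a \<omega>)\<^sup>2 \<partial>\<Omega>) \<le> (\<integral>\<omega>. ?D \<omega> \<partial>\<Omega>)" by (rule integral_mono[OF i iD pt])
    also have "\<dots> = 2 * (\<integral>\<omega>. (?N \<omega> + 1)\<^sup>2 * indicator (?E T) \<omega> \<partial>\<Omega>) + 2 * (real (cap T))\<^sup>2 * prob (?E T)"
    proof -
      have "integrable \<Omega> (\<lambda>\<omega>. indicator (?E T) \<omega> :: real)"
        by (intro integrable_real_indicator) (auto simp: less_top[symmetric])
      then show ?thesis
        using count_square_tail(1)[OF T] by (subst Bochner_Integration.integral_add) auto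
    qed
    also have "\<dots> \<le> 2 * (tail_const * exp (- T)) + 2 * (cap_rate * T + 2)\<^sup>2 * (tail_const * exp (- T))"
      using cap_bound[OF T] count_square_tail(2)[OF T] prob_cap_exceeded[OF T]
      by (intro add_mono mult_left_mono mult_mono power_mono) auto
    finally show ?thesis using i by (simp add: T_def)
  qed
  show "eventually (\<lambda>a. square_int (?U a)) at_top"
    using fa eventually_gt_at_top[of 1] by eventually_elim (auto simp: square_int_def meas bound)
  show "eventually (\<lambda>a. (\<integral>\<omega>. (?U a \<omega>)\<^sup>2 \<partial>\<Omega>) \<le> ?b (clock t a)) at_top"
    using fa eventually_gt_at_top[of 1] by eventually_elim (use bound in blast)
  have "(?b \<longlongrightarrow> 0) at_top"
  proof -
    have 1: "((\<lambda>T. exp (- T)) \<longlongrightarrow> (0::real)) at_top" by real_asymp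
    have "((\<lambda>T. (c * T + 2)\<^sup>2 * exp (- T)) \<longlongrightarrow> 0) at_top" if "c > 0" for c :: real
      using that by real_asymp
    from this[OF cap_rate_pos] have 2: "((\<lambda>T. (cap_rate * T + 2)\<^sup>2 * exp (- T)) \<longlongrightarrow> 0) at_top" .
    have "((\<lambda>T. 2 * tail_const * exp (- T) + 2 * tail_const * ((cap_rate * T + 2)\<^sup>2 * exp (- T)))
        \<longlongrightarrow> 2 * tail_const * 0 + 2 * tail_const * 0) at_top"
      by (intro tendsto_intros 1 2)
    then show ?thesis by (simp add: mult_ac)
  qed
  then show "((\<lambda>a. ?b (clock t a)) \<longlongrightarrow> 0) at_top"
    by (rule filterlim_compose[OF _ clock_at_top[OF t]])
qed

end


section \<open>Limit variance and limit law\<close>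

lemma one_minus_power_tendsto_exp:
  fixes w :: "real \<Rightarrow> real" and m :: "real \<Rightarrow> nat"
  assumes w0: "eventually (\<lambda>a. 0 \<le> w a) at_top" and w: "(w \<longlongrightarrow> 0) at_top"
    and mw: "((\<lambda>a. real (m a) * w a) \<longlongrightarrow> c) at_top"
  shows "((\<lambda>a. (1 - w a) ^ m a) \<longlongrightarrow> exp (- c)) at_top"
proof -
  have small: "eventually (\<lambda>a. w a < 1 / 2) at_top" using w by (intro order_tendstoD(2)) auto
  have "((\<lambda>a. real (m a) * ln (1 - w a)) \<longlongrightarrow> - c) at_top"
  proof (rule tendsto_sandwich)
    show "eventually (\<lambda>a. - (real (m a) * w a) - 2 * (real (m a) * w a) * w a \<le> real (m a) * ln (1 - w a)) at_top"
      using w0 small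
    proof eventually_elim
      case (elim a)
      have "real (m a) * (- w a - 2 * (w a)\<^sup>2) \<le> real (m a) * ln (1 - w a)"
        using elim by (intro mult_left_mono ln_one_minus_pos_lower_bound) auto
      then show ?case by (simp add: power2_eq_square algebra_simps)
    qed
    show "eventually (\<lambda>a. real (m a) * ln (1 - w a) \<le> - (real (m a) * w a)) at_top"
      using w0 small
    proof eventually_elim
      case (elim a)
      have "real (m a) * ln (1 - w a) \<le> real (m a) * (- w a)"
        using elim by (intro mult_left_mono ln_one_minus_pos_upper_bound) auto
      then show ?case by simp
    qed
    show "((\<lambda>a. - (real (m a) * w a) - 2 * (real (m a) * w a) * w a) \<longlongrightarrow> - c) at_top"
      using tendsto_diff[OF tendsto_minus[OF mw] tendsto_mult[OF tendsto_mult[OF tendsto_const mw] w, of 2]] by simp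
    show "((\<lambda>a. - (real (m a) * w a)) \<longlongrightarrow> - c) at_top" by (rule tendsto_minus[OF mw])
  qed
  then have "((\<lambda>a. exp (real (m a) * ln (1 - w a))) \<longlongrightarrow> exp (- c)) at_top" by (rule tendsto_exp)
  moreover have "eventually (\<lambda>a. exp (real (m a) * ln (1 - w a)) = (1 - w a) ^ m a) at_top"
    using small by eventually_elim (simp add: exp_of_nat_mult)
  ultimately show ?thesis by (rule Lim_transform_eventually)
qed

lemma eventually_bounded_of_tendsto:
  fixes f :: "real \<Rightarrow> real"
  assumes "(f \<longlongrightarrow> l) at_top"
  shows "eventually (\<lambda>a. f a \<le> l + 1) at_top"
  using order_tendstoD(2)[OF assms, of "l + 1"] by (auto elim: eventually_mono)

lemma norm_iexp_diff_le: "cmod (iexp x - iexp y) \<le> \<bar>x - y\<bar>"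
proof -
  have "iexp x - iexp y = iexp y * (iexp (x - y) - 1)"
    by (simp add: right_diff_distrib exp_add[symmetric])
  then have "cmod (iexp x - iexp y) = cmod (iexp (x - y) - 1)" by (simp add: norm_mult)
  also have "\<dots> \<le> \<bar>x - y\<bar>" using iexp_approx1[of "x - y" 0] by simp
  finally show ?thesis .
qed

context observable_chain
begin

text \<open>The martingale variance per unit time: there are \<open>area a / mean_flight\<close> steps per unit time,
  and sums are divided by \<open>a\<close>.\<close>

definition asymp_var :: "real \<Rightarrow> real" where
  "asymp_var a = mart_var a / (mean_flight * ln a)"

lemma mart_square: "(\<integral>\<omega>. (mart t a \<omega>)\<^sup>2 \<partial>\<Omega>) = real (steps t a) * mart_var a"
  unfolding mart_def mart_var_def by (rule expectation_martingale_square[OF corrector_bounded])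

lemma mart_mean: "(\<integral>\<omega>. mart t a \<omega> \<partial>\<Omega>) = 0"
  unfolding mart_def by (rule expectation_martingale[OF corrector_bounded])

lemma mart_var_quotient_bounded: obtains B where "eventually (\<lambda>a. mart_var a / ln a \<le> B) at_top"
proof -
  obtain C where C: "C > 0" "((\<lambda>a. moment a / ln a) \<longlongrightarrow> C) at_top" by (rule moment_asymp)
  have "((\<lambda>a. moment (level a) / ln a / (1 - \<rho>)\<^sup>2) \<longlongrightarrow> C / (1 - \<rho>)\<^sup>2) at_top"
    using rho_less by (intro tendsto_divide tendsto_const level_moment_asymp C) auto
  from eventually_bounded_of_tendsto[OF this]
  have "eventually (\<lambda>a. mart_var a / ln a \<le> C / (1 - \<rho>)\<^sup>2 + 1) at_top"
    using eventually_gt_at_top[of 1]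
  proof eventually_elim
    case (elim a)
    have "mart_var a / ln a \<le> moment (level a) / (1 - \<rho>)\<^sup>2 / ln a"
      using elim mart_var_le[of a] by (intro divide_right_mono) auto
    also have "\<dots> = moment (level a) / ln a / (1 - \<rho>)\<^sup>2" by simp
    finally show ?case using elim(1) by linarith
  qed
  then show thesis by (rule that)
qed

lemma mart_square_scaled_eq:
  assumes "a > 1"
  shows "(\<integral>\<omega>. (mart t a \<omega> / a)\<^sup>2 \<partial>\<Omega>) = real (steps t a) / area a * (mart_var a / ln a)"
proof -
  have "(\<integral>\<omega>. (mart t a \<omega> / a)\<^sup>2 \<partial>\<Omega>) = real (steps t a) * mart_var a / a\<^sup>2"
    by (simp add: power_divide mart_square)
  then show ?thesis using assms by (simp add: area_def power2_eq_square)
qed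

lemma mart_square_scaled:
  assumes t: "t > 0"
  shows "((\<lambda>a. (\<integral>\<omega>. (mart t a \<omega> / a)\<^sup>2 \<partial>\<Omega>) - t * asymp_var a) \<longlongrightarrow> 0) at_top"
proof -
  obtain B where B: "eventually (\<lambda>a. mart_var a / ln a \<le> B) at_top" by (rule mart_var_quotient_bounded)
  show ?thesis
  proof (rule Lim_null_comparison)
    have "((\<lambda>a. \<bar>real (steps t a) / area a - t / mean_flight\<bar> * B) \<longlongrightarrow> \<bar>t / mean_flight - t / mean_flight\<bar> * B) at_top"
      by (intro tendsto_intros steps_quotient[OF t])
    then show "((\<lambda>a. \<bar>real (steps t a) / area a - t / mean_flight\<bar> * B) \<longlongrightarrow> 0) at_top" by simp
    show "eventually (\<lambda>a. norm ((\<integral>\<omega>. (mart t a \<omega> / a)\<^sup>2 \<partial>\<Omega>) - t * asymp_var a)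
        \<le> \<bar>real (steps t a) / area a - t / mean_flight\<bar> * B) at_top"
      using B eventually_gt_at_top[of 1]
    proof eventually_elim
      case (elim a)
      have "(\<integral>\<omega>. (mart t a \<omega> / a)\<^sup>2 \<partial>\<Omega>) - t * asymp_var a
          = (real (steps t a) / area a - t / mean_flight) * (mart_var a / ln a)"
      proof -
        have e1: "asymp_var a = mart_var a / ln a / mean_flight" by (simp add: asymp_var_def)
        have e2: "p * x - t * (x / mean_flight) = (p - t / mean_flight) * x" for p x :: real
          by (simp add: algebra_simps)
        show ?thesis unfolding mart_square_scaled_eq[OF elim(2)] e1 by (rule e2)
      qed
      moreover have "0 \<le> mart_var a / ln a" using elim(2) mart_var_nonneg[of a] by simp
      ultimately show ?case using elim(1) by (simp only: real_norm_def abs_mult abs_of_nonneg) (intro mult_left_mono, auto)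
    qed
  qed
qed

lemma mart_scaled_square_int: "square_int (\<lambda>\<omega>. mart t a \<omega> / a)"
  by (intro square_int_bounded bounded_measurable_divide mart_bounded)

lemma mart_square_scaled_bounded:
  assumes t: "t > 0"
  obtains B where "eventually (\<lambda>a. (\<integral>\<omega>. (mart t a \<omega> / a)\<^sup>2 \<partial>\<Omega>) \<le> B) at_top"
proof -
  obtain B where B: "eventually (\<lambda>a. mart_var a / ln a \<le> B) at_top" by (rule mart_var_quotient_bounded)
  have "eventually (\<lambda>a. (\<integral>\<omega>. (mart t a \<omega> / a)\<^sup>2 \<partial>\<Omega>) \<le> (t / mean_flight + 1) * B) at_top"
    using B eventually_bounded_of_tendsto[OF steps_quotient[OF t]] eventually_gt_at_top[of 1]
  proof eventually_elim
    case (elim a)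
    have "0 \<le> mart_var a / ln a" using elim(3) mart_var_nonneg[of a] by simp
    moreover have "0 \<le> t / mean_flight + 1" using t mean_flight_pos by simp
    ultimately show ?case unfolding mart_square_scaled_eq[OF elim(3)] using elim by (intro mult_mono) auto
  qed
  then show thesis by (rule that)
qed

lemma mart_square_limit:
  assumes t: "t > 0" and D: "(asymp_var \<longlongrightarrow> D) at_top"
  shows "((\<lambda>a. \<integral>\<omega>. (mart t a \<omega> / a)\<^sup>2 \<partial>\<Omega>) \<longlongrightarrow> t * D) at_top"
  using tendsto_add[OF mart_square_scaled[OF t] tendsto_mult[OF tendsto_const D, of t]] by simp


text \<open>The sum in the variance assumption equals a martingale plus a deterministic drift, up to a
  mean square null term, provided that the drift stays bounded; and boundedness of the drift is
  itself forced by convergence of the second moment.\<close>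

definition scaled_drift :: "real \<Rightarrow> real" where
  "scaled_drift a = drift a * area a / a"

definition truncated_total :: "real \<Rightarrow> real \<Rightarrow> 'w \<Rightarrow> real" where
  "truncated_total t a \<omega> = (\<Sum>j\<le>count (clock t a) \<omega>. truncate (level a) (Z (V j \<omega>))) / a"

lemma truncated_total_random_drift:
  assumes t: "t > 0"
  shows "ms_null (\<lambda>a \<omega>. truncated_total t a \<omega> - mart t a \<omega> / a - real (num t a \<omega>) * drift a / a)"
proof (rule ms_null_cong[OF _ ms_null_add[OF count_sum_truncation[OF t] ms_null_add[OF _ centered_sum_approximation[OF t]]]])
  let ?f = "\<lambda>a v. truncate (level a) (Z v)"
  let ?W = "\<lambda>a \<omega>. ?f a (V (count (clock t a) \<omega>) \<omega>) / a"
  show "?f a \<in> bounded_measurable S" for a by (rule truncate_Z_bounded)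
  have f_le: "\<bar>?f a v\<bar> \<le> level a" if "a > 1" for a v using abs_truncate_le level_pos[OF that] by simp
  show "eventually (\<lambda>a. \<forall>v\<in>space S. \<bar>?f a v\<bar> \<le> a) at_top"
    using level_le eventually_gt_at_top[of 1] by eventually_elim (use f_le in \<open>auto intro: order_trans\<close>)
  show "ms_null ?W"
  proof (rule ms_null_bounded[OF _ _ level_quotient])
    have "(\<lambda>\<omega>. ?f a (V (count (clock t a) \<omega>) \<omega>)) \<in> borel_measurable \<Omega>" for a
      by (rule measurable_compose_countable[of "\<lambda>k \<omega>. ?f a (V k \<omega>)"]) measurable
    then show "eventually (\<lambda>a. ?W a \<in> borel_measurable \<Omega>) at_top" by simp
    show "eventually (\<lambda>a. \<forall>\<omega>\<in>space \<Omega>. \<bar>?W a \<omega>\<bar> \<le> level a / a) at_top"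
      using eventually_gt_at_top[of 1] by eventually_elim (auto intro!: divide_right_mono f_le)
  qed
  have "((\<Sum>j<N. ?f a (V j \<omega>)) - (\<Sum>j<n. ?f a (V j \<omega>))) / a
      + (?f a (V N \<omega>) / a + ((\<Sum>j<n. centered a (V j \<omega>)) - x) / a)
    = (\<Sum>j\<le>N. ?f a (V j \<omega>)) / a - x / a - real n * drift a / a" for a \<omega> N n x
    by (simp add: centered_def sum_subtractf add_divide_distrib diff_divide_distrib flip: lessThan_Suc_atMost)
  then show "eventually (\<lambda>a. \<forall>\<omega>\<in>space \<Omega>.
      ((\<Sum>j<count (clock t a) \<omega>. ?f a (V j \<omega>)) - (\<Sum>j<num t a \<omega>. ?f a (V j \<omega>))) / a
      + (?W a \<omega> + ((\<Sum>j<num t a \<omega>. centered a (V j \<omega>)) - mart t a \<omega>) / a)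
    = truncated_total t a \<omega> - mart t a \<omega> / a - real (num t a \<omega>) * drift a / a) at_top"
    unfolding truncated_total_def by (intro always_eventually allI ballI)
qed

lemma truncated_total_square_int:
  assumes t: "t > 0"
  shows "eventually (\<lambda>a. square_int (truncated_total t a)) at_top"
proof -
  have "eventually (\<lambda>a. square_int (\<lambda>\<omega>. truncated_total t a \<omega> - mart t a \<omega> / a - real (num t a \<omega>) * drift a / a)) at_top"
    using truncated_total_random_drift[OF t] by (simp add: ms_null_def)
  then show ?thesis
  proof eventually_elim
    case (elim a)
    have "square_int (\<lambda>\<omega>. mart t a \<omega> / a + real (num t a \<omega>) * drift a / a)"
      by (intro square_int_bounded bounded_measurable_add bounded_measurable_divide bounded_measurable_mult
          bounded_measurable_const mart_bounded num_bounded)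
    from square_int_add[OF elim this] show ?case by simp
  qed
qed

text \<open>The random drift is the total minus the martingale and a null term, so its second moment is
  bounded; and the random count in it has second moment of order \<open>(area a)\<^sup>2\<close> from below.\<close>

lemma scaled_drift_bounded:
  assumes L: "((\<lambda>a. \<integral>\<omega>. (truncated_total 1 a \<omega>)\<^sup>2 \<partial>\<Omega>) \<longlongrightarrow> L) at_top"
  obtains Q where "eventually (\<lambda>a. (scaled_drift a)\<^sup>2 \<le> Q) at_top"
proof -
  let ?U = "\<lambda>a \<omega>. truncated_total 1 a \<omega> - mart 1 a \<omega> / a - real (num 1 a \<omega>) * drift a / a"
  have U: "ms_null ?U" by (rule truncated_total_random_drift) simp
  then have U0: "((\<lambda>a. \<integral>\<omega>. (?U a \<omega>)\<^sup>2 \<partial>\<Omega>) \<longlongrightarrow> 0) at_top" and Ui: "eventually (\<lambda>a. square_int (?U a)) at_top"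
    by (auto simp: ms_null_def)
  obtain B where B: "eventually (\<lambda>a. (\<integral>\<omega>. (mart 1 a \<omega> / a)\<^sup>2 \<partial>\<Omega>) \<le> B) at_top"
    by (rule mart_square_scaled_bounded[of 1]) auto
  define c where "c = (1 / mean_flight)\<^sup>2 / 2"
  have c: "c > 0" using mean_flight_pos by (simp add: c_def)
  let ?d = "\<lambda>a \<omega>. (real (num 1 a \<omega>) - real (steps 1 a)) / area a"
  have d0: "((\<lambda>a. \<integral>\<omega>. (?d a \<omega>)\<^sup>2 \<partial>\<Omega>) \<longlongrightarrow> 0) at_top" using num_concentration[of 1] by (simp add: ms_null_def)
  have "((\<lambda>a. (real (steps 1 a) / area a)\<^sup>2) \<longlongrightarrow> (1 / mean_flight)\<^sup>2) at_top"
    by (intro tendsto_power steps_quotient) simp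
  then have sc: "eventually (\<lambda>a. c < (real (steps 1 a) / area a)\<^sup>2) at_top"
    using mean_flight_pos by (intro order_tendstoD(1)) (auto simp: c_def field_simps)
  have dc: "eventually (\<lambda>a. (\<integral>\<omega>. (?d a \<omega>)\<^sup>2 \<partial>\<Omega>) < c / 4) at_top"
    using d0 c by (intro order_tendstoD(2)) auto
  have "eventually (\<lambda>a. (scaled_drift a)\<^sup>2 \<le> 4 * (2 * (L + 1) + 2 * (2 * 1 + 2 * B)) / c) at_top"
    using eventually_bounded_of_tendsto[OF L] eventually_bounded_of_tendsto[OF U0] Ui B sc dc
      truncated_total_square_int[of 1, OF zero_less_one] eventually_gt_at_top[of 1]
  proof eventually_elim
    case (elim a)
    have a: "a > 0" "area a > 0" using elim area_pos by auto
    define x where "x = (scaled_drift a)\<^sup>2"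
    let ?n = "\<lambda>\<omega>. real (num 1 a \<omega>) / area a"
    have n: "square_int ?n" by (intro square_int_bounded bounded_measurable_divide num_bounded)
    have d: "square_int (\<lambda>\<omega>. - ?d a \<omega>)"
      by (intro square_int_bounded bounded_measurable_uminus bounded_measurable_divide bounded_measurable_diff
          bounded_measurable_const num_bounded)
    have V: "square_int (\<lambda>\<omega>. ?U a \<omega> + mart 1 a \<omega> / a)" by (intro square_int_add elim(3) mart_scaled_square_int)
    have V': "square_int (\<lambda>\<omega>. - (?U a \<omega> + mart 1 a \<omega> / a))" using V by (rule square_int_uminus)
    \<comment> \<open>second moment of the random drift, from the total and the martingale\<close>
    have "(\<integral>\<omega>. (real (num 1 a \<omega>) * drift a / a)\<^sup>2 \<partial>\<Omega>) = (\<integral>\<omega>. (truncated_total 1 a \<omega> + - (?U a \<omega> + mart 1 a \<omega> / a))\<^sup>2 \<partial>\<Omega>)"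
      by simp
    also have "\<dots> \<le> 2 * (\<integral>\<omega>. (truncated_total 1 a \<omega>)\<^sup>2 \<partial>\<Omega>) + 2 * (\<integral>\<omega>. (- (?U a \<omega> + mart 1 a \<omega> / a))\<^sup>2 \<partial>\<Omega>)"
      by (rule square_int_add_le[OF elim(7) V'])
    finally have h: "(\<integral>\<omega>. (real (num 1 a \<omega>) * drift a / a)\<^sup>2 \<partial>\<Omega>)
      \<le> 2 * (\<integral>\<omega>. (truncated_total 1 a \<omega>)\<^sup>2 \<partial>\<Omega>) + 2 * (\<integral>\<omega>. (- (?U a \<omega> + mart 1 a \<omega> / a))\<^sup>2 \<partial>\<Omega>)" .
    have "(\<integral>\<omega>. (- (?U a \<omega> + mart 1 a \<omega> / a))\<^sup>2 \<partial>\<Omega>) = (\<integral>\<omega>. (?U a \<omega> + mart 1 a \<omega> / a)\<^sup>2 \<partial>\<Omega>)"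
      by (simp only: power2_minus)
    also have "\<dots> \<le> 2 * (\<integral>\<omega>. (?U a \<omega>)\<^sup>2 \<partial>\<Omega>) + 2 * (\<integral>\<omega>. (mart 1 a \<omega> / a)\<^sup>2 \<partial>\<Omega>)"
      by (rule square_int_add_le[OF elim(3) mart_scaled_square_int])
    finally have "(\<integral>\<omega>. (- (?U a \<omega> + mart 1 a \<omega> / a))\<^sup>2 \<partial>\<Omega>)
      \<le> 2 * (\<integral>\<omega>. (?U a \<omega>)\<^sup>2 \<partial>\<Omega>) + 2 * (\<integral>\<omega>. (mart 1 a \<omega> / a)\<^sup>2 \<partial>\<Omega>)" .
    with h have 1: "(\<integral>\<omega>. (real (num 1 a \<omega>) * drift a / a)\<^sup>2 \<partial>\<Omega>) \<le> 2 * (L + 1) + 2 * (2 * 1 + 2 * B)"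
      using elim(1,2,4) by argo
    have "(\<integral>\<omega>. (real (num 1 a \<omega>) * drift a / a)\<^sup>2 \<partial>\<Omega>) = (\<integral>\<omega>. x * (?n \<omega>)\<^sup>2 \<partial>\<Omega>)"
      using a by (intro Bochner_Integration.integral_cong) (auto simp: x_def scaled_drift_def power_mult_distrib power_divide)
    also have "\<dots> = x * (\<integral>\<omega>. (?n \<omega>)\<^sup>2 \<partial>\<Omega>)" by simp
    finally have 2: "x * (\<integral>\<omega>. (?n \<omega>)\<^sup>2 \<partial>\<Omega>) \<le> 2 * (L + 1) + 2 * (2 * 1 + 2 * B)" using 1 by simp
    \<comment> \<open>the count itself is of order \<open>area a\<close> in mean square\<close>
    have "(real (steps 1 a) / area a)\<^sup>2 = (\<integral>\<omega>. (?n \<omega> + - ?d a \<omega>)\<^sup>2 \<partial>\<Omega>)"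
      using a by (simp add: diff_divide_distrib prob_space)
    also have "\<dots> \<le> 2 * (\<integral>\<omega>. (?n \<omega>)\<^sup>2 \<partial>\<Omega>) + 2 * (\<integral>\<omega>. (- ?d a \<omega>)\<^sup>2 \<partial>\<Omega>)"
      by (rule square_int_add_le[OF n d])
    also have "(\<integral>\<omega>. (- ?d a \<omega>)\<^sup>2 \<partial>\<Omega>) = (\<integral>\<omega>. (?d a \<omega>)\<^sup>2 \<partial>\<Omega>)" by (simp only: power2_minus)
    finally have "c / 4 \<le> (\<integral>\<omega>. (?n \<omega>)\<^sup>2 \<partial>\<Omega>)" using elim(5,6) by argo
    then have "x * (c / 4) \<le> x * (\<integral>\<omega>. (?n \<omega>)\<^sup>2 \<partial>\<Omega>)" by (intro mult_left_mono) (auto simp: x_def)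
    then have "x * (c / 4) \<le> 2 * (L + 1) + 2 * (2 * 1 + 2 * B)" using 2 by linarith
    then show ?case using c by (simp add: x_def field_simps)
  qed
  then show thesis by (rule that)
qed

lemma truncated_total_second_moment:
  assumes t: "t > 0"
    and L: "((\<lambda>a. \<integral>\<omega>. (truncated_total t a \<omega>)\<^sup>2 \<partial>\<Omega>) \<longlongrightarrow> L) at_top"
    and Q: "eventually (\<lambda>a. (scaled_drift a)\<^sup>2 \<le> Q) at_top"
  shows "((\<lambda>a. t * asymp_var a + t\<^sup>2 * (scaled_drift a / mean_flight)\<^sup>2) \<longlongrightarrow> L) at_top"
proof -
  define y where "y a = real (steps t a) / area a" for a
  have y: "(y \<longlongrightarrow> t / mean_flight) at_top" unfolding y_def by (rule steps_quotient[OF t])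
  let ?A = "\<lambda>a \<omega>. mart t a \<omega> / a + y a * scaled_drift a"
  let ?d = "\<lambda>a \<omega>. (real (num t a \<omega>) - real (steps t a)) / area a"
  let ?U1 = "\<lambda>a \<omega>. truncated_total t a \<omega> - mart t a \<omega> / a - real (num t a \<omega>) * drift a / a"
  have U2: "ms_null (\<lambda>a \<omega>. ?d a \<omega> * scaled_drift a)"
  proof (rule ms_nullI)
    show "eventually (\<lambda>a. square_int (\<lambda>\<omega>. ?d a \<omega> * scaled_drift a)) at_top"
      by (intro always_eventually allI square_int_bounded bounded_measurable_mult bounded_measurable_divide
          bounded_measurable_diff bounded_measurable_const num_bounded)
    show "eventually (\<lambda>a. (\<integral>\<omega>. (?d a \<omega> * scaled_drift a)\<^sup>2 \<partial>\<Omega>) \<le> (\<integral>\<omega>. (?d a \<omega>)\<^sup>2 \<partial>\<Omega>) * Q) at_top"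
      using Q
    proof eventually_elim
      case (elim a)
      have "(\<integral>\<omega>. (?d a \<omega> * scaled_drift a)\<^sup>2 \<partial>\<Omega>) = (\<integral>\<omega>. (?d a \<omega>)\<^sup>2 \<partial>\<Omega>) * (scaled_drift a)\<^sup>2"
        by (simp only: power_mult_distrib) simp
      also have "\<dots> \<le> (\<integral>\<omega>. (?d a \<omega>)\<^sup>2 \<partial>\<Omega>) * Q" using elim by (intro mult_left_mono) auto
      finally show ?case .
    qed
    have "((\<lambda>a. (\<integral>\<omega>. (?d a \<omega>)\<^sup>2 \<partial>\<Omega>) * Q) \<longlongrightarrow> 0 * Q) at_top"
      using num_concentration[OF t] unfolding ms_null_def by (intro tendsto_mult tendsto_const) auto
    then show "((\<lambda>a. (\<integral>\<omega>. (?d a \<omega>)\<^sup>2 \<partial>\<Omega>) * Q) \<longlongrightarrow> 0) at_top" by simp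
  qed
  have U: "ms_null (\<lambda>a \<omega>. - (?U1 a \<omega> + ?d a \<omega> * scaled_drift a))"
    by (intro ms_null_uminus ms_null_add truncated_total_random_drift U2 t)
  have "((\<lambda>a. (\<integral>\<omega>. (truncated_total t a \<omega> + - (?U1 a \<omega> + ?d a \<omega> * scaled_drift a))\<^sup>2 \<partial>\<Omega>)
      - (\<integral>\<omega>. (truncated_total t a \<omega>)\<^sup>2 \<partial>\<Omega>)) \<longlongrightarrow> 0) at_top"
    by (rule second_moment_perturbation[OF truncated_total_square_int[OF t] U eventually_bounded_of_tendsto[OF L]])
  from tendsto_add[OF this L]
  have "((\<lambda>a. \<integral>\<omega>. (truncated_total t a \<omega> + - (?U1 a \<omega> + ?d a \<omega> * scaled_drift a))\<^sup>2 \<partial>\<Omega>) \<longlongrightarrow> L) at_top" by simp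
  moreover have "eventually (\<lambda>a. (\<integral>\<omega>. (truncated_total t a \<omega> + - (?U1 a \<omega> + ?d a \<omega> * scaled_drift a))\<^sup>2 \<partial>\<Omega>)
      = (\<integral>\<omega>. (mart t a \<omega> / a)\<^sup>2 \<partial>\<Omega>) + (y a * scaled_drift a)\<^sup>2) at_top"
    using eventually_gt_at_top[of 1]
  proof eventually_elim
    case (elim a)
    have a: "a > 0" "area a > 0" using elim area_pos by auto
    have eqA: "truncated_total t a \<omega> + - (?U1 a \<omega> + ?d a \<omega> * scaled_drift a) = ?A a \<omega>" for \<omega>
      using a by (simp add: y_def scaled_drift_def diff_divide_distrib left_diff_distrib)
    have "(\<integral>\<omega>. (truncated_total t a \<omega> + - (?U1 a \<omega> + ?d a \<omega> * scaled_drift a))\<^sup>2 \<partial>\<Omega>) = (\<integral>\<omega>. (?A a \<omega>)\<^sup>2 \<partial>\<Omega>)"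
      by (simp only: eqA)
    also have "\<dots> = (\<integral>\<omega>. (mart t a \<omega> / a)\<^sup>2 + (2 * (y a * scaled_drift a) / a) * mart t a \<omega> + (y a * scaled_drift a)\<^sup>2 \<partial>\<Omega>)"
      by (simp add: power2_sum add_ac mult_ac)
    also have "\<dots> = (\<integral>\<omega>. (mart t a \<omega> / a)\<^sup>2 \<partial>\<Omega>) + (2 * (y a * scaled_drift a) / a) * (\<integral>\<omega>. mart t a \<omega> \<partial>\<Omega>) + (y a * scaled_drift a)\<^sup>2"
    proof -
      have i: "integrable \<Omega> (mart t a)" by (rule bounded_measurable_integrable[OF mart_bounded])
      have j: "integrable \<Omega> (\<lambda>\<omega>. (mart t a \<omega> / a)\<^sup>2)" using mart_scaled_square_int by (simp add: square_int_def)
      show ?thesis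
        by (subst Bochner_Integration.integral_add, (intro Bochner_Integration.integrable_add integrable_mult_right i j integrable_const)+)
           (subst Bochner_Integration.integral_add, (intro integrable_mult_right i j)+, simp add: prob_space)
    qed
    finally show ?case by (simp add: mart_mean)
  qed
  ultimately have "((\<lambda>a. (\<integral>\<omega>. (mart t a \<omega> / a)\<^sup>2 \<partial>\<Omega>) + (y a * scaled_drift a)\<^sup>2) \<longlongrightarrow> L) at_top"
    by (rule Lim_transform_eventually)
  from tendsto_diff[OF this mart_square_scaled[OF t]]
  have 1: "((\<lambda>a. t * asymp_var a + (y a * scaled_drift a)\<^sup>2) \<longlongrightarrow> L) at_top" by (simp add: add.commute)
  have 2: "((\<lambda>a. (t\<^sup>2 * (1 / mean_flight)\<^sup>2 - (y a)\<^sup>2) * (scaled_drift a)\<^sup>2) \<longlongrightarrow> 0) at_top"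
  proof (rule Lim_null_comparison)
    have "((\<lambda>a. \<bar>t\<^sup>2 * (1 / mean_flight)\<^sup>2 - (y a)\<^sup>2\<bar> * Q) \<longlongrightarrow> \<bar>t\<^sup>2 * (1 / mean_flight)\<^sup>2 - (t / mean_flight)\<^sup>2\<bar> * Q) at_top"
      by (intro tendsto_intros y)
    then show "((\<lambda>a. \<bar>t\<^sup>2 * (1 / mean_flight)\<^sup>2 - (y a)\<^sup>2\<bar> * Q) \<longlongrightarrow> 0) at_top"
      by (simp add: power_divide)
    show "eventually (\<lambda>a. norm ((t\<^sup>2 * (1 / mean_flight)\<^sup>2 - (y a)\<^sup>2) * (scaled_drift a)\<^sup>2)
        \<le> \<bar>t\<^sup>2 * (1 / mean_flight)\<^sup>2 - (y a)\<^sup>2\<bar> * Q) at_top"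
      using Q by eventually_elim (simp add: abs_mult mult_left_mono)
  qed
  have "((\<lambda>a. (t * asymp_var a + (y a * scaled_drift a)\<^sup>2)
      + (t\<^sup>2 * (1 / mean_flight)\<^sup>2 - (y a)\<^sup>2) * (scaled_drift a)\<^sup>2) \<longlongrightarrow> L + 0) at_top"
    by (rule tendsto_add[OF 1 2])
  moreover have "(t * p + (q * s)\<^sup>2) + (t\<^sup>2 * (1 / mean_flight)\<^sup>2 - q\<^sup>2) * s\<^sup>2 = t * p + t\<^sup>2 * (s / mean_flight)\<^sup>2"
    for p q s :: real
    by (simp add: power_mult_distrib power_divide algebra_simps)
  ultimately show ?thesis by (simp only: add_0_right)
qed

text \<open>Variance and drift enter with \<open>t\<close> and \<open>t\<^sup>2\<close>, so the limits at \<open>t = 1\<close> and \<open>t = 2\<close>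
  separate them.\<close>

lemma asymp_var_converges:
  assumes L: "\<And>t. t > 0 \<Longrightarrow> \<exists>L. ((\<lambda>a. \<integral>\<omega>. (truncated_total t a \<omega>)\<^sup>2 \<partial>\<Omega>) \<longlongrightarrow> L) at_top"
  obtains D where "(asymp_var \<longlongrightarrow> D) at_top" "D \<ge> 0"
proof -
  obtain L1 where L1: "((\<lambda>a. \<integral>\<omega>. (truncated_total 1 a \<omega>)\<^sup>2 \<partial>\<Omega>) \<longlongrightarrow> L1) at_top" using L[of 1] by auto
  obtain L2 where L2: "((\<lambda>a. \<integral>\<omega>. (truncated_total 2 a \<omega>)\<^sup>2 \<partial>\<Omega>) \<longlongrightarrow> L2) at_top" using L[of 2] by auto
  obtain Q where Q: "eventually (\<lambda>a. (scaled_drift a)\<^sup>2 \<le> Q) at_top" by (rule scaled_drift_bounded[OF L1])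
  let ?b = "\<lambda>a. (scaled_drift a / mean_flight)\<^sup>2"
  have 1: "((\<lambda>a. 1 * asymp_var a + 1\<^sup>2 * ?b a) \<longlongrightarrow> L1) at_top"
    by (rule truncated_total_second_moment[OF _ L1 Q]) simp
  have 2: "((\<lambda>a. 2 * asymp_var a + 2\<^sup>2 * ?b a) \<longlongrightarrow> L2) at_top"
    by (rule truncated_total_second_moment[OF _ L2 Q]) simp
  have "((\<lambda>a. 2 * (1 * asymp_var a + 1\<^sup>2 * ?b a) - (1 / 2) * (2 * asymp_var a + 2\<^sup>2 * ?b a)) \<longlongrightarrow> 2 * L1 - (1 / 2) * L2) at_top"
    by (intro tendsto_diff tendsto_mult tendsto_const 1 2)
  moreover have "2 * (1 * s + 1\<^sup>2 * b) - (1 / 2) * (2 * s + 2\<^sup>2 * b) = s" for s b :: real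
    by (simp add: field_simps)
  ultimately have lim: "(asymp_var \<longlongrightarrow> 2 * L1 - (1 / 2) * L2) at_top" by (simp only:)
  moreover have "2 * L1 - (1 / 2) * L2 \<ge> 0"
  proof (rule tendsto_lowerbound[OF lim])
    show "eventually (\<lambda>a. 0 \<le> asymp_var a) at_top"
      using eventually_gt_at_top[of 1]
      by eventually_elim (use mart_var_nonneg mean_flight_pos in \<open>auto simp: asymp_var_def\<close>)
  qed simp
  ultimately show thesis by (rule that)
qed

lemma full_total_approximation:
  assumes t: "t > 0"
  shows "ms_null (\<lambda>a \<omega>. (\<Sum>j<count (clock t a) \<omega>. truncate a (Z (V j \<omega>))) / a - mart t a \<omega> / a)"
proof (rule ms_null_cong[OF _ ms_null_add[OF count_sum_truncation[OF t] full_sum_approximation[OF t]]])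
  show "(\<lambda>v. truncate a (Z v)) \<in> bounded_measurable S" for a by (rule truncate_Z_bounded)
  show "eventually (\<lambda>a. \<forall>v\<in>space S. \<bar>truncate a (Z v)\<bar> \<le> a) at_top"
    using eventually_ge_at_top[of 0] by eventually_elim (simp add: abs_truncate_le)
qed (auto simp: add_divide_distrib diff_divide_distrib intro!: always_eventually)

lemma full_second_moment:
  assumes t: "t > 0" and D: "(asymp_var \<longlongrightarrow> D) at_top"
  shows "((\<lambda>a. 1 / (a\<^sup>2 * t) * (\<integral>\<omega>. (\<Sum>j<count (clock t a) \<omega>. truncate a (Z (V j \<omega>)))\<^sup>2 \<partial>\<Omega>)) \<longlongrightarrow> D) at_top"
proof -
  let ?X = "\<lambda>a \<omega>. (\<Sum>j<count (clock t a) \<omega>. truncate a (Z (V j \<omega>))) / a"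
  obtain B where B: "eventually (\<lambda>a. (\<integral>\<omega>. (mart t a \<omega> / a)\<^sup>2 \<partial>\<Omega>) \<le> B) at_top"
    by (rule mart_square_scaled_bounded[OF t])
  have "((\<lambda>a. (\<integral>\<omega>. (mart t a \<omega> / a + (?X a \<omega> - mart t a \<omega> / a))\<^sup>2 \<partial>\<Omega>) - (\<integral>\<omega>. (mart t a \<omega> / a)\<^sup>2 \<partial>\<Omega>)) \<longlongrightarrow> 0) at_top"
    by (rule second_moment_perturbation[OF _ full_total_approximation[OF t] B]) (intro always_eventually allI mart_scaled_square_int)
  from tendsto_add[OF this mart_square_limit[OF t D]]
  have "((\<lambda>a. \<integral>\<omega>. (?X a \<omega>)\<^sup>2 \<partial>\<Omega>) \<longlongrightarrow> t * D) at_top" by simp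
  from tendsto_mult[OF tendsto_const this, of "1 / t"]
  have "((\<lambda>a. 1 / t * (\<integral>\<omega>. (?X a \<omega>)\<^sup>2 \<partial>\<Omega>)) \<longlongrightarrow> D) at_top" using t by simp
  then show ?thesis by (simp add: power_divide mult.commute)
qed

text \<open>The accumulated error of \<open>martingale_char_bound\<close> is the total variance, which is bounded, times
  the size of the corrector relative to \<open>a\<close>, which vanishes.\<close>

lemma mart_char_limit:
  assumes t: "t > 0" and D: "(asymp_var \<longlongrightarrow> D) at_top"
  shows "((\<lambda>a. \<integral>\<omega>. iexp (u * (mart t a \<omega> / a)) \<partial>\<Omega>) \<longlongrightarrow> complex_of_real (exp (- (u\<^sup>2 * (t * D) / 2)))) at_top"
proof -
  define G where "G a = real (depth a) * (2 * level a)" for a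
  define w where "w a = (u / a)\<^sup>2 * mart_var a / 2" for a
  define e where "e a = real (steps t a) * (\<bar>u / a\<bar> ^ 3 * G a * mart_var a / (1 - \<rho>))" for a
  obtain B where B: "eventually (\<lambda>a. mart_var a / ln a \<le> B) at_top" by (rule mart_var_quotient_bounded)
  have msq: "((\<lambda>a. real (steps t a) * mart_var a / a\<^sup>2) \<longlongrightarrow> t * D) at_top"
    using mart_square_limit[OF t D] by (simp add: power_divide mart_square)
  have mw: "((\<lambda>a. real (steps t a) * w a) \<longlongrightarrow> u\<^sup>2 * (t * D) / 2) at_top"
  proof -
    have "((\<lambda>a. u\<^sup>2 * (real (steps t a) * mart_var a / a\<^sup>2) / 2) \<longlongrightarrow> u\<^sup>2 * (t * D) / 2) at_top"
      by (intro tendsto_intros msq) simp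
    then show ?thesis by (simp add: w_def power_divide mult_ac)
  qed
  have w0: "eventually (\<lambda>a. 0 \<le> w a) at_top" by (simp add: w_def mart_var_nonneg)
  have w: "(w \<longlongrightarrow> 0) at_top"
  proof (rule tendsto_sandwich[OF w0 _ tendsto_const])
    show "eventually (\<lambda>a. w a \<le> u\<^sup>2 * B / 2 * (ln a / a\<^sup>2)) at_top"
      using B eventually_gt_at_top[of 1]
    proof eventually_elim
      case (elim a)
      then have "mart_var a \<le> B * ln a" by (simp add: pos_divide_le_eq)
      then have "u\<^sup>2 / (2 * a\<^sup>2) * mart_var a \<le> u\<^sup>2 / (2 * a\<^sup>2) * (B * ln a)" by (intro mult_left_mono) auto
      then show ?case by (simp add: w_def power_divide mult_ac)
    qed
    have "((\<lambda>a::real. ln a / a\<^sup>2) \<longlongrightarrow> 0) at_top" by real_asymp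
    from tendsto_mult[OF tendsto_const this, of "u\<^sup>2 * B / 2"]
    show "((\<lambda>a. u\<^sup>2 * B / 2 * (ln a / a\<^sup>2)) \<longlongrightarrow> 0) at_top" by simp
  qed
  have e: "(e \<longlongrightarrow> 0) at_top"
  proof -
    have "((\<lambda>a. \<bar>u\<bar> ^ 3 / (1 - \<rho>) * (real (steps t a) * mart_var a / a\<^sup>2) * (G a / a)) \<longlongrightarrow> \<bar>u\<bar> ^ 3 / (1 - \<rho>) * (t * D) * 0) at_top"
      unfolding G_def by (intro tendsto_mult tendsto_const msq corrector_size)
    moreover have "eventually (\<lambda>a. \<bar>u\<bar> ^ 3 / (1 - \<rho>) * (real (steps t a) * mart_var a / a\<^sup>2) * (G a / a) = e a) at_top"
      using eventually_gt_at_top[of 0]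
      by eventually_elim (simp add: e_def power_divide abs_divide power3_eq_cube power2_eq_square mult_ac)
    ultimately show ?thesis by (auto elim: Lim_transform_eventually)
  qed
  have "((\<lambda>a. (\<integral>\<omega>. iexp (u * (mart t a \<omega> / a)) \<partial>\<Omega>) - of_real ((1 - w a) ^ steps t a)) \<longlongrightarrow> 0) at_top"
  proof (rule Lim_null_comparison[OF _ e])
    have "eventually (\<lambda>a. w a < 1) at_top" using w by (intro order_tendstoD(2)) auto
    then show "eventually (\<lambda>a. cmod ((\<integral>\<omega>. iexp (u * (mart t a \<omega> / a)) \<partial>\<Omega>) - of_real ((1 - w a) ^ steps t a)) \<le> e a) at_top"
      using eventually_gt_at_top[of 1]
    proof eventually_elim
      case (elim a)
      have "(u / a)\<^sup>2 * mart_var a / 2 \<le> 1" using elim(1) by (simp add: w_def)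
      from martingale_char_bound[OF corrector_bounded abs_corrector_le[OF elim(2)] this[unfolded mart_var_def], of "steps t a"]
      show ?case by (simp add: mart_def w_def e_def G_def mart_var_def)
    qed
  qed
  moreover have "((\<lambda>a. complex_of_real ((1 - w a) ^ steps t a)) \<longlongrightarrow> complex_of_real (exp (- (u\<^sup>2 * (t * D) / 2)))) at_top"
    by (intro tendsto_of_real one_minus_power_tendsto_exp w0 w mw)
  ultimately show ?thesis using tendsto_add by fastforce
qed

text \<open>Outside this event the cap has no effect on the count, and truncation at \<open>a\<close> has none on the
  observed values.\<close>

definition exceptional :: "real \<Rightarrow> real \<Rightarrow> 'w set" where
  "exceptional t a = {\<omega> \<in> space \<Omega>. arrival (cap (clock t a)) \<omega> \<le> clock t a}
    \<union> (\<Union>j<cap (clock t a). {\<omega> \<in> space \<Omega>. \<bar>Z (V j \<omega>)\<bar> > a})"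

lemma exceptional_measurable[measurable]: "exceptional t a \<in> sets \<Omega>"
  unfolding exceptional_def by measurable

lemma exceptional_negligible:
  assumes t: "t > 0"
  shows "((\<lambda>a. prob (exceptional t a)) \<longlongrightarrow> 0) at_top"
proof (rule tendsto_sandwich[OF _ _ tendsto_const])
  obtain C where C: "C > 0" "((\<lambda>a. moment a / ln a) \<longlongrightarrow> C) at_top" by (rule moment_asymp)
  let ?l = "\<lambda>a. cap_rate * t + 3 * (1 / area a)"
  let ?b = "\<lambda>a. tail_const * exp (- clock t a) + ?l a * (nu.tail_moment Z a * a / ln a)"
  have l: "(?l \<longlongrightarrow> cap_rate * t + 3 * 0) at_top" by (intro tendsto_intros inverse_area)
  have "((\<lambda>T. exp (- T)) \<longlongrightarrow> (0::real)) at_top" by real_asymp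
  from filterlim_compose[OF this clock_at_top[OF t]] have "((\<lambda>a. exp (- clock t a)) \<longlongrightarrow> 0) at_top" .
  then have "(?b \<longlongrightarrow> tail_const * 0 + (cap_rate * t + 3 * 0) * 0) at_top"
    by (intro tendsto_add tendsto_mult l tendsto_const nu.tail_moment_asymp[OF Z_integrable C(2)])
  then show "(?b \<longlongrightarrow> 0) at_top" by simp
  show "eventually (\<lambda>a. prob (exceptional t a) \<le> ?b a) at_top"
    using eventually_gt_at_top[of 1] cap_quotient[OF t]
  proof eventually_elim
    case (elim a)
    have a: "a > 0" "ln a > 0" "area a > 0" using elim area_pos by auto
    let ?L = "cap (clock t a)"
    let ?E = "\<lambda>j. {\<omega> \<in> space \<Omega>. \<bar>Z (V j \<omega>)\<bar> > a}"
    have T: "clock t a \<ge> 0" using a t by (simp add: clock_def)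
    have pE: "prob (?E j) \<le> nu.tail_moment Z a / a" for j
    proof -
      have "prob (?E j) = measure (distr \<Omega> S (V j)) {v \<in> space S. \<bar>Z v\<bar> > a}"
        using measurable_space[OF V_measurable]
        by (subst measure_distr) (auto intro!: arg_cong[where f=prob])
      also have "\<dots> \<le> nu.tail_moment Z a / a"
        unfolding distr_V using nu.prob_exceeds_le[OF Z_integrable a(1)] by simp
      finally show ?thesis .
    qed
    have "prob (exceptional t a) \<le> prob {\<omega> \<in> space \<Omega>. arrival ?L \<omega> \<le> clock t a} + prob (\<Union>j<?L. ?E j)"
      unfolding exceptional_def by (intro measure_subadditive) (auto simp: emeasure_eq_measure)
    also have "prob (\<Union>j<?L. ?E j) \<le> (\<Sum>j<?L. prob (?E j))"
      by (intro measure_subadditive_finite) (auto simp: emeasure_eq_measure)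
    also have "\<dots> \<le> (\<Sum>j<?L. nu.tail_moment Z a / a)" by (intro sum_mono pE)
    also have "\<dots> = real ?L * (nu.tail_moment Z a / a)" by simp
    also have "\<dots> \<le> (?l a * area a) * (nu.tail_moment Z a / a)"
      using elim(2) a nu.tail_moment_nonneg[of Z a] by (intro mult_right_mono) auto
    also have "\<dots> = ?l a * (nu.tail_moment Z a * a / ln a)" using a by (simp add: area_def)
    finally show ?case using prob_cap_exceeded[OF T] by linarith
  qed
qed simp

lemma observable_char_limit:
  assumes t: "t > 0" and D: "(asymp_var \<longlongrightarrow> D) at_top"
  shows "((\<lambda>a. \<integral>\<omega>. iexp (u * (\<Sum>j<count (clock t a) \<omega>. 1 / a * Z (V j \<omega>))) \<partial>\<Omega>)
    \<longlongrightarrow> complex_of_real (exp (- (u\<^sup>2 * (t * D) / 2)))) at_top"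
proof -
  let ?X = "\<lambda>a \<omega>. \<Sum>j<count (clock t a) \<omega>. 1 / a * Z (V j \<omega>)"
  let ?Y = "\<lambda>a \<omega>. (\<Sum>j<count (clock t a) \<omega>. truncate a (Z (V j \<omega>))) / a"
  let ?M = "\<lambda>a \<omega>. mart t a \<omega> / a"
  let ?U = "\<lambda>a \<omega>. ?Y a \<omega> - ?M a \<omega>"
  have U: "((\<lambda>a. \<integral>\<omega>. (?U a \<omega>)\<^sup>2 \<partial>\<Omega>) \<longlongrightarrow> 0) at_top" "eventually (\<lambda>a. square_int (?U a)) at_top"
    using full_total_approximation[OF t] by (auto simp: ms_null_def)
  have "((\<lambda>a. (\<integral>\<omega>. iexp (u * ?X a \<omega>) \<partial>\<Omega>) - (\<integral>\<omega>. iexp (u * ?M a \<omega>) \<partial>\<Omega>)) \<longlongrightarrow> 0) at_top"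
  proof (rule Lim_null_comparison)
    have "((\<lambda>a. 2 * prob (exceptional t a) + \<bar>u\<bar> * sqrt (\<integral>\<omega>. (?U a \<omega>)\<^sup>2 \<partial>\<Omega>)) \<longlongrightarrow> 2 * 0 + \<bar>u\<bar> * sqrt 0) at_top"
      by (intro tendsto_intros exceptional_negligible[OF t] U(1))
    then show "((\<lambda>a. 2 * prob (exceptional t a) + \<bar>u\<bar> * sqrt (\<integral>\<omega>. (?U a \<omega>)\<^sup>2 \<partial>\<Omega>)) \<longlongrightarrow> 0) at_top" by simp
    show "eventually (\<lambda>a. cmod ((\<integral>\<omega>. iexp (u * ?X a \<omega>) \<partial>\<Omega>) - (\<integral>\<omega>. iexp (u * ?M a \<omega>) \<partial>\<Omega>))
        \<le> 2 * prob (exceptional t a) + \<bar>u\<bar> * sqrt (\<integral>\<omega>. (?U a \<omega>)\<^sup>2 \<partial>\<Omega>)) at_top"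
      using U(2)
    proof eventually_elim
      case (elim a)
      have [measurable]: "mart t a \<in> borel_measurable \<Omega>" by (rule bounded_measurable_measurable[OF mart_bounded])
      have [measurable]: "?X a \<in> borel_measurable \<Omega>" by measurable
      have iexp_int: "integrable \<Omega> (\<lambda>\<omega>. iexp (f \<omega>))" if [measurable]: "f \<in> borel_measurable \<Omega>" for f :: "'w \<Rightarrow> real"
      proof (rule integrable_const_bound[where B=1])
        show "(\<lambda>\<omega>. iexp (f \<omega>)) \<in> borel_measurable \<Omega>" by measurable
      qed simp
      have iX: "integrable \<Omega> (\<lambda>\<omega>. iexp (u * ?X a \<omega>))" by (rule iexp_int) measurable
      have iM: "integrable \<Omega> (\<lambda>\<omega>. iexp (u * ?M a \<omega>))" by (rule iexp_int) measurable
      have iU: "integrable \<Omega> (?U a)"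
        using elim by (auto simp: square_int_def intro: square_integrable_imp_integrable)
      have iE: "integrable \<Omega> (\<lambda>\<omega>. indicator (exceptional t a) \<omega> :: real)"
        by (intro integrable_real_indicator) (auto simp: less_top[symmetric])
      have "cmod ((\<integral>\<omega>. iexp (u * ?X a \<omega>) \<partial>\<Omega>) - (\<integral>\<omega>. iexp (u * ?M a \<omega>) \<partial>\<Omega>))
          = cmod (\<integral>\<omega>. iexp (u * ?X a \<omega>) - iexp (u * ?M a \<omega>) \<partial>\<Omega>)"
        using iX iM by (subst Bochner_Integration.integral_diff) auto
      also have "\<dots> \<le> (\<integral>\<omega>. 2 * indicator (exceptional t a) \<omega> + \<bar>u\<bar> * \<bar>?U a \<omega>\<bar> \<partial>\<Omega>)"
      proof (rule order_trans[OF integral_norm_bound integral_mono])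
        show "integrable \<Omega> (\<lambda>\<omega>. cmod (iexp (u * ?X a \<omega>) - iexp (u * ?M a \<omega>)))"
          by (intro integrable_norm Bochner_Integration.integrable_diff iX iM)
        show "integrable \<Omega> (\<lambda>\<omega>. 2 * indicator (exceptional t a) \<omega> + \<bar>u\<bar> * \<bar>?U a \<omega>\<bar>)"
          by (intro Bochner_Integration.integrable_add integrable_mult_right integrable_abs iE iU)
        fix \<omega> assume \<omega>: "\<omega> \<in> space \<Omega>"
        show "cmod (iexp (u * ?X a \<omega>) - iexp (u * ?M a \<omega>)) \<le> 2 * indicator (exceptional t a) \<omega> + \<bar>u\<bar> * \<bar>?U a \<omega>\<bar>"
        proof (cases "\<omega> \<in> exceptional t a")
          case True
          have "cmod (iexp (u * ?X a \<omega>) - iexp (u * ?M a \<omega>)) \<le> cmod (iexp (u * ?X a \<omega>)) + cmod (iexp (u * ?M a \<omega>))"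
            by (rule norm_triangle_ineq4)
          also have "\<dots> = 2" by (simp only: norm_exp_i_times)
          finally have "cmod (iexp (u * ?X a \<omega>) - iexp (u * ?M a \<omega>)) \<le> 2" .
          moreover have "0 \<le> \<bar>u\<bar> * \<bar>?U a \<omega>\<bar>" by simp
          moreover have "indicator (exceptional t a) \<omega> = (1 :: real)" using True by simp
          ultimately show ?thesis by linarith
        next
          case False
          then have arr: "clock t a < arrival (cap (clock t a)) \<omega>"
            and small: "\<And>j. j < cap (clock t a) \<Longrightarrow> \<bar>Z (V j \<omega>)\<bar> \<le> a"
            using \<omega> by (auto simp: exceptional_def not_le not_less)
          have "count (clock t a) \<omega> \<le> cap (clock t a)"
            using count_eq_capped_count[OF \<omega> arr] num_le_cap[OF \<omega>, of t a] by (simp add: truncated_count_def)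
          then have "?X a \<omega> = ?Y a \<omega>"
            unfolding sum_divide_distrib by (intro sum.cong refl) (use small in \<open>auto simp: truncate_def\<close>)
          moreover have "cmod (iexp (u * ?Y a \<omega>) - iexp (u * ?M a \<omega>)) \<le> \<bar>u * ?Y a \<omega> - u * ?M a \<omega>\<bar>"
            by (rule norm_iexp_diff_le)
          moreover have "\<bar>u * ?Y a \<omega> - u * ?M a \<omega>\<bar> = \<bar>u\<bar> * \<bar>?U a \<omega>\<bar>"
            by (simp only: right_diff_distrib[symmetric] abs_mult)
          ultimately show ?thesis using False by simp
        qed
      qed
      also have "\<dots> = 2 * prob (exceptional t a) + \<bar>u\<bar> * (\<integral>\<omega>. \<bar>?U a \<omega>\<bar> \<partial>\<Omega>)"
        using iE iU by (subst Bochner_Integration.integral_add) auto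
      also have "(\<integral>\<omega>. \<bar>?U a \<omega>\<bar> \<partial>\<Omega>) \<le> sqrt (\<integral>\<omega>. (?U a \<omega>)\<^sup>2 \<partial>\<Omega>)"
        using elim by (intro expectation_abs_le_sqrt) (auto simp: square_int_def)
      finally show ?case by (simp add: mult_left_mono)
    qed
  qed
  from tendsto_add[OF this mart_char_limit[OF t D, of u]] show ?thesis by simp
qed

end


section \<open>Finite mean flight time\<close>

lemma nn_integral_gaussian_finite:
  fixes k :: real
  assumes k: "k > 0"
  shows "(\<integral>\<^sup>+x. ennreal (exp (- k * (norm x)\<^sup>2)) \<partial>(lborel :: ('a :: euclidean_space) measure)) < \<infinity>"
proof -
  have one: "(\<integral>\<^sup>+x. ennreal (exp (- k * x\<^sup>2)) \<partial>(lborel :: real measure)) < \<infinity>"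
  proof -
    define \<sigma> where "\<sigma> = sqrt (1 / (2 * k))"
    have s2: "\<sigma>\<^sup>2 = 1 / (2 * k)" using k by (simp add: \<sigma>_def)
    have "exp (- k * x\<^sup>2) = sqrt (2 * pi * \<sigma>\<^sup>2) * normal_density 0 \<sigma> x" for x
      using k by (simp add: normal_density_def s2)
    moreover have "\<sigma> > 0" using k by (simp add: \<sigma>_def)
    ultimately have "integrable lborel (\<lambda>x. exp (- k * x\<^sup>2))" by simp
    then show ?thesis by (simp add: integrable_iff_bounded)
  qed
  have "(norm x)\<^sup>2 = (\<Sum>b\<in>Basis. (x \<bullet> b)\<^sup>2)" for x :: 'a
    unfolding power2_norm_eq_inner by (subst euclidean_inner) (simp add: power2_eq_square)
  then have "ennreal (exp (- k * (norm x)\<^sup>2)) = (\<Prod>b\<in>Basis. ennreal (exp (- k * (x \<bullet> b)\<^sup>2)))" for x :: 'a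
    by (simp add: sum_distrib_left exp_sum sum_negf[symmetric] prod_ennreal)
  then have "(\<integral>\<^sup>+x. ennreal (exp (- k * (norm x)\<^sup>2)) \<partial>(lborel :: 'a measure))
      = (\<integral>\<^sup>+x. (\<Prod>b\<in>Basis. ennreal (exp (- k * (x \<bullet> b)\<^sup>2))) \<partial>(lborel :: 'a measure))"
    by simp
  also have "\<dots> = (\<Prod>b\<in>(Basis :: 'a set). \<integral>\<^sup>+x. ennreal (exp (- k * x\<^sup>2)) \<partial>lborel)"
    by (rule nn_integral_lborel_prod) auto
  also have "\<dots> < \<infinity>" using one by (simp add: power_less_top_ennreal)
  finally show ?thesis .
qed

lemma halfspace_measurable[measurable]: "halfspace i \<in> sets borel"
proof -
  have "open (halfspace i)"
    unfolding halfspace_def by (intro open_Collect_less continuous_intros)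
  then show ?thesis by simp
qed

lemma component_measurable[measurable]: "(\<lambda>v :: real ^ 'n::finite. v $ i) \<in> borel_measurable borel"
  by (intro borel_measurable_continuous_onI continuous_intros)

text \<open>The normal component in the density cancels against \<open>1 / v $ i\<close>, and a Gaussian integral
  remains.\<close>

lemma nn_integral_inverse_maxwellian:
  assumes "M > 0" "\<beta> > 0"
  shows "(\<integral>\<^sup>+v. ennreal (1 / v $ i) \<partial>maxwellian i M \<beta>) < \<infinity>"
proof -
  define c where "c = 2 * pi * (\<beta> * M / (2 * pi)) powr ((real CARD('a) + 1) / 2)"
  define k where "k = \<beta> * M / 2"
  have c: "c \<ge> 0" by (simp add: c_def)
  have k: "k > 0" using assms by (simp add: k_def)
  have [measurable]: "(\<lambda>v :: real ^ 'a. v $ i) \<in> borel_measurable (restrict_space lborel (halfspace i))"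
    by (intro measurable_restrict_space1) simp
  have [measurable]: "(\<lambda>v :: real ^ 'a. norm v) \<in> borel_measurable (restrict_space lborel (halfspace i))"
    by (intro measurable_restrict_space1) simp
  have "(\<integral>\<^sup>+v. ennreal (1 / v $ i) \<partial>maxwellian i M \<beta>)
      = (\<integral>\<^sup>+v. ennreal (c * (v $ i) * exp (- \<beta> * M * (norm v)\<^sup>2 / 2)) * ennreal (1 / v $ i) \<partial>restrict_space lborel (halfspace i))"
    unfolding maxwellian_def c_def by (rule nn_integral_density) measurable
  also have "\<dots> = (\<integral>\<^sup>+v. ennreal c * ennreal (exp (- k * (norm v)\<^sup>2)) \<partial>restrict_space lborel (halfspace i))"
  proof (rule nn_integral_cong)
    fix v assume "v \<in> space (restrict_space lborel (halfspace i))"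
    then have "v $ i > 0" by (simp add: space_restrict_space halfspace_def)
    then show "ennreal (c * (v $ i) * exp (- \<beta> * M * (norm v)\<^sup>2 / 2)) * ennreal (1 / v $ i) = ennreal c * ennreal (exp (- k * (norm v)\<^sup>2))"
      using c by (simp add: ennreal_mult'[symmetric] k_def mult_ac)
  qed
  also have "\<dots> = (\<integral>\<^sup>+v. ennreal c * ennreal (exp (- k * (norm v)\<^sup>2)) * indicator (halfspace i) v \<partial>lborel)"
    by (rule nn_integral_restrict_space) simp
  also have "\<dots> \<le> (\<integral>\<^sup>+v. ennreal c * ennreal (exp (- k * (norm v)\<^sup>2)) \<partial>(lborel :: (real ^ 'a) measure))"
    by (intro nn_integral_mono) (simp add: indicator_def)
  also have "\<dots> = ennreal c * (\<integral>\<^sup>+v. ennreal (exp (- k * (norm v)\<^sup>2)) \<partial>(lborel :: (real ^ 'a) measure))"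
    by (rule nn_integral_cmult) measurable
  also have "\<dots> < \<infinity>"
    using nn_integral_gaussian_finite[OF k, where 'a="real ^ 'a"] by (simp add: ennreal_mult_less_top)
  finally show ?thesis .
qed

text \<open>After the same cancellation the area of the hemisphere remains, divided by the normalising
  constant, which is not zero because the law has total mass one.\<close>

lemma nn_integral_inverse_cosine_law:
  fixes i :: "'n::finite"
  assumes "prob_space (cosine_law i s)"
  shows "(\<integral>\<^sup>+v. ennreal (1 / v $ i) \<partial>cosine_law i s) < \<infinity>"
proof -
  let ?R = "restrict_space (sphere_measure s) (halfspace i) :: (real ^ 'n) measure"
  define C where "C = (\<integral>\<^sup>+u. ennreal (u $ i) \<partial>?R)"
  have sets: "sets (sphere_measure s :: (real ^ 'n) measure) = sets borel" by (simp add: sphere_measure_def)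
  have [measurable]: "(\<lambda>v :: real ^ 'n. v $ i) \<in> borel_measurable ?R"
    by (intro measurable_restrict_space1) (simp add: measurable_cong_sets[OF sets refl])
  have "1 = emeasure (cosine_law i s) (space (cosine_law i s))"
    using assms by (simp add: prob_space.emeasure_space_1)
  also have "\<dots> = (\<integral>\<^sup>+v. ennreal (v $ i) / C \<partial>?R)"
    unfolding cosine_law_def C_def[symmetric]
    by (subst emeasure_density) (auto intro!: nn_integral_cong simp: indicator_def)
  also have "\<dots> = C / C" unfolding C_def by (rule nn_integral_divide) measurable
  finally have C: "C \<noteq> 0" by auto
  have "(\<integral>\<^sup>+v. ennreal (1 / v $ i) \<partial>cosine_law i s) = (\<integral>\<^sup>+v. ennreal (v $ i) / C * ennreal (1 / v $ i) \<partial>?R)"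
    unfolding cosine_law_def C_def[symmetric] by (rule nn_integral_density) measurable
  also have "\<dots> = (\<integral>\<^sup>+v. 1 / C \<partial>?R)"
  proof (rule nn_integral_cong)
    fix v assume "v \<in> space ?R"
    then have v: "v $ i > 0" by (simp add: space_restrict_space halfspace_def)
    have "ennreal (v $ i) / C * ennreal (1 / v $ i) = (ennreal (v $ i) * ennreal (1 / v $ i)) / C"
      by (simp add: divide_ennreal_def mult_ac)
    also have "ennreal (v $ i) * ennreal (1 / v $ i) = 1" using v by (simp add: ennreal_mult'[symmetric])
    finally show "ennreal (v $ i) / C * ennreal (1 / v $ i) = 1 / C" .
  qed
  also have "\<dots> = 1 / C * emeasure ?R (space ?R)" by simp
  also have "\<dots> < \<infinity>"
  proof -
    have "emeasure ?R (space ?R) \<le> emeasure (sphere_measure s :: (real ^ 'n) measure) UNIV"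
      by (subst emeasure_restrict_space) (auto simp: sets sets_eq_imp_space_eq[OF sets] space_restrict_space intro!: emeasure_mono)
    also have "\<dots> = ennreal (real CARD('n) / s) * emeasure lborel (cball 0 s :: (real ^ 'n) set)"
    proof -
      have "(\<lambda>x :: real ^ 'n. (s / norm x) *\<^sub>R x) \<in> borel_measurable (restrict_space lborel (cball 0 s))"
        by (intro measurable_restrict_space1) measurable
      then show ?thesis
        unfolding sphere_measure_def
        by (simp add: emeasure_scale_measure emeasure_distr emeasure_restrict_space space_restrict_space)
    qed
    also have "\<dots> < \<infinity>"
      using emeasure_bounded_finite[of "cball 0 s :: (real ^ 'n) set"] by (simp add: ennreal_mult_less_top)
    finally have "emeasure ?R (space ?R) < \<infinity>" .
    moreover have "1 / C < \<infinity>" using C by (simp add: divide_ennreal_def less_top[symmetric])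
    ultimately show ?thesis by (simp add: ennreal_mult_less_top)
  qed
  finally show ?thesis .
qed

lemma flight_time_measurable[measurable]: "flight_time i r \<in> borel_measurable (vel_space i)"
  unfolding flight_time_def[abs_def] vel_space_def by (intro measurable_restrict_space1) measurable

lemma flight_time_pos: "r > 0 \<Longrightarrow> v \<in> space (vel_space i) \<Longrightarrow> flight_time i r v > 0"
  by (simp add: flight_time_def vel_space_def space_restrict_space halfspace_def)

lemma integrable_flight_time:
  assumes "M > 0" "r > 0" and \<nu>: "prob_space \<nu>" "sets \<nu> = sets (vel_space i)" and nat: "natural_collision i M \<eta> \<nu>"
  shows "integrable \<nu> (flight_time i r)"
proof (rule integrableI_bounded)
  show [measurable]: "flight_time i r \<in> borel_measurable \<nu>"
    using flight_time_measurable by (simp add: measurable_cong_sets[OF \<nu>(2) refl])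
  have fin: "(\<integral>\<^sup>+v. ennreal (1 / v $ i) \<partial>\<nu>) < \<infinity>"
    using nat \<nu>(1) assms(1) nn_integral_inverse_maxwellian nn_integral_inverse_cosine_law
    unfolding natural_collision_def by blast
  have [measurable]: "(\<lambda>v. v $ i) \<in> borel_measurable \<nu>"
    unfolding measurable_cong_sets[OF \<nu>(2) refl] vel_space_def by (intro measurable_restrict_space1) measurable
  have "(\<integral>\<^sup>+v. ennreal (norm (flight_time i r v)) \<partial>\<nu>) = (\<integral>\<^sup>+v. ennreal (2 * r) * ennreal (1 / v $ i) \<partial>\<nu>)"
  proof (rule nn_integral_cong)
    fix v assume "v \<in> space \<nu>"
    then have "v $ i > 0" using sets_eq_imp_space_eq[OF \<nu>(2)] by (simp add: vel_space_def space_restrict_space halfspace_def)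
    then show "ennreal (norm (flight_time i r v)) = ennreal (2 * r) * ennreal (1 / v $ i)"
      using assms(2) by (simp add: flight_time_def ennreal_mult'[symmetric])
  qed
  also have "\<dots> = ennreal (2 * r) * (\<integral>\<^sup>+v. ennreal (1 / v $ i) \<partial>\<nu>)" by (rule nn_integral_cmult) measurable
  also have "\<dots> < \<infinity>" using fin by (simp add: ennreal_mult_less_top)
  finally show "(\<integral>\<^sup>+v. ennreal (norm (flight_time i r v)) \<partial>\<nu>) < \<infinity>" .
qed


section \<open>The central limit theorem\<close>

lemma normal_law_char:
  assumes "\<sigma>2 \<ge> 0"
  shows "real_distribution (normal_law \<sigma>2)"
    and "char (normal_law \<sigma>2) u = complex_of_real (exp (- (u\<^sup>2 * \<sigma>2 / 2)))"
proof -
  have "real_distribution (normal_law \<sigma>2) \<and> char (normal_law \<sigma>2) u = complex_of_real (exp (- (u\<^sup>2 * \<sigma>2 / 2)))"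
  proof (cases "\<sigma>2 = 0")
    case True
    have "real_distribution (return borel 0 :: real measure)"
      unfolding real_distribution_def real_distribution_axioms_def by (auto intro: prob_space_return)
    moreover have "char (return borel 0) u = 1"
      unfolding char_def by (subst integral_return) auto
    ultimately show ?thesis using True by (simp add: normal_law_def)
  next
    case False
    define \<sigma> where "\<sigma> = sqrt \<sigma>2"
    have s: "\<sigma> > 0" "\<sigma>\<^sup>2 = \<sigma>2" using False assms by (auto simp: \<sigma>_def)
    let ?N = "density lborel (\<lambda>x. ennreal (normal_density 0 \<sigma> x))"
    interpret N: prob_space ?N using s(1) by (rule prob_space_normal_density)
    have dist: "distributed ?N lborel (\<lambda>x. x) (\<lambda>x. ennreal (normal_density 0 \<sigma> x))"
      by (auto simp: distributed_def intro!: distr_id2)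
    then have "distributed ?N lborel (\<lambda>x. x / \<sigma>) std_normal_density"
      using N.normal_standard_normal_convert[OF s(1), of "\<lambda>x. x" 0] by simp
    then have std: "distr ?N lborel (\<lambda>x. x / \<sigma>) = std_normal_distribution"
      by (simp add: distributed_def)
    have "char ?N u = (\<integral>x. iexp ((u * \<sigma>) * (x / \<sigma>)) \<partial>?N)"
      unfolding char_def using s(1) by (intro Bochner_Integration.integral_cong) auto
    also have "\<dots> = (\<integral>y. iexp ((u * \<sigma>) * y) \<partial>distr ?N lborel (\<lambda>x. x / \<sigma>))"
      by (subst integral_distr) auto
    also have "\<dots> = char std_normal_distribution (u * \<sigma>)" unfolding std char_def ..
    also have "\<dots> = complex_of_real (exp (- (u\<^sup>2 * \<sigma>2 / 2)))"
      unfolding char_std_normal_distribution by (simp add: power_mult_distrib s(2))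
    finally have "char ?N u = complex_of_real (exp (- (u\<^sup>2 * \<sigma>2 / 2)))" .
    moreover have "real_distribution ?N"
      unfolding real_distribution_def real_distribution_axioms_def using N.prob_space_axioms by simp
    ultimately show ?thesis using False by (simp add: normal_law_def \<sigma>_def)
  qed
  then show "real_distribution (normal_law \<sigma>2)" "char (normal_law \<sigma>2) u = complex_of_real (exp (- (u\<^sup>2 * \<sigma>2 / 2)))"
    by auto
qed

lemma (in prob_space) conv_in_distribution_normalI:
  assumes X[measurable]: "\<And>a. X a \<in> borel_measurable M" and s: "\<sigma>2 \<ge> 0"
    and lim: "\<And>u. ((\<lambda>a. \<integral>x. iexp (u * X a x) \<partial>M) \<longlongrightarrow> complex_of_real (exp (- (u\<^sup>2 * \<sigma>2 / 2)))) at_top"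
  shows "conv_in_distribution M X (normal_law \<sigma>2)"
  unfolding conv_in_distribution_def
proof (intro allI impI)
  fix \<alpha> :: "nat \<Rightarrow> real" assume \<alpha>: "filterlim \<alpha> at_top sequentially"
  show "weak_conv_m (\<lambda>k. distr M borel (X (\<alpha> k))) (normal_law \<sigma>2)"
  proof (rule levy_continuity)
    show "real_distribution (distr M borel (X (\<alpha> k)))" for k
      by (rule real_distribution_distr) simp
    show "real_distribution (normal_law \<sigma>2)" by (rule normal_law_char(1)[OF s])
    fix u :: real
    have "char (distr M borel (X a)) u = (\<integral>x. iexp (u * X a x) \<partial>M)" for a
      unfolding char_def by (subst integral_distr) auto
    then show "(\<lambda>k. char (distr M borel (X (\<alpha> k))) u) \<longlonglongrightarrow> char (normal_law \<sigma>2) u"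
      unfolding normal_law_char(2)[OF s] using filterlim_compose[OF lim \<alpha>] by simp
  qed
qed

theorem theorem2:
  fixes i :: "'n::finite"
    and r M \<gamma> :: real
    and \<eta> :: "real ^ 'n \<Rightarrow> (real ^ 'n) measure"
    and \<nu> :: "(real ^ 'n) measure"
    and \<Omega> :: "'w measure"
    and V :: "nat \<Rightarrow> 'w \<Rightarrow> real ^ 'n"
    and Z :: "real ^ 'n \<Rightarrow> real"
  assumes "CARD('n) \<ge> 2" and "r > 0" and "M > 0"
    and "collision_kernel i \<eta>"
    and "natural_collision i M \<eta> \<nu>"
    and "quasi_compact \<eta> \<nu>"
    and "markov_chain \<Omega> (vel_space i) \<nu> \<eta> V"
    and "Z \<in> borel_measurable (vel_space i)"
    and "slowly_varying_observable \<nu> Z"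
    and "\<gamma> > 1"
    and "truncated_variance_assumption \<Omega> i r V Z \<gamma>"
  shows "\<exists>D. \<forall>t>0.
           ((\<lambda>a. 1 / (a\<^sup>2 * t) *
                 (\<integral>\<omega>. (\<Sum>j<scaled_collisions i r V a t \<omega>. truncate a (Z (V j \<omega>)))\<^sup>2 \<partial>\<Omega>))
              \<longlongrightarrow> D) at_top \<and>
           conv_in_distribution \<Omega>
             (\<lambda>a \<omega>. \<Sum>j<scaled_collisions i r V a t \<omega>. 1 / a * Z (V j \<omega>))
             (normal_law (t * D))"
proof -
  have "stationary \<eta> \<nu>" and db: "detailed_balance \<eta> \<nu>"
    using assms(5) unfolding natural_collision_def by auto
  then interpret c: stationary_chain \<Omega> "vel_space i" \<nu> \<eta> V
    using assms(4,7) by (auto simp: stationary_chain_def stationary_chain_axioms_def collision_kernel_def markov_chain_def)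
  obtain \<rho> where rho: "0 < \<rho>" "\<rho> < 1"
    "\<And>f. f \<in> bounded_measurable (vel_space i) \<Longrightarrow> (\<integral>v. f v \<partial>\<nu>) = 0 \<Longrightarrow>
      (\<integral>v. (kernel_avg \<eta> f v)\<^sup>2 \<partial>\<nu>) \<le> \<rho>\<^sup>2 * (\<integral>v. (f v)\<^sup>2 \<partial>\<nu>)"
    using c.spectral_gap[OF assms(6) db] by blast
  have fl: "integrable \<nu> (flight_time i r)"
    by (rule integrable_flight_time[OF assms(3,2) c.nu.prob_space_axioms c.sets_nu assms(5)])
  interpret observable_chain \<Omega> "vel_space i" \<nu> \<eta> V \<rho> "flight_time i r" Z r \<gamma>
    by unfold_locales (use rho fl assms flight_time_pos in auto)
  have count: "scaled_collisions i r V a t = count (clock t a)" for a t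
    by (simp add: fun_eq_iff scaled_collisions_def collisions_def count_def arrival_def clock_def area_def)
  have "\<exists>L. ((\<lambda>a. \<integral>\<omega>. (truncated_total t a \<omega>)\<^sup>2 \<partial>\<Omega>) \<longlongrightarrow> L) at_top" if "t > 0" for t
    using assms(11) that
    by (simp add: truncated_variance_assumption_def count truncated_total_def level_def)
  then obtain D where D: "(asymp_var \<longlongrightarrow> D) at_top" "D \<ge> 0"
    by (rule asymp_var_converges)
  show ?thesis
  proof (intro exI[of _ D] allI impI conjI)
    fix t :: real assume t: "t > 0"
    show "((\<lambda>a. 1 / (a\<^sup>2 * t) *
         (\<integral>\<omega>. (\<Sum>j<scaled_collisions i r V a t \<omega>. truncate a (Z (V j \<omega>)))\<^sup>2 \<partial>\<Omega>)) \<longlongrightarrow> D) at_top"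
      unfolding count by (rule full_second_moment[OF t D(1)])
    show "conv_in_distribution \<Omega> (\<lambda>a \<omega>. \<Sum>j<scaled_collisions i r V a t \<omega>. 1 / a * Z (V j \<omega>)) (normal_law (t * D))"
      unfolding count using t D(2)
      by (intro c.conv_in_distribution_normalI observable_char_limit[OF t D(1)]) auto
  qed
qed

end
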